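(* Let $\Gamma\subset SL(2,\mathbb{R})$ be a non-uniform lattice and $X=SL(2,\mathbb{R})/\Gamma$. Given $x_0,x\in X$ such that $x$ is not cuspidal, let $$\gamma=\gamma(x)=\limsup_{t\to\infty}\frac{d(g_tx,x_0)}{t},$$ and suppose $\gamma>0$. Then for all $S>0$, $\epsilon\in(0,\gamma)$ and $\delta\in(0,1)$, there are $s_0>S$ and $\kappa>0$ such that, writing $C=B(x_0,\kappa\log s_0)$, $$\left|\int_{-s_0}^{s_0}\chi_C(h_sx)\,ds-2s_0\,\mu(C)\right|\ge s_0^{\gamma-\epsilon}(1-\delta).$$
   Context: A non-uniform lattice is a discrete subgroup $\Gamma$ of $SL(2,\mathbb{R})$ with $SL(2,\mathbb{R})/\Gamma$ of finite volume and non-compact. $X=SL(2,\mathbb{R})/\Gamma$ is viewed as the unit tangent bundle of the hyperbolic orbifold $\mathbb{H}^2/\Gamma=SO(2)\backslash SL(2,\mathbb{R})/\Gamma$, with the hyperbolic metric normalized to have curvature $-1$. For $x,y\in X$, $d(x,y)$ denotes the hyperbolic distance between their projections to $\mathbb{H}^2/\Gamma$, and $B(x,R)=\{y\in X:d(x,y)<R\}$. $\chi_C$ is the indicator function of $C$, and $\mu$ is the $SL(2,\mathbb{R})$-invariant probability measure on $X$ induced by normalized Haar measure. The one-parameter groups $$g_t=\begin{pmatrix}e^{t/2}&0\\0&e^{-t/2}\end{pmatrix},\qquad h_s=\begin{pmatrix}1&0\\ s&1\end{pmatrix}$$ act on $X$ by left multiplication; $H=\{h_s:s\in\mathbb{R}\}$.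 A point $x\in X$ is called cuspidal if $Hx$ is closed in $X$, equivalently if $\{g_tx\}_{t\ge0}$ is divergent in $X$ (leaves every compact set). *)

theory Defs
  imports "HOL-Analysis.Analysis" "HOL-Algebra.Left_Coset"
begin

definition SL2R :: "(real^2^2) monoid" where
  "SL2R = \<lparr>carrier = {A. det A = 1}, monoid.mult = (**), one = mat 1\<rparr>"

lemma group_SL2R: "group SL2R"
proof (rule groupI)
  fix A assume "A \<in> carrier SL2R"
  then have A: "det A = 1" by (simp add: SL2R_def)
  then have inv: "invertible A" by (simp add: invertible_det_nz)
  then obtain B where B: "A ** B = mat 1" "B ** A = mat 1"
    unfolding invertible_def by blast
  have "det B = 1" using B(1) A by (metis det_I det_mul mult_1)
  with B show "\<exists>B\<in>carrier SL2R. B \<otimes>\<^bsub>SL2R\<^esub> A = \<one>\<^bsub>SL2R\<^esub>"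
    by (auto simp: SL2R_def)
qed (auto simp: SL2R_def det_mul matrix_mul_assoc)

text \<open>The points of \<open>SL(2,\<real>)/\<Gamma>\<close> are the cosets \<open>g\<Gamma>\<close>, as sets of matrices; the left action of
  \<open>g\<close> on a point \<open>x\<close> is the translate \<open>g <# x\<close>.\<close>

abbreviation quotient_space :: "(real^2^2) set \<Rightarrow> (real^2^2) set set" where
  "quotient_space \<Gamma> \<equiv> lcosets\<^bsub>SL2R\<^esub> \<Gamma>"

abbreviation act :: "real^2^2 \<Rightarrow> (real^2^2) set \<Rightarrow> (real^2^2) set" (infixr \<open>\<bullet>\<^sub>X\<close> 70) where
  "g \<bullet>\<^sub>X x \<equiv> g <#\<^bsub>SL2R\<^esub> x"

definition quotient_topology :: "(real^2^2) set \<Rightarrow> (real^2^2) set topology" where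
  "quotient_topology \<Gamma> = topology (\<lambda>U. U \<subseteq> quotient_space \<Gamma> \<and>
     openin (top_of_set (carrier SL2R)) {g \<in> carrier SL2R. g \<bullet>\<^sub>X \<Gamma> \<in> U})"

lemma openin_quotient_topology:
  "openin (quotient_topology \<Gamma>) U \<longleftrightarrow> U \<subseteq> quotient_space \<Gamma> \<and>
     openin (top_of_set (carrier SL2R)) {g \<in> carrier SL2R. g \<bullet>\<^sub>X \<Gamma> \<in> U}"
proof -
  have "istopology (\<lambda>U. U \<subseteq> quotient_space \<Gamma> \<and>
     openin (top_of_set (carrier SL2R)) {g \<in> carrier SL2R. g \<bullet>\<^sub>X \<Gamma> \<in> U})" (is "istopology ?P")
    unfolding istopology_def
  proof (intro conjI allI impI)
    fix S T assume "?P S" "?P T"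
    moreover have "{g \<in> carrier SL2R. g \<bullet>\<^sub>X \<Gamma> \<in> S \<inter> T} =
      {g \<in> carrier SL2R. g \<bullet>\<^sub>X \<Gamma> \<in> S} \<inter> {g \<in> carrier SL2R. g \<bullet>\<^sub>X \<Gamma> \<in> T}" by auto
    ultimately show "S \<inter> T \<subseteq> quotient_space \<Gamma>"
      "openin (top_of_set (carrier SL2R)) {g \<in> carrier SL2R. g \<bullet>\<^sub>X \<Gamma> \<in> S \<inter> T}"
      by (auto intro: openin_Int)
  next
    fix K assume K: "\<forall>S\<in>K. ?P S"
    then show "\<Union>K \<subseteq> quotient_space \<Gamma>" by auto
    have "{g \<in> carrier SL2R. g \<bullet>\<^sub>X \<Gamma> \<in> \<Union>K} =
      \<Union>((\<lambda>S. {g \<in> carrier SL2R. g \<bullet>\<^sub>X \<Gamma> \<in> S}) ` K)" by auto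
    with K show "openin (top_of_set (carrier SL2R)) {g \<in> carrier SL2R. g \<bullet>\<^sub>X \<Gamma> \<in> \<Union>K}"
      by (metis (no_types, lifting) imageE openin_Union)
  qed
  then show ?thesis by (simp add: quotient_topology_def topology_inverse')
qed

lemma topspace_quotient_topology: "topspace (quotient_topology \<Gamma>) = quotient_space \<Gamma>"
proof -
  have "{g \<in> carrier SL2R. g \<bullet>\<^sub>X \<Gamma> \<in> quotient_space \<Gamma>} = carrier SL2R"
    by (auto simp: LCOSETS_def)
  then have "openin (quotient_topology \<Gamma>) (quotient_space \<Gamma>)"
    by (simp add: openin_quotient_topology)
  then show ?thesis
    by (metis openin_quotient_topology openin_subset openin_topspace subset_antisym)
qed

lemma quotient_map_quotient_topology:
  "quotient_map (top_of_set (carrier SL2R)) (quotient_topology \<Gamma>) (\<lambda>g. g \<bullet>\<^sub>X \<Gamma>)"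
  by (auto simp: quotient_map_def topspace_quotient_topology openin_quotient_topology LCOSETS_def)

definition haar_measure :: "(real^2^2) measure \<Rightarrow> bool" where
  "haar_measure m \<longleftrightarrow>
     sets m = sets (restrict_space borel (carrier SL2R)) \<and>
     (\<forall>g\<in>carrier SL2R. \<forall>E\<in>sets m. emeasure m ((\<lambda>a. g ** a) ` E) = emeasure m E) \<and>
     (\<forall>K. compact K \<and> K \<subseteq> carrier SL2R \<longrightarrow> emeasure m K < \<infinity>) \<and>
     emeasure m (carrier SL2R) \<noteq> 0"

text \<open>The Borel measure on \<open>SL(2,\<real>)/\<Gamma>\<close> (\<open>\<Gamma>\<close> discrete) which the projection matches locally with a
  given Haar measure. As the projection is a local homeomorphism, this determines the measure, and
  the measure is invariant under the left action because Haar measure is.\<close>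

definition induced_measure ::
    "(real^2^2) set \<Rightarrow> (real^2^2) measure \<Rightarrow> (real^2^2) set measure \<Rightarrow> bool" where
  "induced_measure \<Gamma> m \<mu> \<longleftrightarrow>
     space \<mu> = quotient_space \<Gamma> \<and>
     sets \<mu> = sigma_sets (quotient_space \<Gamma>) {U. openin (quotient_topology \<Gamma>) U} \<and>
     (\<forall>E\<in>sets m. inj_on (\<lambda>g. g \<bullet>\<^sub>X \<Gamma>) E \<longrightarrow> emeasure \<mu> ((\<lambda>g. g \<bullet>\<^sub>X \<Gamma>) ` E) = emeasure m E)"

definition lattice_in_SL2R :: "(real^2^2) set \<Rightarrow> bool" where
  "lattice_in_SL2R \<Gamma> \<longleftrightarrow> subgroup \<Gamma> SL2R \<and> discrete \<Gamma> \<and>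
     (\<exists>m \<mu>. haar_measure m \<and> induced_measure \<Gamma> m \<mu> \<and> emeasure \<mu> (quotient_space \<Gamma>) < \<infinity>)"

definition nonuniform_lattice :: "(real^2^2) set \<Rightarrow> bool" where
  "nonuniform_lattice \<Gamma> \<longleftrightarrow> lattice_in_SL2R \<Gamma> \<and> \<not> compact_space (quotient_topology \<Gamma>)"

text \<open>The normalised invariant measure: Haar measure is only determined up to scaling, and its scale
  is fixed here by requiring total mass 1 on the quotient.\<close>

definition normalized_haar_quotient :: "(real^2^2) set \<Rightarrow> (real^2^2) set measure \<Rightarrow> bool" where
  "normalized_haar_quotient \<Gamma> \<mu> \<longleftrightarrow>
     emeasure \<mu> (quotient_space \<Gamma>) = 1 \<and> (\<exists>m. haar_measure m \<and> induced_measure \<Gamma> m \<mu>)"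

text \<open>Distance of the curvature \<open>-1\<close> metric \<open>(dx\<^sup>2 + dy\<^sup>2)/y\<^sup>2\<close> on the upper half-plane.\<close>

definition hyp_dist :: "complex \<Rightarrow> complex \<Rightarrow> real" where
  "hyp_dist z w = arcosh (1 + (cmod (z - w))\<^sup>2 / (2 * Im z * Im w))"

definition moebius :: "real^2^2 \<Rightarrow> complex \<Rightarrow> complex" where
  "moebius A z = (of_real (A$1$1) * z + of_real (A$1$2)) / (of_real (A$2$1) * z + of_real (A$2$2))"

text \<open>\<open>SO(2)g \<mapsto> g\<^sup>-\<^sup>1\<cdot>\<i>\<close> identifies the orbits of left multiplication by \<open>SO(2)\<close> with
  the points of the upper half-plane, and turns right multiplication by \<open>\<gamma>\<close> into the isometry \<open>\<gamma>\<^sup>-\<^sup>1\<close>. The coset \<open>g\<Gamma>\<close> is thus mapped to a full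
  \<open>\<Gamma>\<close>-orbit, and the distance in the orbifold is the distance between the two orbits.\<close>

definition half_plane_point :: "real^2^2 \<Rightarrow> complex" where
  "half_plane_point g = moebius (matrix_inv g) \<i>"

definition orbifold_dist :: "(real^2^2) set \<Rightarrow> (real^2^2) set \<Rightarrow> real" where
  "orbifold_dist x y = (INF (a, b) \<in> x \<times> y. hyp_dist (half_plane_point a) (half_plane_point b))"

definition orbifold_ball ::
    "(real^2^2) set \<Rightarrow> (real^2^2) set \<Rightarrow> real \<Rightarrow> (real^2^2) set set" where
  "orbifold_ball \<Gamma> x R = {y \<in> quotient_space \<Gamma>. orbifold_dist x y < R}"

definition geodesic_flow :: "real \<Rightarrow> real^2^2" where
  "geodesic_flow t = vector [vector [exp (t/2), 0], vector [0, exp (- t/2)]]"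

definition horocycle_flow :: "real \<Rightarrow> real^2^2" where
  "horocycle_flow s = vector [vector [1, 0], vector [s, 1]]"

definition cuspidal :: "(real^2^2) set \<Rightarrow> (real^2^2) set \<Rightarrow> bool" where
  "cuspidal \<Gamma> x \<longleftrightarrow> closedin (quotient_topology \<Gamma>) (range (\<lambda>s. horocycle_flow s \<bullet>\<^sub>X x))"

end

theory Submission
  imports Defs
begin

text \<open>
  With \<open>g\<close>, \<open>h\<close> representing two points of the quotient, the orbifold distance \<open>d\<close> satisfies
  \<open>2 cosh d = inf \<parallel>g \<gamma> h\<^sup>-\<^sup>1\<parallel>\<^sup>2\<close> over \<open>\<gamma>\<close> in \<open>\<Gamma>\<close> (Frobenius norm), so the triangle inequality becomes
  submultiplicativity. Unipotent elements of \<open>\<Gamma>\<close> are encoded by vectors \<open>w\<close>, with \<open>\<parallel>g w\<parallel>\<^sup>2\<close> the size of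
  the element seen from \<open>g\<close>. A commutator argument for elements of least size together with the finite
  volume shows that a point at distance \<open>d\<close> from the base point has such a vector with
  \<open>\<parallel>g w\<parallel>\<^sup>2 \<le> K e\<^sup>-\<^sup>d\<close>, and conversely a short vector forces a large distance. Packing translates of
  the set of points with a short vector bounds the measure of the complement of a ball of radius \<open>R\<close>
  by a multiple of \<open>e\<^sup>-\<^sup>R\<close>.

  If \<open>g\<^sub>t x\<close> is at distance about \<open>\<gamma> t\<close>, its short vector stays short along a piece of the horocycle
  through \<open>x\<close>: with \<open>s\<^sub>0\<close> about \<open>e\<^sup>t\<close> and \<open>\<kappa> = 1 - \<gamma> + \<epsilon>\<close>, the points \<open>h\<^sub>s x\<close> avoid the ball
  for a set of \<open>s\<close> of length at least a multiple of \<open>s\<^sub>0\<^sup>\<gamma>\<^sup>-\<^sup>3\<^sup>\<epsilon>\<^sup>/\<^sup>4\<close>, whereas equidistribution would allow only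
  \<open>O(s\<^sub>0\<^sup>1\<^sup>-\<^sup>\<kappa>) = O(s\<^sub>0\<^sup>\<gamma>\<^sup>-\<^sup>\<epsilon>)\<close>.
\<close>

section \<open>Two-by-two matrices\<close>

text \<open>No fundamental domain and no list of cusps enters; everything about the ends of the
  quotient is drawn from discreteness and the total mass 1. Haar measure is given as left invariant,
  but the neighbourhoods packed around thick points are images of right translates U g. Their
  measures agree because SL(2,R) is unimodular, and this is why unimodularity is proved first.

  The exponents come from one computation. The matrix \<open>horocycle_flow s\<close> fixes the
  first coordinate v1 of a vector and turns the second into (s - z) v1 with z = - v2 / v1, so the
  vector is shortest at s = z. This time has to lie in the window, which dictates
  \<open>s\<^sub>0\<close> = 2 e^T for a T with |v2| <= e^T |v1|. An excursion of rate b = \<gamma>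
  - \<epsilon>/2 gives v1^2 = O(e^(-(1 + b) T)), hence squared length O(\<open>s\<^sub>0\<close>^(2
  \<beta> - 1 - b)) for |s - z| up to \<open>s\<^sub>0\<close>^\<beta>. Leaving the ball requires
  the exponent -\<kappa>, so \<beta> is the mean of b and \<gamma> - \<epsilon>, and the room
  between \<beta> and \<gamma> - \<epsilon> absorbs the constants.\<close>

definition mat2 :: "real \<Rightarrow> real \<Rightarrow> real \<Rightarrow> real \<Rightarrow> real^2^2" where
  "mat2 a b c d = vector [vector [a, b], vector [c, d]]"

lemma mat2_nth [simp]:
  "mat2 a b c d $ 1 $ 1 = a" "mat2 a b c d $ 1 $ 2 = b"
  "mat2 a b c d $ 2 $ 1 = c" "mat2 a b c d $ 2 $ 2 = d"
  by (simp_all add: mat2_def)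

lemma mat2_eq_iff: "A = B \<longleftrightarrow>
    A$1$1 = B$1$1 \<and> A$1$2 = B$1$2 \<and> A$2$1 = B$2$1 \<and> A$2$2 = (B$2$2 :: real)"
  for A B :: "real^2^2"
  by (auto simp: vec_eq_iff forall_2)

lemma vec2_eq_iff: "v = w \<longleftrightarrow> v$1 = w$1 \<and> v$2 = (w$2 :: real)" for v w :: "real^2"
  by (auto simp: vec_eq_iff forall_2)

lemma matrix_mult_nth2: "(A ** B)$i$j = A$i$1 * B$1$j + A$i$2 * (B$2$j :: real)"
  for A B :: "real^2^2"
  by (simp add: matrix_matrix_mult_def sum_2)

lemma matrix_vector_nth2: "(A *v v)$i = A$i$1 * v$1 + A$i$2 * (v$2 :: real)"
  for A :: "real^2^2"
  by (simp add: matrix_vector_mult_def sum_2)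

lemma mat_nth2 [simp]: "(mat k :: real^2^2)$1$1 = k" "(mat k :: real^2^2)$1$2 = 0"
  "(mat k :: real^2^2)$2$1 = 0" "(mat k :: real^2^2)$2$2 = k"
  by (simp_all add: mat_def)

lemmas entry_simps = mat2_eq_iff vec2_eq_iff matrix_mult_nth2 matrix_vector_nth2 det_2

lemma norm_sq_vec2: "(norm v)\<^sup>2 = (v$1)\<^sup>2 + (v$2)\<^sup>2" for v :: "real^2"
  unfolding power2_norm_eq_inner by (simp add: inner_vec_def sum_2 power2_eq_square)

lemma norm_sq_mat2: "(norm A)\<^sup>2 = (A$1$1)\<^sup>2 + (A$1$2)\<^sup>2 + (A$2$1)\<^sup>2 + (A$2$2)\<^sup>2" for A :: "real^2^2"
  unfolding power2_norm_eq_inner by (simp add: inner_vec_def sum_2 power2_eq_square)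

lemma cauchy_schwarz2: "(a*c + b*d)\<^sup>2 \<le> (a\<^sup>2 + b\<^sup>2) * (c\<^sup>2 + d\<^sup>2)" for a b c d :: real
proof -
  have "(a\<^sup>2 + b\<^sup>2) * (c\<^sup>2 + d\<^sup>2) - (a*c + b*d)\<^sup>2 = (a*d - b*c)\<^sup>2"
    by (simp add: power2_eq_square algebra_simps)
  then show ?thesis using zero_le_power2[of "a*d - b*c"] by linarith
qed

lemma norm_matrix_mult_le: "norm (A ** B) \<le> norm A * norm B" for A B :: "real^2^2"
proof (rule power2_le_imp_le)
  have "(norm (A ** B))\<^sup>2 \<le>
      ((A$1$1)\<^sup>2 + (A$1$2)\<^sup>2) * ((B$1$1)\<^sup>2 + (B$2$1)\<^sup>2)
    + ((A$1$1)\<^sup>2 + (A$1$2)\<^sup>2) * ((B$1$2)\<^sup>2 + (B$2$2)\<^sup>2)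
    + ((A$2$1)\<^sup>2 + (A$2$2)\<^sup>2) * ((B$1$1)\<^sup>2 + (B$2$1)\<^sup>2)
    + ((A$2$1)\<^sup>2 + (A$2$2)\<^sup>2) * ((B$1$2)\<^sup>2 + (B$2$2)\<^sup>2)"
    unfolding norm_sq_mat2 matrix_mult_nth2 by (intro add_mono cauchy_schwarz2)
  also have "\<dots> = (norm A * norm B)\<^sup>2"
    unfolding power_mult_distrib norm_sq_mat2 by (simp add: algebra_simps)
  finally show "(norm (A ** B))\<^sup>2 \<le> (norm A * norm B)\<^sup>2" .
qed simp

lemma norm_matrix_vector_le: "norm (A *v v) \<le> norm A * norm v" for A :: "real^2^2"
proof (rule power2_le_imp_le)
  have "(norm (A *v v))\<^sup>2 \<le> ((A$1$1)\<^sup>2 + (A$1$2)\<^sup>2) * ((v$1)\<^sup>2 + (v$2)\<^sup>2)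
    + ((A$2$1)\<^sup>2 + (A$2$2)\<^sup>2) * ((v$1)\<^sup>2 + (v$2)\<^sup>2)"
    unfolding norm_sq_vec2 matrix_vector_nth2 by (intro add_mono cauchy_schwarz2)
  also have "\<dots> = (norm A * norm v)\<^sup>2"
    unfolding power_mult_distrib norm_sq_mat2 norm_sq_vec2 by (simp add: algebra_simps)
  finally show "(norm (A *v v))\<^sup>2 \<le> (norm A * norm v)\<^sup>2" .
qed simp

text \<open>Stands in for the inverse: the two agree on determinant 1, and being linear in the
  entries this one is continuous and keeps the norm everywhere.\<close>

definition adj2 :: "real^2^2 \<Rightarrow> real^2^2" where
  "adj2 A = mat2 (A$2$2) (- A$1$2) (- A$2$1) (A$1$1)"

lemma adj2_nth [simp]: "adj2 A $ 1 $ 1 = A$2$2" "adj2 A $ 1 $ 2 = - A$1$2"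
  "adj2 A $ 2 $ 1 = - A$2$1" "adj2 A $ 2 $ 2 = A$1$1"
  by (simp_all add: adj2_def)

lemma norm_adj2 [simp]: "norm (adj2 A) = norm A"
  by (rule power2_eq_imp_eq) (simp_all add: norm_sq_mat2)

lemma det_adj2 [simp]: "det (adj2 A) = det A"
  by (simp add: det_2)

lemma adj2_adj2 [simp]: "adj2 (adj2 A) = A"
  by (simp add: mat2_eq_iff)

lemma adj2_mat1 [simp]: "adj2 (mat 1) = mat 1"
  by (simp add: entry_simps)

lemma adj2_mult: "adj2 (A ** B) = adj2 B ** adj2 A"
  by (simp add: entry_simps algebra_simps)

lemma mult_adj2: "det A = 1 \<Longrightarrow> A ** adj2 A = mat 1"
  and adj2_mult_self: "det A = 1 \<Longrightarrow> adj2 A ** A = mat 1" for A :: "real^2^2"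
  by (simp_all add: entry_simps algebra_simps)

lemma mult_adj2_cancel:
  fixes A B :: "real^2^2"
  assumes "det A = 1"
  shows "A ** (adj2 A ** B) = B" "adj2 A ** (A ** B) = B"
    "(B ** A) ** adj2 A = B" "(B ** adj2 A) ** A = B"
  by (simp_all add: assms matrix_mul_assoc mult_adj2 adj2_mult_self)
    (simp_all add: assms matrix_mul_assoc[symmetric] mult_adj2 adj2_mult_self)

lemma adj2_vector_cancel:
  fixes A :: "real^2^2"
  assumes "det A = 1"
  shows "A *v (adj2 A *v v) = v" "adj2 A *v (A *v v) = v"
  by (simp_all add: assms matrix_vector_mul_assoc mult_adj2 adj2_mult_self)

lemma matrix_inv_eq_adj2: 
  fixes A :: "real^2^2"
  assumes "det A = 1" shows "matrix_inv A = adj2 A"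
proof -
  have "invertible A" using assms by (simp add: invertible_det_nz)
  then have "A ** matrix_inv A = mat 1"
    unfolding matrix_inv_def invertible_def by (rule someI2_ex) blast
  then have "adj2 A ** (A ** matrix_inv A) = adj2 A" by simp
  then show ?thesis by (simp add: mult_adj2_cancel assms)
qed

text \<open>By ad - bc = 1 the difference is (a - d)^2 + (b + c)^2. The bound makes half the squared
  norm an admissible argument of \<open>arcosh\<close>.\<close>

lemma norm_sq_SL2_ge_2: fixes A :: "real^2^2" assumes "det A = 1" shows "2 \<le> (norm A)\<^sup>2"
proof -
  have "1 = A$1$1 * A$2$2 - A$1$2 * A$2$1" using assms by (simp add: det_2)
  moreover have "0 \<le> (A$1$1 - A$2$2)\<^sup>2 + (A$1$2 + A$2$1)\<^sup>2" by simp
  ultimately show ?thesis unfolding norm_sq_mat2 by (simp add: power2_eq_square algebra_simps)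
qed

text \<open>For det g = 1 and \<eta> in the group, g \<eta> = (\<open>conj2 g \<eta>\<close>) g. So
  this is \<eta> as seen from g: when it is close to 1, the projection to the quotient is barely
  injective around g.\<close>

definition conj2 :: "real^2^2 \<Rightarrow> real^2^2 \<Rightarrow> real^2^2" where
  "conj2 g A = g ** A ** adj2 g"

lemma conj2_conj2: "conj2 g (conj2 h A) = conj2 (g ** h) A"
  by (simp add: conj2_def adj2_mult matrix_mul_assoc)

lemma conj2_adj2: "det g = 1 \<Longrightarrow> conj2 (adj2 g) (conj2 g A) = A"
  by (simp add: conj2_conj2 adj2_mult_self) (simp add: conj2_def)

lemma conj2_mult: "det g = 1 \<Longrightarrow> conj2 g (A ** B) = conj2 g A ** conj2 g B"
  by (simp add: conj2_def matrix_mul_assoc[symmetric] mult_adj2_cancel)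

lemma conj2_add: "conj2 g (A + B) = conj2 g A + conj2 g B"
  by (simp add: conj2_def matrix_add_ldistrib) (simp add: entry_simps algebra_simps)

lemma conj2_scaleR: "conj2 g (c *\<^sub>R A) = c *\<^sub>R conj2 g A"
  by (simp add: conj2_def entry_simps algebra_simps)

lemma conj2_mat1: "det g = 1 \<Longrightarrow> conj2 g (mat 1) = mat 1"
  by (simp add: conj2_def mult_adj2)

lemma det_conj2: "det g = 1 \<Longrightarrow> det (conj2 g A) = det A"
  by (simp add: conj2_def det_mul)

lemma norm_conj2_le: "norm (conj2 g A) \<le> (norm g)\<^sup>2 * norm A"
proof -
  have "norm (conj2 g A) \<le> norm (g ** A) * norm g"
    unfolding conj2_def using norm_matrix_mult_le[of "g ** A" "adj2 g"] by simp
  also have "\<dots> \<le> (norm g * norm A) * norm g"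
    by (intro mult_right_mono norm_matrix_mult_le) simp
  finally show ?thesis by (simp add: power2_eq_square algebra_simps)
qed

text \<open>An element of \<open>SL(2,\<real>)\<close> is \<open>\<plusminus>1\<close> iff its traceless part vanishes, so the norm of that part measures the
  distance to the centre, uniformly in the sign.\<close>

definition tl2 :: "real^2^2 \<Rightarrow> real^2^2" where
  "tl2 A = mat2 ((A$1$1 - A$2$2) / 2) (A$1$2) (A$2$1) ((A$2$2 - A$1$1) / 2)"

lemma tl2_nth [simp]: "tl2 A $ 1 $ 1 = (A$1$1 - A$2$2) / 2" "tl2 A $ 1 $ 2 = A$1$2"
  "tl2 A $ 2 $ 1 = A$2$1" "tl2 A $ 2 $ 2 = (A$2$2 - A$1$1) / 2"
  by (simp_all add: tl2_def)

lemma tl2_decomp: "A = mat ((A$1$1 + A$2$2) / 2) + tl2 A"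
  by (simp add: entry_simps field_simps)

lemma tl2_conj2:
  assumes "det g = 1"
  shows "tl2 (conj2 g A) = conj2 g (tl2 A)"
proof -
  define t where "t = (A$1$1 + A$2$2) / 2"
  define N where "N = conj2 g (tl2 A)"
  have "N$1$1 + N$2$2 = 0"
    by (simp add: N_def conj2_def matrix_mult_nth2 field_simps)
  then have "tl2 (mat t + N) = N" by (auto simp: entry_simps)
  moreover have "mat t = t *\<^sub>R (mat 1 :: real^2^2)" by (simp add: entry_simps)
  then have "conj2 g A = mat t + N"
    by (subst tl2_decomp[of A]) (simp add: conj2_add conj2_scaleR conj2_mat1 assms t_def N_def)
  ultimately show ?thesis by (simp add: N_def)
qed

text \<open>Scalar and traceless parts are orthogonal in the Frobenius norm, and A - 1 has the same
  traceless part as A.\<close>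

lemma norm_tl2_le: "norm (tl2 A) \<le> norm (A - mat 1)"
proof (rule power2_le_imp_le)
  have "(norm (A - mat 1))\<^sup>2 - (norm (tl2 A))\<^sup>2 = (A$1$1 + A$2$2 - 2)\<^sup>2 / 2"
    unfolding norm_sq_mat2 by (simp add: power_divide) (simp add: power2_eq_square algebra_simps)
  then show "(norm (tl2 A))\<^sup>2 \<le> (norm (A - mat 1))\<^sup>2" 
    using zero_le_power2[of "A$1$1 + A$2$2 - 2"] by linarith
qed simp

lemma tl2_eq_0_cases: 
  assumes "det A = 1" "tl2 A = 0"
  obtains "A = mat 1" | "A = - mat 1"
proof -
  have "A$1$2 = 0" "A$2$1 = 0" "A$1$1 = A$2$2"
    using tl2_nth[of A] unfolding assms(2) by simp_all
  moreover have "A$2$2 * A$2$2 = 1" using assms(1) calculation by (simp add: det_2)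
  then have "A$2$2 = 1 \<or> A$2$2 = -1" by (simp add: square_eq_1_iff)
  ultimately show ?thesis using that by (auto simp: mat2_eq_iff)
qed

text \<open>The other candidate, -1, lies at distance sqrt 8 from 1.\<close>

lemma tl2_eq_0_near_1:
  assumes "det A = 1" "tl2 A = 0" "norm (A - mat 1) < 1"
  shows "A = mat 1"
  using assms(1,2)
proof (cases rule: tl2_eq_0_cases)
  case 2
  then have "(norm (A - mat 1))\<^sup>2 = 8" by (simp add: norm_sq_mat2)
  moreover have "(norm (A - mat 1))\<^sup>2 \<le> 1\<^sup>2" using assms(3) by (intro power_mono) auto
  ultimately show ?thesis by simp
qed

lemma abs_det_le_norm_sq: "\<bar>det A\<bar> \<le> (norm A)\<^sup>2" for A :: "real^2^2"
proof -
  have "\<bar>a*d - b*c\<bar> \<le> a\<^sup>2 + b\<^sup>2 + c\<^sup>2 + d\<^sup>2" for a b c d :: real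
    using zero_le_power2[of "a-d"] zero_le_power2[of "a+d"] zero_le_power2[of "b-c"] zero_le_power2[of "b+c"]
     zero_le_power2[of a] zero_le_power2[of b] zero_le_power2[of c] zero_le_power2[of d]
    by (simp add: power2_eq_square algebra_simps abs_le_iff)
  from this[of "A$1$1" "A$2$2" "A$1$2" "A$2$1"] show ?thesis
    by (simp add: norm_sq_mat2 det_2)
qed

text \<open>The determinant ties the trace to the traceless part: det (\<open>tl2 A\<close>) = 1 -
  (tr A / 2)^2. Hence a bound on the traceless part alone bounds the whole matrix.\<close>

lemma norm_SL2_le: assumes "det A = 1" shows "(norm A)\<^sup>2 \<le> 2 + 3 * (norm (tl2 A))\<^sup>2"
proof -
  have "det (tl2 A) = 1 - ((A$1$1 + A$2$2) / 2)\<^sup>2"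
    using assms by (simp add: det_2 power2_eq_square field_simps)
  then have "((A$1$1 + A$2$2) / 2)\<^sup>2 \<le> 1 + (norm (tl2 A))\<^sup>2"
    using abs_det_le_norm_sq[of "tl2 A"] by linarith
  moreover have "(norm A)\<^sup>2 = 2 * ((A$1$1 + A$2$2) / 2)\<^sup>2 + (norm (tl2 A))\<^sup>2"
    unfolding norm_sq_mat2 by (simp add: power_divide) (simp add: power2_eq_square field_simps)
  ultimately show ?thesis by linarith
qed

text \<open>The entries of AB = BA are, up to sign, the 2x2 minors of the vectors (difference of the
  diagonal entries, upper right, lower left) of A and B, so these vectors are parallel. The cases
  choose a nonzero coordinate to divide by.\<close>

lemma commuting_tl2_proportional:
  assumes "A ** B = B ** A" "tl2 A \<noteq> 0"
  obtains c where "tl2 B = c *\<^sub>R tl2 A"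
proof -
  have c: "(A ** B)$i$j = (B ** A)$i$j" for i j by (simp add: assms(1))
  have e: "A$1$2 * B$2$1 = B$1$2 * A$2$1" 
    "(A$1$1 - A$2$2) * B$1$2 = (B$1$1 - B$2$2) * A$1$2"
    "(A$1$1 - A$2$2) * B$2$1 = (B$1$1 - B$2$2) * A$2$1"
    using c[of 1 1] c[of 1 2] c[of 2 1] unfolding matrix_mult_nth2 by algebra+
  have proportional: "tl2 B = c *\<^sub>R tl2 A"
    if "B$1$2 = c * A$1$2" "B$2$1 = c * A$2$1" "B$1$1 - B$2$2 = c * (A$1$1 - A$2$2)" for c
  proof -
    have "B$2$2 - B$1$1 = c * (A$2$2 - A$1$1)" using that(3) by algebra
    then show ?thesis using that by (simp add: mat2_eq_iff)
  qed
  have "A$1$2 \<noteq> 0 \<or> A$2$1 \<noteq> 0 \<or> A$1$1 - A$2$2 \<noteq> 0"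
  proof (rule ccontr)
    assume "\<not> ?thesis"
    then have "tl2 A = 0" by (simp add: mat2_eq_iff)
    with assms(2) show False by simp
  qed
  then consider "A$1$2 \<noteq> 0" | "A$2$1 \<noteq> 0" | "A$1$1 - A$2$2 \<noteq> 0" by blast
  then show ?thesis
  proof cases
    case 1
    define c where "c = (B$1$2) / (A$1$2)"
    then have c: "B$1$2 = c * (A$1$2)" using 1 by simp
    have "(A$1$2) * (B$2$1) = (A$1$2) * (c * (A$2$1))" using c e by algebra
    then have "B$2$1 = c * (A$2$1)" using 1 by (simp only: mult_cancel_left) simp
    moreover
    have "(A$1$2) * (B$1$1 - B$2$2) = (A$1$2) * (c * (A$1$1 - A$2$2))" using c e by algebra
    then have "B$1$1 - B$2$2 = c * (A$1$1 - A$2$2)" using 1 by (simp only: mult_cancel_left) simp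
    ultimately show ?thesis using c by (intro that[of c] proportional) auto
  next
    case 2
    define c where "c = (B$2$1) / (A$2$1)"
    then have c: "B$2$1 = c * (A$2$1)" using 2 by simp
    have "(A$2$1) * (B$1$2) = (A$2$1) * (c * (A$1$2))" using c e by algebra
    then have "B$1$2 = c * (A$1$2)" using 2 by (simp only: mult_cancel_left) simp
    moreover
    have "(A$2$1) * (B$1$1 - B$2$2) = (A$2$1) * (c * (A$1$1 - A$2$2))" using c e by algebra
    then have "B$1$1 - B$2$2 = c * (A$1$1 - A$2$2)" using 2 by (simp only: mult_cancel_left) simp
    ultimately show ?thesis using c by (intro that[of c] proportional) auto
  next
    case 3
    define c where "c = (B$1$1 - B$2$2) / (A$1$1 - A$2$2)"
    then have c: "B$1$1 - B$2$2 = c * (A$1$1 - A$2$2)" using 3 by simp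
    have "(A$1$1 - A$2$2) * (B$1$2) = (A$1$1 - A$2$2) * (c * (A$1$2))" using c e by algebra
    then have "B$1$2 = c * (A$1$2)" using 3 by (simp only: mult_cancel_left) simp
    moreover
    have "(A$1$1 - A$2$2) * (B$2$1) = (A$1$1 - A$2$2) * (c * (A$2$1))" using c e by algebra
    then have "B$2$1 = c * (A$2$1)" using 3 by (simp only: mult_cancel_left) simp
    ultimately show ?thesis using c by (intro that[of c] proportional) auto
  qed
qed

text \<open>The matrix of w \<mapsto> (v1 w2 - v2 w1) v, whose image and, for nonzero v, kernel are
  spanned by v. As the form is invariant under SL(2,R), conjugation by g becomes application of g to
  v.\<close>

definition nil2 :: "real^2 \<Rightarrow> real^2^2" where
  "nil2 v = mat2 (- (v$1 * v$2)) ((v$1)\<^sup>2) (- ((v$2)\<^sup>2)) (v$1 * v$2)"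

lemma nil2_nth [simp]: "nil2 v $ 1 $ 1 = - (v$1 * v$2)" "nil2 v $ 1 $ 2 = (v$1)\<^sup>2"
  "nil2 v $ 2 $ 1 = - ((v$2)\<^sup>2)" "nil2 v $ 2 $ 2 = v$1 * v$2"
  by (simp_all add: nil2_def)

lemma nil2_scaleR: "nil2 (c *\<^sub>R v) = c\<^sup>2 *\<^sub>R nil2 v"
  by (simp add: entry_simps power2_eq_square)

lemma conj2_nil2: "det g = 1 \<Longrightarrow> conj2 g (nil2 v) = nil2 (g *v v)"
  by (simp add: entry_simps conj2_def power2_eq_square algebra_simps)

lemma norm_nil2: "norm (nil2 v) = (norm v)\<^sup>2"
proof (rule power2_eq_imp_eq)
  show "(norm (nil2 v))\<^sup>2 = ((norm v)\<^sup>2)\<^sup>2"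
    unfolding norm_sq_mat2 norm_sq_vec2 by (simp add: power2_eq_square algebra_simps)
qed simp_all

lemma nil2_eq_0_iff [simp]: "nil2 v = 0 \<longleftrightarrow> v = 0"
  by (metis norm_nil2 norm_eq_zero zero_eq_power2)

lemma tl2_1_nil2 [simp]: "tl2 (mat 1 + nil2 v) = nil2 v"
  by (simp add: entry_simps)

lemma unipotent_power: "(mat 1 + a *\<^sub>R nil2 v) ** (mat 1 + b *\<^sub>R nil2 v) = mat 1 + (a + b) *\<^sub>R nil2 v"
  by (simp add: entry_simps power2_eq_square algebra_simps)

text \<open>The matrices of trace and determinant 0 form a cone. \<open>nil2\<close> covers only the
  half with upper right entry >= 0 and lower left entry <= 0; \<sigma> selects the half.\<close>

lemma nilpotent_is_nil2:
  assumes "tl2 M = M" "det M = 0" 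
  obtains \<sigma> v where "\<sigma> = 1 \<or> \<sigma> = -1" "M = \<sigma> *\<^sub>R nil2 v"
proof -
  have t: "M$2$2 = - M$1$1" using tl2_nth(1)[of M] unfolding assms(1) by simp
  then have d: "(M$1$1)\<^sup>2 = - (M$1$2 * M$2$1)" using assms(2) by (simp add: det_2 power2_eq_square)
  define p where "p = M$1$1"
  define q where "q = M$1$2"
  define r where "r = M$2$1"
  have d': "p\<^sup>2 = - (q * r)" using d by (simp add: p_def q_def r_def)
  have M: "M = mat2 p q r (-p)" using t by (simp add: entry_simps p_def q_def r_def)
  consider "q > 0" | "q < 0" | "q = 0" by linarith
  then show ?thesis
  proof cases
    case 1
    have "M = 1 *\<^sub>R nil2 (vector [sqrt q, - p / sqrt q])" 
      using 1 d' by (simp add: M mat2_eq_iff power_divide)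
    then show ?thesis using that by blast
  next
    case 2
    have "M = (-1) *\<^sub>R nil2 (vector [sqrt (-q), p / sqrt (-q)])" 
      using 2 d' by (simp add: M mat2_eq_iff power_divide)
    then show ?thesis using that by blast
  next
    case 3
    then have p: "p = 0" using d' by simp
    consider "r \<le> 0" | "r > 0" by linarith
    then show ?thesis
    proof cases
      case 1
      have "M = 1 *\<^sub>R nil2 (vector [0, sqrt (-r)])" 
        using 1 p 3 by (simp add: M mat2_eq_iff power_divide)
      then show ?thesis using that by blast
    next
      case 2
      have "M = (-1) *\<^sub>R nil2 (vector [0, sqrt r])" 
        using 2 p 3 by (simp add: M mat2_eq_iff power_divide)
      then show ?thesis using that by blast
    qed
  qed
qed

text \<open>Conjugation by \<open>diag(\<surd>l, 1/\<surd>l)\<close> multiplies the upper right entry by \<open>l\<close>; a bounded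
  conjugation first makes that entry comparable to the norm.\<close>

lemma expanding_conjugation:
  assumes M: "tl2 M = M" and l: "l \<ge> 1"
  obtains h :: "real^2^2" where "det h = 1" "(norm h)\<^sup>2 \<le> 6 * l" "norm (conj2 h M) \<ge> l * norm M / 6"
proof -
  have t: "M$2$2 = - M$1$1" using tl2_nth(1)[of M] unfolding assms(1) by simp
  define p where "p = M$1$1"
  define q where "q = M$1$2"
  define r where "r = M$2$1"
  define n where "n = norm M"
  have M: "M = mat2 p q r (-p)" using t by (simp add: entry_simps p_def q_def r_def)
  have n2: "n\<^sup>2 = 2 * p\<^sup>2 + q\<^sup>2 + r\<^sup>2" unfolding n_def norm_sq_mat2 by (simp add: M)
  have n0: "n \<ge> 0" by (simp add: n_def)
  define s where "s = sqrt l"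
  have s: "s > 0" "s\<^sup>2 = l" using l by (auto simp: s_def)
  have "1 / l \<le> 1" using l by simp
  then have il: "1 / l \<le> l" using l by linarith
  have entry: "\<bar>A$1$2\<bar> \<le> norm A" "\<bar>A$2$1\<bar> \<le> norm A" for A :: "real^2^2"
    by (rule order_trans[OF component_le_norm_cart Finite_Cartesian_Product.norm_nth_le])+
  consider "\<bar>q\<bar> \<ge> n / 6" | "\<bar>r\<bar> \<ge> n / 6" | "\<bar>q\<bar> < n / 6" "\<bar>r\<bar> < n / 6" by linarith
  then show ?thesis
  proof cases
    case 1
    let ?h = "mat2 s 0 0 (1/s)"
    have "norm (conj2 ?h M) \<ge> \<bar>conj2 ?h M $ 1 $ 2\<bar>" by (rule entry)
    also have "conj2 ?h M $ 1 $ 2 = l * q" 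
      using s by (simp add: conj2_def entry_simps M power2_eq_square)
    finally have "norm (conj2 ?h M) \<ge> l * \<bar>q\<bar>" using l by (simp add: abs_mult)
    moreover have "l * \<bar>q\<bar> \<ge> l * (n/6)" using 1 l by (intro mult_left_mono) auto
    moreover have "(norm ?h)\<^sup>2 \<le> 6 * l" using il l by (simp add: norm_sq_mat2 power_divide s)
    moreover have "det ?h = 1" using s by (simp add: det_2)
    ultimately show ?thesis by (intro that[of ?h]) (auto simp: n_def)
  next
    case 2
    let ?h = "mat2 (1/s) 0 0 s"
    have "norm (conj2 ?h M) \<ge> \<bar>conj2 ?h M $ 2 $ 1\<bar>" by (rule entry)
    also have "conj2 ?h M $ 2 $ 1 = l * r" 
      using s by (simp add: conj2_def entry_simps M power2_eq_square)
    finally have "norm (conj2 ?h M) \<ge> l * \<bar>r\<bar>" using l by (simp add: abs_mult)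
    moreover have "l * \<bar>r\<bar> \<ge> l * (n/6)" using 2 l by (intro mult_left_mono) auto
    moreover have "(norm ?h)\<^sup>2 \<le> 6 * l" using il l by (simp add: norm_sq_mat2 power_divide s)
    moreover have "det ?h = 1" using s by (simp add: det_2)
    ultimately show ?thesis by (intro that[of ?h]) (auto simp: n_def)
  next
    case 3
    have "q\<^sup>2 \<le> (n/6)\<^sup>2" "r\<^sup>2 \<le> (n/6)\<^sup>2" using 3 by (metis abs_ge_zero less_imp_le power2_abs power_mono)+
    then have "q\<^sup>2 \<le> n\<^sup>2 / 36" "r\<^sup>2 \<le> n\<^sup>2 / 36" by (simp_all add: power_divide)
    then have "p\<^sup>2 \<ge> n\<^sup>2 * (4/9)" using n2 zero_le_power2[of n] by linarith
    then have "(2/3 * n)\<^sup>2 \<le> \<bar>p\<bar>\<^sup>2" by (simp add: power_mult_distrib power2_eq_square)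
    then have p: "2/3 * n \<le> \<bar>p\<bar>" by (rule power2_le_imp_le) simp
    \<comment> \<open>Here the diagonal entry p dominates. The matrix is diag(s, 1/s) times the
      upper shear by 1, and the shear moves -2 p into the upper right corner before the
      stretching.\<close>
    let ?h = "mat2 s s 0 (1/s)"
    have "norm (conj2 ?h M) \<ge> \<bar>conj2 ?h M $ 1 $ 2\<bar>" by (rule entry)
    also have "conj2 ?h M $ 1 $ 2 = l * (q - 2 * p - r)" 
      using s by (simp add: conj2_def entry_simps M power2_eq_square algebra_simps)
    finally have "norm (conj2 ?h M) \<ge> l * \<bar>q - 2 * p - r\<bar>" using l by (simp add: abs_mult)
    moreover have "\<bar>q - 2 * p - r\<bar> \<ge> n/6" using 3 p by linarith
    then have "l * \<bar>q - 2 * p - r\<bar> \<ge> l * (n/6)" using l by (intro mult_left_mono) auto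
    moreover have "(norm ?h)\<^sup>2 \<le> 6 * l" using il l by (simp add: norm_sq_mat2 power_divide s)
    moreover have "det ?h = 1" using s by (simp add: det_2)
    ultimately show ?thesis by (intro that[of ?h]) (auto simp: n_def)
  qed
qed

section \<open>Discrete subgroups and their parabolic elements\<close>

definition wedge :: "real^2 \<Rightarrow> real^2 \<Rightarrow> real" where
  "wedge v w = v$1 * w$2 - v$2 * w$1"

lemma wedge_matrix: "wedge (g *v v) (g *v w) = det g * wedge v w"
  by (simp add: wedge_def entry_simps algebra_simps)

lemma commutator_tl2: "A ** B - B ** A = tl2 A ** tl2 B - tl2 B ** tl2 A"
  by (simp add: mat2_eq_iff matrix_mult_nth2 field_simps)

lemma conj2_eq_0_iff: "det g = 1 \<Longrightarrow> conj2 g A = 0 \<longleftrightarrow> A = 0"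
proof
  assume "det g = 1" "conj2 g A = 0"
  then have "A = conj2 (adj2 g) 0" by (metis conj2_adj2)
  then show "A = 0" by (simp add: conj2_def)
qed (simp add: conj2_def)

lemma norm_le_of_conj2:
  assumes "det g = 1" shows "norm A \<le> (norm g)\<^sup>2 * norm (conj2 g A)"
  using norm_conj2_le[of "adj2 g" "conj2 g A"] assms by (simp add: conj2_adj2)

lemma norm_small_SL2_le_2:
  assumes "det A = 1" "norm (tl2 A) \<le> 1 / 16" shows "norm A \<le> 2"
proof (rule power2_le_imp_le)
  have "(norm (tl2 A))\<^sup>2 \<le> (1/16)\<^sup>2" using assms(2) by (intro power_mono) auto
  also have "\<dots> \<le> 1/3" by (simp add: power2_eq_square)
  finally show "(norm A)\<^sup>2 \<le> 2\<^sup>2" using norm_SL2_le[OF assms(1)] by simp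
qed simp

lemma matrix_diff_ldistrib2: "A ** (B - C) = A ** B - (A ** C :: real^2^2)"
  and matrix_diff_rdistrib2: "(B - C) ** A = B ** A - (C ** A :: real^2^2)"
  by (simp_all add: mat2_eq_iff matrix_mult_nth2 algebra_simps)

locale discrete_subgroup_SL2R =
  fixes \<Gamma> :: "(real^2^2) set"
  assumes subgroup: "subgroup \<Gamma> SL2R" and discrete: "discrete \<Gamma>"
begin

lemma det_mem: "\<gamma> \<in> \<Gamma> \<Longrightarrow> det \<gamma> = 1"
  using subgroup.subset[OF subgroup] by (auto simp: SL2R_def)

lemma one_mem: "mat 1 \<in> \<Gamma>"
  using subgroup.one_closed[OF subgroup] by (simp add: SL2R_def)

lemma mult_mem: "\<gamma> \<in> \<Gamma> \<Longrightarrow> \<eta> \<in> \<Gamma> \<Longrightarrow> \<gamma> ** \<eta> \<in> \<Gamma>"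
  using subgroup.m_closed[OF subgroup] by (simp add: SL2R_def)

lemma adj2_mem: assumes "\<gamma> \<in> \<Gamma>" shows "adj2 \<gamma> \<in> \<Gamma>"
proof -
  interpret group SL2R by (rule group_SL2R)
  have "inv\<^bsub>SL2R\<^esub> \<gamma> = adj2 \<gamma>"
    using det_mem[OF assms] by (intro inv_equality) (auto simp: SL2R_def adj2_mult_self)
  then show ?thesis using subgroup.m_inv_closed[OF subgroup assms] by simp
qed

lemma separated_from_1:
  obtains r where "r > 0" "\<And>\<gamma>. \<gamma> \<in> \<Gamma> \<Longrightarrow> norm (\<gamma> - mat 1) < r \<Longrightarrow> \<gamma> = mat 1"
proof -
  have "mat 1 isolated_in \<Gamma>" using discrete one_mem by (simp add: discrete_def)
  then obtain e where "e > 0" "\<forall>y\<in>\<Gamma>. dist (mat 1) y < e \<longrightarrow> y = mat 1"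
    by (auto simp: isolated_in_dist_Ex_iff)
  then show ?thesis by (intro that[of e]) (auto simp: dist_norm norm_minus_commute)
qed

text \<open>Discreteness at 1 spreads by translation: for distinct x and y the element x^-1 y is at
  distance at least r from 1, so y - x has norm at least r / norm x. A bounded part is thus
  uniformly discrete.\<close>

lemma finite_bounded: "finite {\<gamma> \<in> \<Gamma>. norm \<gamma> \<le> B}"
proof -
  obtain r where r: "r > 0" "\<And>\<gamma>. \<gamma> \<in> \<Gamma> \<Longrightarrow> norm (\<gamma> - mat 1) < r \<Longrightarrow> \<gamma> = mat 1"
    by (rule separated_from_1) blast
  let ?S = "{\<gamma> \<in> \<Gamma>. norm \<gamma> \<le> B}"
  let ?e = "r / (1 + \<bar>B\<bar>)"
  have "?e > 0" using r by (simp add: add_pos_nonneg)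
  moreover have "x = y" if x: "x \<in> ?S" and y: "y \<in> ?S" and d: "dist x y < ?e" for x y
  proof -
    have "adj2 x ** y - mat 1 = adj2 x ** (y - x)"
      using x by (simp add: matrix_diff_ldistrib2 adj2_mult_self det_mem)
    then have "norm (adj2 x ** y - mat 1) \<le> norm x * norm (y - x)"
      using norm_matrix_mult_le[of "adj2 x" "y - x"] by simp
    also have "\<dots> \<le> (1 + \<bar>B\<bar>) * norm (y - x)" using x by (intro mult_right_mono) auto
    also have "\<dots> < r" using d by (simp add: dist_norm norm_minus_commute field_simps add_pos_nonneg)
    finally have "adj2 x ** y = mat 1" using x y by (intro r) (auto intro: mult_mem adj2_mem)
    then have "x ** (adj2 x ** y) = x" by simp
    then show "x = y" using x by (simp add: mult_adj2_cancel det_mem)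
  qed
  ultimately have "uniform_discrete ?S" unfolding uniform_discrete_def by blast
  moreover have "bounded ?S" by (auto simp: bounded_iff)
  ultimately show ?thesis using uniform_discrete_finite_iff by blast
qed

text \<open>A convergent sequence stays in a bounded part, which is finite and therefore
  closed.\<close>

lemma closed_mem: "closed \<Gamma>"
proof -
  have "l \<in> \<Gamma>" if f: "\<forall>n. f n \<in> \<Gamma>" "f \<longlonglongrightarrow> l" for f l
  proof -
    from f have "Bseq f" by (meson convergentI convergent_imp_Bseq)
    then obtain B where B: "\<And>n. norm (f n) \<le> B" by (auto simp: Bseq_def)
    have "closed {\<gamma> \<in> \<Gamma>. norm \<gamma> \<le> B}" using finite_bounded by (rule finite_imp_closed)
    then show "l \<in> \<Gamma>" using closed_sequentially[of "{\<gamma> \<in> \<Gamma>. norm \<gamma> \<le> B}" f l] f B by auto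
  qed
  then show ?thesis by (auto simp: closed_sequential_limits)
qed

text \<open>The competitors no larger than \<gamma> have bounded conjugates by
  \<open>norm_SL2_le\<close>. Undoing the conjugation bounds the elements themselves, so only
  finitely many remain.\<close>

lemma minimal_element:
  assumes g: "det g = 1" and \<gamma>: "\<gamma> \<in> \<Gamma>" "tl2 \<gamma> \<noteq> 0"
  obtains \<delta> where "\<delta> \<in> \<Gamma>" "tl2 \<delta> \<noteq> 0"
    "\<And>\<eta>. \<eta> \<in> \<Gamma> \<Longrightarrow> tl2 \<eta> \<noteq> 0 \<Longrightarrow> norm (conj2 g (tl2 \<delta>)) \<le> norm (conj2 g (tl2 \<eta>))"
proof -
  let ?f = "\<lambda>\<eta>. norm (conj2 g (tl2 \<eta>))"
  let ?S = "{\<eta> \<in> \<Gamma>. tl2 \<eta> \<noteq> 0 \<and> ?f \<eta> \<le> ?f \<gamma>}"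
  define B where "B = (norm g)\<^sup>2 * sqrt (2 + 3 * (?f \<gamma>)\<^sup>2)"
  have "norm \<eta> \<le> B" if "\<eta> \<in> ?S" for \<eta>
  proof -
    have "(norm (conj2 g \<eta>))\<^sup>2 \<le> 2 + 3 * (?f \<eta>)\<^sup>2"
      using norm_SL2_le[of "conj2 g \<eta>"] that g by (simp add: det_conj2 det_mem tl2_conj2)
    also have "\<dots> \<le> 2 + 3 * (?f \<gamma>)\<^sup>2" using that by (auto intro: power_mono)
    finally have "norm (conj2 g \<eta>) \<le> sqrt (2 + 3 * (?f \<gamma>)\<^sup>2)" by (rule real_le_rsqrt)
    then have "(norm g)\<^sup>2 * norm (conj2 g \<eta>) \<le> B" unfolding B_def by (rule mult_left_mono) simp
    then show ?thesis using norm_le_of_conj2[OF g, of \<eta>] by linarith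
  qed
  then have "?S \<subseteq> {\<gamma> \<in> \<Gamma>. norm \<gamma> \<le> B}" by auto
  then have fin: "finite ?S" using finite_bounded finite_subset by blast
  have ne: "?S \<noteq> {}" using \<gamma> by auto
  from arg_min_if_finite[OF fin ne, of ?f]
  have \<delta>: "arg_min_on ?f ?S \<in> ?S" "\<And>\<eta>. \<eta> \<in> ?S \<Longrightarrow> ?f (arg_min_on ?f ?S) \<le> ?f \<eta>"
    by (auto simp: not_less)
  show ?thesis
  proof (rule that)
    fix \<eta> assume "\<eta> \<in> \<Gamma>" "tl2 \<eta> \<noteq> 0"
    then show "?f (arg_min_on ?f ?S) \<le> ?f \<eta>" using \<delta> by (cases "?f \<eta> \<le> ?f \<gamma>") force+
  qed (use \<delta>(1) in auto)
qed

text \<open>The commutator of two small elements is smaller than both, hence trivial when one of them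
  has minimal size.\<close>

lemma minimal_element_commutes:
  assumes g: "det g = 1" and \<delta>: "\<delta> \<in> \<Gamma>"
    and min: "\<And>\<eta>. \<eta> \<in> \<Gamma> \<Longrightarrow> tl2 \<eta> \<noteq> 0 \<Longrightarrow> norm (conj2 g (tl2 \<delta>)) \<le> norm (conj2 g (tl2 \<eta>))"
    and \<gamma>: "\<gamma> \<in> \<Gamma>" "norm (conj2 g (tl2 \<gamma>)) \<le> 1 / 16"
  shows "\<delta> ** \<gamma> = \<gamma> ** \<delta>"
proof (cases "tl2 \<gamma> = 0 \<or> tl2 \<delta> = 0")
  case True
  have neg: "A ** (- mat 1) = (- mat 1) ** A" for A :: "real^2^2" by (simp add: entry_simps)
  from True have "(\<gamma> = mat 1 \<or> \<gamma> = - mat 1) \<or> (\<delta> = mat 1 \<or> \<delta> = - mat 1)"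
    using tl2_eq_0_cases[of \<gamma>] tl2_eq_0_cases[of \<delta>] \<gamma> \<delta> det_mem by metis
  then show ?thesis using neg by fastforce
next
  case False
  define D where "D = conj2 g \<delta>"
  define C where "C = conj2 g \<gamma>"
  define d where "d = norm (tl2 D)"
  have dD: "det D = 1" "det C = 1" using g \<delta> \<gamma> by (simp_all add: D_def C_def det_conj2 det_mem)
  have d: "d = norm (conj2 g (tl2 \<delta>))" by (simp add: d_def D_def tl2_conj2 g)
  have C16: "norm (tl2 C) \<le> 1/16" using \<gamma> by (simp add: C_def tl2_conj2 g)
  have D16: "norm (tl2 D) \<le> 1/16" using \<gamma> min[of \<gamma>] False by (simp add: D_def tl2_conj2 g)
  have d0: "d > 0" using False by (simp add: d conj2_eq_0_iff g)
  have n2: "norm D \<le> 2" "norm C \<le> 2" using norm_small_SL2_le_2 dD C16 D16 by auto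
  define W where "W = D ** C ** adj2 D ** adj2 C"
  define \<eta> where "\<eta> = \<delta> ** \<gamma> ** adj2 \<delta> ** adj2 \<gamma>"
  have \<eta>: "\<eta> \<in> \<Gamma>" unfolding \<eta>_def using \<delta> \<gamma> by (auto intro: mult_mem adj2_mem)
  have adjc: "adj2 (conj2 g A) = conj2 g (adj2 A)" for A
    by (simp add: conj2_def adj2_mult matrix_mul_assoc)
  have W\<eta>: "W = conj2 g \<eta>" unfolding W_def \<eta>_def D_def C_def
    by (simp add: conj2_mult g adjc)
  have "C ** D ** adj2 D ** adj2 C = mat 1"
    by (simp add: mult_adj2_cancel dD mult_adj2)
  \<comment> \<open>Scalar parts drop out of DC - CD, so the commutator is controlled by the
    traceless parts alone.\<close>
  then have "W - mat 1 = (D ** C - C ** D) ** adj2 D ** adj2 C"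
    by (simp add: W_def matrix_diff_rdistrib2)
  also have "\<dots> = (tl2 D ** tl2 C - tl2 C ** tl2 D) ** adj2 D ** adj2 C"
    unfolding commutator_tl2[of D C] ..
  finally have "norm (W - mat 1) \<le> norm (tl2 D ** tl2 C - tl2 C ** tl2 D) * norm D * norm C"
    using norm_matrix_mult_le[of "tl2 D ** tl2 C - tl2 C ** tl2 D" "adj2 D"]
      norm_matrix_mult_le[of "(tl2 D ** tl2 C - tl2 C ** tl2 D) ** adj2 D" "adj2 C"]
    by (simp add: order_trans[OF _ mult_right_mono])
  \<comment> \<open>The threshold 1/16 originates here: together with the norms of D and C, at most
    2 each, it yields the factor 1/2, and the commutator undercuts the minimum d.\<close>
  also have "\<dots> \<le> (2 * d * (1/16)) * 2 * 2"
  proof (intro mult_mono n2)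
    have "norm (tl2 D ** tl2 C) \<le> d * (1/16)" "norm (tl2 C ** tl2 D) \<le> (1/16) * d"
      unfolding d_def
      by (rule order_trans[OF norm_matrix_mult_le], intro mult_left_mono mult_right_mono C16; simp)+
    then show "norm (tl2 D ** tl2 C - tl2 C ** tl2 D) \<le> 2 * d * (1/16)"
      using norm_triangle_ineq4[of "tl2 D ** tl2 C" "tl2 C ** tl2 D"] by linarith
  qed (use d0 in auto)
  finally have W2: "norm (W - mat 1) \<le> d / 2" by simp
  have "tl2 \<eta> = 0"
  proof (rule ccontr)
    assume "tl2 \<eta> \<noteq> 0"
    then have "d \<le> norm (tl2 W)" using min[OF \<eta>] by (simp add: d W\<eta> tl2_conj2 g)
    then show False using norm_tl2_le[of W] W2 d0 by linarith
  qed
  then have "tl2 W = 0" by (simp add: W\<eta> tl2_conj2 g conj2_eq_0_iff)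
  moreover have "det W = 1" using \<eta> by (simp add: W\<eta> det_conj2 g det_mem)
  moreover have "norm (W - mat 1) < 1" using W2 D16 by (simp add: d_def)
  ultimately have "W = mat 1" by (intro tl2_eq_0_near_1) auto
  then have "W ** C = C" by simp
  then have "D ** C ** adj2 D = C" by (simp add: W_def mult_adj2_cancel dD)
  then have "D ** C ** adj2 D ** D = C ** D" by simp
  then have "D ** C = C ** D" by (simp add: mult_adj2_cancel dD)
  then have "conj2 g (\<delta> ** \<gamma>) = conj2 g (\<gamma> ** \<delta>)" by (simp add: D_def C_def conj2_mult g)
  then show ?thesis by (metis conj2_adj2 g)
qed

text \<open>The inverse of 1 + \<open>nil2 v\<close> is 1 - \<open>nil2 v\<close>, so up to
  inversion every nontrivial unipotent element of \<Gamma> is recorded, with v determined up to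
  sign.\<close>

definition parabolic_vectors :: "(real^2) set" where
  "parabolic_vectors = {v. v \<noteq> 0 \<and> mat 1 + nil2 v \<in> \<Gamma>}"

lemma parabolic_vectors_act:
  assumes "\<gamma> \<in> \<Gamma>" "v \<in> parabolic_vectors"
  shows "\<gamma> *v v \<in> parabolic_vectors"
proof -
  have d: "det \<gamma> = 1" using assms det_mem by simp
  have "conj2 \<gamma> (mat 1 + nil2 v) \<in> \<Gamma>"
    using assms unfolding conj2_def parabolic_vectors_def by (auto intro: mult_mem adj2_mem)
  then have "mat 1 + nil2 (\<gamma> *v v) \<in> \<Gamma>" by (simp add: conj2_add conj2_mat1 conj2_nil2 d)
  moreover have "\<gamma> *v v \<noteq> 0" using assms(2) adj2_vector_cancel(2)[OF d, of v]
    by (auto simp: parabolic_vectors_def)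
  ultimately show ?thesis by (simp add: parabolic_vectors_def)
qed

lemma parabolic_vectors_sqrt:
  assumes "v \<in> parabolic_vectors" "k > 0"
  shows "sqrt (real k) *\<^sub>R v \<in> parabolic_vectors"
proof -
  have "mat 1 + real k *\<^sub>R nil2 v \<in> \<Gamma>" for k
  proof (induction k)
    case 0 then show ?case by (simp add: one_mem)
  next
    case (Suc k)
    have "(mat 1 + real k *\<^sub>R nil2 v) ** (mat 1 + 1 *\<^sub>R nil2 v) \<in> \<Gamma>"
      using Suc assms by (intro mult_mem) (auto simp: parabolic_vectors_def)
    then show ?case unfolding unipotent_power by (simp add: algebra_simps)
  qed
  then show ?thesis using assms by (simp add: parabolic_vectors_def nil2_scaleR)
qed

lemma parabolic_vectorsI:
  assumes "mat 1 + a *\<^sub>R nil2 v \<in> \<Gamma>" "a \<noteq> 0" "v \<noteq> 0"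
  shows "sqrt \<bar>a\<bar> *\<^sub>R v \<in> parabolic_vectors"
proof (cases "a > 0")
  case True
  then show ?thesis using assms by (simp add: parabolic_vectors_def nil2_scaleR)
next
  case False
  have "adj2 (mat 1 + a *\<^sub>R nil2 v) = mat 1 + (- a) *\<^sub>R nil2 v"
    by (simp add: entry_simps algebra_simps)
  then have "mat 1 + (- a) *\<^sub>R nil2 v \<in> \<Gamma>" using adj2_mem[OF assms(1)] by simp
  then show ?thesis using assms False by (simp add: parabolic_vectors_def nil2_scaleR)
qed

text \<open>A form of Shimizu's lemma. Some g makes v and w orthogonal and equally long, of squared
  length |\<open>wedge v w\<close>|. Were this below 1/16, both unipotents would be small at the
  same g and commute with a minimal element there, so \<open>nil2 v\<close> and
  \<open>nil2 w\<close> would be proportional.\<close>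

lemma parabolic_vectors_wedge:
  assumes v: "v \<in> parabolic_vectors" and w: "w \<in> parabolic_vectors" and vw: "wedge v w \<noteq> 0"
  shows "\<bar>wedge v w\<bar> \<ge> 1 / 16"
proof (rule ccontr)
  assume small: "\<not> ?thesis"
  define t where "t = \<bar>wedge v w\<bar>"
  define s where "s = sqrt t"
  define \<sigma> where "\<sigma> = sgn (wedge v w)"
  have t: "t > 0" "t < 1/16" using vw small by (auto simp: t_def)
  have s: "s > 0" "s * s = t" using t by (auto simp: s_def)
  have \<sigma>: "\<sigma> * wedge v w = t" "\<sigma> * \<sigma> = 1" using vw by (auto simp: \<sigma>_def t_def sgn_if)
  \<comment> \<open>The rows are the functionals x \<mapsto> \<sigma> \<open>wedge x w\<close> / s
    and x \<mapsto> \<open>wedge v x\<close> / s. They send v and w to the two axes, and \<sigma>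
    makes the determinant positive.\<close>
  define g where "g = mat2 (\<sigma> * w$2 / s) (- \<sigma> * w$1 / s) (- v$2 / s) (v$1 / s)"
  have "det g = \<sigma> * wedge v w / (s * s)"
    by (simp add: det_2 g_def wedge_def diff_divide_distrib right_diff_distrib) (simp add: mult_ac)
  then have g: "det g = 1" using \<sigma> s t by simp
  have gv1: "(g *v v)$1 = \<sigma> * wedge v w / s" "(g *v v)$2 = 0"
    using s(1) by (simp_all add: matrix_vector_nth2 g_def wedge_def field_simps)
  have gw1: "(g *v w)$1 = 0" "(g *v w)$2 = wedge v w / s"
    using s(1) by (simp_all add: matrix_vector_nth2 g_def wedge_def field_simps)
  have ts: "t / s = s" using s by (metis nonzero_mult_div_cancel_left less_irrefl)
  have gv: "norm (g *v v) ^ 2 = t" unfolding norm_sq_vec2 gv1 \<sigma> ts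
    using s by (simp add: power2_eq_square)
  have "(wedge v w / s)\<^sup>2 = (t / s)\<^sup>2" by (simp add: t_def power_divide)
  then have gw: "norm (g *v w) ^ 2 = t" unfolding norm_sq_vec2 gw1 ts
    using s by (simp add: power2_eq_square)
  let ?V = "mat 1 + nil2 v" and ?W = "mat 1 + nil2 w"
  have V: "?V \<in> \<Gamma>" "tl2 ?V \<noteq> 0" and W: "?W \<in> \<Gamma>" "tl2 ?W \<noteq> 0"
    using v w by (auto simp: parabolic_vectors_def)
  obtain \<delta> where \<delta>: "\<delta> \<in> \<Gamma>" "tl2 \<delta> \<noteq> 0"
    and min: "\<And>\<eta>. \<eta> \<in> \<Gamma> \<Longrightarrow> tl2 \<eta> \<noteq> 0 \<Longrightarrow> norm (conj2 g (tl2 \<delta>)) \<le> norm (conj2 g (tl2 \<eta>))"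
    using minimal_element[OF g V] by blast
  have "norm (conj2 g (tl2 ?V)) \<le> 1/16" "norm (conj2 g (tl2 ?W)) \<le> 1/16"
    using g gv gw t by (simp_all add: conj2_nil2 norm_nil2)
  then have "\<delta> ** ?V = ?V ** \<delta>" "\<delta> ** ?W = ?W ** \<delta>"
    using minimal_element_commutes[OF g \<delta>(1) min] V W by blast+
  then obtain a b where "nil2 v = a *\<^sub>R tl2 \<delta>" "nil2 w = b *\<^sub>R tl2 \<delta>"
    using commuting_tl2_proportional[OF _ \<delta>(2)] by (metis tl2_1_nil2)
  then have ab: "b *\<^sub>R nil2 v = a *\<^sub>R nil2 w" and ab0: "a \<noteq> 0" "b \<noteq> 0"
    using v w by (auto simp: parabolic_vectors_def)
  then have "b *\<^sub>R conj2 g (nil2 v) = a *\<^sub>R conj2 g (nil2 w)" by (metis conj2_scaleR)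
  then have "(b *\<^sub>R nil2 (g *v v))$1$2 = (a *\<^sub>R nil2 (g *v w))$1$2" by (simp add: conj2_nil2 g)
  then have "(g *v v)$1 = 0" using gw1 ab0 by simp
  then show False using gv1 \<sigma> t s by simp
qed

text \<open>Since 1 + \<open>nil2 w\<close> cannot come closer than r to 1, w has norm at least sqrt
  r, and passing to g costs at most the factor \<open>norm g\<close>.\<close>

lemma parabolic_vectors_lower_bound:
  assumes g: "det g = 1"
  obtains c where "c > 0" "\<And>w. w \<in> parabolic_vectors \<Longrightarrow> norm (g *v w) \<ge> c"
proof -
  obtain r where r: "r > 0" "\<And>\<gamma>. \<gamma> \<in> \<Gamma> \<Longrightarrow> norm (\<gamma> - mat 1) < r \<Longrightarrow> \<gamma> = mat 1"
    by (rule separated_from_1) blast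
  have "1\<^sup>2 \<le> (norm g)\<^sup>2" using norm_sq_SL2_ge_2[OF g] by simp
  then have g1: "norm g \<ge> 1" by (rule power2_le_imp_le) simp
  have "norm (g *v w) \<ge> sqrt r / norm g" if w: "w \<in> parabolic_vectors" for w
  proof -
    have "nil2 w \<noteq> 0" "mat 1 + nil2 w \<in> \<Gamma>" using w by (auto simp: parabolic_vectors_def)
    then have "\<not> norm (nil2 w) < r" using r(2)[of "mat 1 + nil2 w"] by auto
    then have "sqrt r \<le> norm w" by (intro real_le_lsqrt) (auto simp: norm_nil2)
    also have "w = adj2 g *v (g *v w)" by (simp add: adj2_vector_cancel g)
    also have "norm \<dots> \<le> norm g * norm (g *v w)" by (metis norm_matrix_vector_le norm_adj2)
    finally have "sqrt r \<le> norm (g *v w) * norm g" by (simp add: mult.commute)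
    then show ?thesis using g1 by (subst pos_divide_le_eq) auto
  qed
  moreover have "sqrt r / norm g > 0"
    using r(1) less_le_trans[OF zero_less_one g1] by (intro divide_pos_pos) auto
  ultimately show ?thesis by (rule that[rotated])
qed

end

section \<open>Unimodularity\<close>

abbreviation SL2 :: "(real^2^2) set" where "SL2 \<equiv> carrier SL2R"

lemma SL2_iff: "A \<in> SL2 \<longleftrightarrow> det A = 1"
  by (simp add: SL2R_def)

lemma SL2_mult [intro]: "A \<in> SL2 \<Longrightarrow> B \<in> SL2 \<Longrightarrow> A ** B \<in> SL2"
  by (simp add: SL2_iff det_mul)

lemma SL2_adj2 [intro]: "A \<in> SL2 \<Longrightarrow> adj2 A \<in> SL2"
  by (simp add: SL2_iff)

lemma SL2_mat1 [intro, simp]: "mat 1 \<in> SL2"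
  by (simp add: SL2_iff)

lemma SL2_cancel:
  assumes "A \<in> SL2"
  shows "A ** (adj2 A ** B) = B" "adj2 A ** (A ** B) = B"
    "(B ** A) ** adj2 A = B" "(B ** adj2 A) ** A = B"
    "A ** adj2 A = mat 1" "adj2 A ** A = mat 1"
  using assms by (simp_all add: SL2_iff mult_adj2_cancel mult_adj2 adj2_mult_self)

lemma continuous_on_matrix_mult [continuous_intros]:
  fixes f g :: "'a::topological_space \<Rightarrow> real^2^2"
  assumes "continuous_on S f" "continuous_on S g"
  shows "continuous_on S (\<lambda>x. f x ** g x)"
  unfolding matrix_matrix_mult_def using assms by (intro continuous_intros)

lemma continuous_on_adj2 [continuous_intros]:
  assumes "continuous_on S f" shows "continuous_on S (\<lambda>x. adj2 (f x))"
proof -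
  have "adj2 A = (A$1$1 + A$2$2) *\<^sub>R mat 1 - A" for A by (simp add: mat2_eq_iff)
  then show ?thesis using assms by (auto intro!: continuous_intros)
qed

lemma closed_SL2: "closed SL2"
proof -
  have "continuous_on UNIV (\<lambda>A::real^2^2. det A)" unfolding det_2 by (intro continuous_intros)
  then have "closed ((\<lambda>A::real^2^2. det A) -` {1})" by (intro closed_vimage) auto
  then show ?thesis by (simp add: vimage_def SL2R_def)
qed

lemma left_translate_eq:
  assumes "g \<in> SL2" "W \<subseteq> SL2"
  shows "(**) g ` W = {x \<in> SL2. adj2 g ** x \<in> W}"
proof (safe)
  fix x assume x: "adj2 g ** x \<in> W"
  have "x = g ** (adj2 g ** x)" using assms by (simp add: SL2_cancel)
  then show "x \<in> (**) g ` W" using x by (rule image_eqI)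
qed (use assms SL2_cancel in auto)

lemma right_translate_eq:
  assumes "g \<in> SL2" "W \<subseteq> SL2"
  shows "(\<lambda>x. x ** g) ` W = {x \<in> SL2. x ** adj2 g \<in> W}"
proof (safe)
  fix x assume x: "x ** adj2 g \<in> W"
  have "x = x ** adj2 g ** g" using assms by (simp add: SL2_cancel)
  then show "x \<in> (\<lambda>x. x ** g) ` W" using x by (rule image_eqI)
qed (use assms SL2_cancel in auto)

lemma openin_preimage_SL2:
  assumes "continuous_on SL2 f" "\<And>x. x \<in> SL2 \<Longrightarrow> f x \<in> SL2" "openin (top_of_set SL2) W"
  shows "openin (top_of_set SL2) {x \<in> SL2. f x \<in> W}"
proof -
  have "openin (top_of_set SL2) (SL2 \<inter> f -` W)"
    using assms by (intro continuous_openin_preimage[where T = SL2]) auto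
  then show ?thesis by (simp add: vimage_def Int_def)
qed

lemma openin_left_translate:
  assumes "g \<in> SL2" "openin (top_of_set SL2) W"
  shows "openin (top_of_set SL2) ((**) g ` W)"
proof -
  have "W \<subseteq> SL2" using assms(2) openin_imp_subset by blast
  then show ?thesis unfolding left_translate_eq[OF assms(1) \<open>W \<subseteq> SL2\<close>] using assms
    by (intro openin_preimage_SL2) (auto intro!: continuous_intros)
qed

lemma openin_right_translate:
  assumes "g \<in> SL2" "openin (top_of_set SL2) W"
  shows "openin (top_of_set SL2) ((\<lambda>x. x ** g) ` W)"
proof -
  have "W \<subseteq> SL2" using assms(2) openin_imp_subset by blast
  then show ?thesis unfolding right_translate_eq[OF assms(1) \<open>W \<subseteq> SL2\<close>] using assms
    by (intro openin_preimage_SL2) (auto intro!: continuous_intros)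
qed

definition nhd1 :: "real \<Rightarrow> (real^2^2) set" where
  "nhd1 u = {h \<in> SL2. norm (h - mat 1) < u}"

lemma openin_nhd1: "openin (top_of_set SL2) (nhd1 u)"
proof -
  have "nhd1 u = SL2 \<inter> ball (mat 1) u"
    by (auto simp: nhd1_def dist_norm norm_minus_commute)
  then show ?thesis by (simp add: openin_open_Int)
qed

lemma nhd1_subset: "nhd1 u \<subseteq> SL2"
  by (auto simp: nhd1_def)

lemma mat1_nhd1: "u > 0 \<Longrightarrow> mat 1 \<in> nhd1 u"
  by (simp add: nhd1_def)

text \<open>All left translates of W together cover the group, and Lindelof's theorem leaves
  countably many.\<close>

lemma countable_left_translates:
  assumes "openin (top_of_set SL2) W" "W \<noteq> {}"
  obtains D where "countable D" "D \<subseteq> SL2" "SL2 = (\<Union>g\<in>D. (**) g ` W)"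
proof -
  have sub: "W \<subseteq> SL2" using assms openin_imp_subset by blast
  let ?F = "(\<lambda>g. (**) g ` W) ` SL2"
  have "\<And>S. S \<in> ?F \<Longrightarrow> openin (top_of_set SL2) S"
    using assms openin_left_translate by auto
  then obtain F' where F': "F' \<subseteq> ?F" "countable F'" "\<Union>F' = \<Union>?F"
    using Lindelof_openin[of ?F SL2] by blast
  obtain D where D: "countable D" "D \<subseteq> SL2" "F' = (\<lambda>g. (**) g ` W) ` D"
    using F'(1,2) by (meson countable_subset_image)
  obtain w where w: "w \<in> W" using assms by blast
  have "\<Union>?F = SL2"
  proof (safe)
    fix g x assume "g \<in> SL2" "x \<in> W" then show "g ** x \<in> SL2" using sub by auto
  next
    fix x assume x: "x \<in> SL2"
    have "x ** adj2 w \<in> SL2" "x = x ** adj2 w ** w" using x w sub SL2_cancel by auto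
    then show "x \<in> \<Union>?F" using w by blast
  qed
  then show ?thesis using D F'(3) by (intro that[of D]) auto
qed

locale haar_SL2R =
  fixes m :: "(real^2^2) measure"
  assumes haar: "haar_measure m"
begin

lemma sets_m: "sets m = sets (restrict_space borel SL2)"
  using haar by (simp add: haar_measure_def)

lemma space_m: "space m = SL2"
  using sets_eq_imp_space_eq[OF sets_m] by (simp add: space_restrict_space)

lemma openin_sets_m: "openin (top_of_set SL2) W \<Longrightarrow> W \<in> sets m"
  unfolding sets_m sets_restrict_space by (auto simp: openin_open)

lemma left_invariant: "g \<in> SL2 \<Longrightarrow> E \<in> sets m \<Longrightarrow> emeasure m ((**) g ` E) = emeasure m E"
  using haar by (simp add: haar_measure_def)

lemma sets_subset: "E \<in> sets m \<Longrightarrow> E \<subseteq> SL2"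
  using sets.sets_into_space space_m by blast

lemma measurable_mI:
  assumes "continuous_on SL2 f" "\<And>x. x \<in> SL2 \<Longrightarrow> f x \<in> SL2"
  shows "f \<in> measurable m m"
proof -
  have "f \<in> measurable (restrict_space borel SL2) (restrict_space borel SL2)"
    using assms by (intro measurable_restrict_space2 borel_measurable_continuous_on_restrict)
      (auto simp: space_restrict_space)
  then show ?thesis using measurable_cong_sets[OF sets_m sets_m] by simp
qed

lemma measurable_mult: "(\<lambda>p. fst p ** snd p) \<in> measurable (m \<Otimes>\<^sub>M m) m"
proof -
  have id: "(\<lambda>x. x) \<in> measurable m borel"
    unfolding measurable_cong_sets[OF sets_m refl] by (rule measurable_restrict_space1) simp
  have "(\<lambda>p. fst p ** snd p) \<in> borel_measurable (m \<Otimes>\<^sub>M m)"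
    by (rule borel_measurable_continuous_Pair)
      (auto intro!: continuous_intros measurable_compose[OF measurable_fst id]
        measurable_compose[OF measurable_snd id])
  then have "(\<lambda>p. fst p ** snd p) \<in> measurable (m \<Otimes>\<^sub>M m) (restrict_space borel SL2)"
    by (rule measurable_restrict_space2[rotated]) (auto simp: space_pair_measure space_m)
  then show ?thesis by (subst measurable_cong_sets[OF refl sets_m])
qed

lemma left_translate_sets:
  assumes "g \<in> SL2" "E \<in> sets m" shows "(**) g ` E \<in> sets m"
proof -
  have "(\<lambda>x. adj2 g ** x) -` E \<inter> space m \<in> sets m"
    using assms by (intro measurable_sets[OF measurable_mI]) (auto intro!: continuous_intros)
  also have "(\<lambda>x. adj2 g ** x) -` E \<inter> space m = (**) g ` E"
    using assms sets_subset by (subst left_translate_eq) (auto simp: space_m)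
  finally show ?thesis .
qed

lemma right_translate_sets:
  assumes "g \<in> SL2" "E \<in> sets m" shows "(\<lambda>x. x ** g) ` E \<in> sets m"
proof -
  have "(\<lambda>x. x ** adj2 g) -` E \<inter> space m \<in> sets m"
    using assms by (intro measurable_sets[OF measurable_mI]) (auto intro!: continuous_intros)
  also have "(\<lambda>x. x ** adj2 g) -` E \<inter> space m = (\<lambda>x. x ** g) ` E"
    using assms sets_subset by (subst right_translate_eq) (auto simp: space_m)
  finally show ?thesis .
qed

lemma adj2_sets:
  assumes "E \<in> sets m" shows "adj2 ` E \<in> sets m"
proof -
  have "adj2 -` E \<inter> space m \<in> sets m"
    using assms by (intro measurable_sets[OF measurable_mI]) (auto intro!: continuous_intros)
  also have "adj2 -` E \<inter> space m = adj2 ` E"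
    using sets_subset[OF assms] by (auto simp: space_m) (metis adj2_adj2 image_eqI)
  finally show ?thesis .
qed

text \<open>Otherwise countably many null translates would cover the group.\<close>

lemma emeasure_open_pos:
  assumes W: "openin (top_of_set SL2) W" "W \<noteq> {}"
  shows "emeasure m W > 0"
proof (rule ccontr)
  assume "\<not> ?thesis"
  then have z: "emeasure m W = 0" by simp
  have Ws: "W \<in> sets m" using W openin_sets_m by blast
  obtain D where D: "countable D" "D \<subseteq> SL2" "SL2 = (\<Union>g\<in>D. (**) g ` W)"
    using countable_left_translates[OF W] by blast
  have "(\<Union>g\<in>D. (**) g ` W) \<in> null_sets m"
    using D z Ws by (intro null_sets_UN') (auto simp: null_sets_def left_invariant left_translate_sets subset_iff)
  then show False using D haar by (auto simp: haar_measure_def null_sets_def)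
qed

lemma emeasure_bounded_finite:
  assumes "W \<in> sets m" "bounded W"
  shows "emeasure m W < \<infinity>"
proof -
  obtain B where B: "\<And>x. x \<in> W \<Longrightarrow> norm x \<le> B" using assms by (auto simp: bounded_iff)
  let ?K = "SL2 \<inter> cball 0 B"
  have K: "compact ?K" using closed_SL2 by (intro closed_Int_compact) auto
  then have "?K \<in> sets m" unfolding sets_m sets_restrict_space by (auto simp: borel_closed)
  then have "emeasure m W \<le> emeasure m ?K" using B sets_subset[OF assms(1)] by (intro emeasure_mono) auto
  also have "\<dots> < \<infinity>" using haar K by (auto simp: haar_measure_def)
  finally show ?thesis .
qed

lemma bounded_nhd1: "bounded (nhd1 u)"
proof -
  have "nhd1 u \<subseteq> ball (mat 1) u" by (auto simp: nhd1_def dist_norm norm_minus_commute)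
  then show ?thesis using bounded_ball bounded_subset by blast
qed

lemma bounded_right_translate:
  "bounded W \<Longrightarrow> bounded ((\<lambda>x. x ** g) ` W)" for W :: "(real^2^2) set" and g :: "real^2^2"
proof -
  assume "bounded W"
  then obtain B where B: "\<And>x. x \<in> W \<Longrightarrow> norm x \<le> B" by (auto simp: bounded_iff)
  have "norm (x ** g) \<le> B * norm g" if "x \<in> W" for x
    using norm_matrix_mult_le[of x g] mult_right_mono[OF B[OF that], of "norm g"] by simp
  then show ?thesis by (auto simp: bounded_iff)
qed

sublocale sigma_finite_measure m
proof
  obtain D where D: "countable D" "D \<subseteq> SL2" "SL2 = (\<Union>g\<in>D. (**) g ` nhd1 1)"
    using countable_left_translates[OF openin_nhd1] mat1_nhd1[of 1] by (metis empty_iff zero_less_one)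
  let ?A = "(\<lambda>g. (**) g ` nhd1 1) ` D"
  have s: "nhd1 1 \<in> sets m" by (intro openin_sets_m openin_nhd1)
  have "emeasure m (nhd1 1) \<noteq> \<infinity>" using emeasure_bounded_finite[OF s bounded_nhd1] by simp
  then show "\<exists>A. countable A \<and> A \<subseteq> sets m \<and> \<Union>A = space m \<and> (\<forall>a\<in>A. emeasure m a \<noteq> \<infinity>)"
    using D s by (intro exI[of _ ?A]) (auto simp: space_m left_translate_sets left_invariant subset_iff)
qed

lemma nn_integral_left_translate:
  assumes f: "f \<in> borel_measurable m" and g: "g \<in> SL2"
  shows "(\<integral>\<^sup>+x. f (g ** x) \<partial>m) = (\<integral>\<^sup>+x. f x \<partial>m)"
proof -
  have T: "(**) g \<in> measurable m m" using g by (intro measurable_mI) (auto intro!: continuous_intros)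
  have "distr m m ((**) g) = m"
  proof (rule measure_eqI)
    fix E assume "E \<in> sets (distr m m ((**) g))"
    then have E: "E \<in> sets m" by simp
    have "emeasure (distr m m ((**) g)) E = emeasure m ((**) g -` E \<inter> space m)"
      using E T by (simp add: emeasure_distr)
    also have "(**) g -` E \<inter> space m = (**) (adj2 g) ` E"
      using g sets_subset[OF E] by (subst left_translate_eq) (auto simp: space_m)
    also have "emeasure m \<dots> = emeasure m E" using g E by (intro left_invariant) auto
    finally show "emeasure (distr m m ((**) g)) E = emeasure m E" .
  qed simp
  then show ?thesis using nn_integral_distr[OF T, of f] f by simp
qed

text \<open>Both sides measure the pairs with x in F and yx in E. Integrating over y first gives the
  left side. Replacing x by y^-1 x, which left invariance allows, turns the conditions into x in E
  and y in x F^-1, and now the y-integral is m(F^-1) for every x. The factored right side is what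
  makes right translates of two sets proportional.\<close>

lemma right_translates_integral:
  assumes E: "E \<in> sets m" and F: "F \<in> sets m"
  shows "(\<integral>\<^sup>+x. emeasure m ((\<lambda>y. y ** adj2 x) ` E) * indicator F x \<partial>m) = emeasure m E * emeasure m (adj2 ` F)"
proof -
  interpret P: pair_sigma_finite m m ..
  note [measurable] = E F
  define mul :: "(real^2^2) \<times> (real^2^2) \<Rightarrow> real^2^2" where "mul = (\<lambda>p. fst p ** snd p)"
  have [measurable]: "mul \<in> measurable (m \<Otimes>\<^sub>M m) m" unfolding mul_def by (rule measurable_mult)
  have [measurable]: "adj2 \<in> measurable m m" by (intro measurable_mI) (auto intro!: continuous_intros)
  have "(\<integral>\<^sup>+x. emeasure m ((\<lambda>y. y ** adj2 x) ` E) * indicator F x \<partial>m)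
      = (\<integral>\<^sup>+x. \<integral>\<^sup>+y. indicator F x * indicator E (mul (y, x)) \<partial>m \<partial>m)"
  proof (rule nn_integral_cong)
    fix x assume "x \<in> space m"
    then have x: "x \<in> SL2" by (simp add: space_m)
    have R: "(\<lambda>y. y ** adj2 x) ` E = {y \<in> space m. y ** x \<in> E}"
      using x sets_subset[OF E] by (subst right_translate_eq) (auto simp: space_m)
    have "(\<integral>\<^sup>+y. indicator E (mul (y, x)) \<partial>m) = (\<integral>\<^sup>+y. indicator ((\<lambda>y. y ** adj2 x) ` E) y \<partial>m)"
      by (intro nn_integral_cong) (auto simp: R mul_def indicator_def)
    also have "\<dots> = emeasure m ((\<lambda>y. y ** adj2 x) ` E)"
      using x E by (intro nn_integral_indicator right_translate_sets) auto
    moreover have "(\<integral>\<^sup>+y. indicator F x * indicator E (mul (y, x)) \<partial>m)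
        = indicator F x * (\<integral>\<^sup>+y. indicator E (mul (y, x)) \<partial>m)"
      using \<open>x \<in> space m\<close> by (intro nn_integral_cmult) measurable
    ultimately show "emeasure m ((\<lambda>y. y ** adj2 x) ` E) * indicator F x
        = (\<integral>\<^sup>+y. indicator F x * indicator E (mul (y, x)) \<partial>m)" by (simp add: mult.commute)
  qed
  also have "\<dots> = (\<integral>\<^sup>+y. \<integral>\<^sup>+x. indicator F x * indicator E (mul (y, x)) \<partial>m \<partial>m)"
    by (rule P.Fubini') measurable
  also have "\<dots> = (\<integral>\<^sup>+y. \<integral>\<^sup>+x. indicator F (mul (adj2 y, x)) * indicator E x \<partial>m \<partial>m)"
  proof (rule nn_integral_cong)
    fix y assume "y \<in> space m"
    then have y: "y \<in> SL2" by (simp add: space_m)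
    then have y': "adj2 y \<in> SL2" "adj2 y \<in> space m" by (auto simp: space_m)
    have "(\<integral>\<^sup>+x. indicator F (mul (adj2 y, x)) * indicator E x \<partial>m)
      = (\<integral>\<^sup>+x. indicator F (mul (adj2 y, y ** x)) * indicator E (y ** x) \<partial>m)"
      using y y' by (intro nn_integral_left_translate[symmetric]) measurable
    also have "\<dots> = (\<integral>\<^sup>+x. indicator F x * indicator E (mul (y, x)) \<partial>m)"
      using y by (simp add: mul_def SL2_cancel)
    finally show "(\<integral>\<^sup>+x. indicator F x * indicator E (mul (y, x)) \<partial>m)
      = (\<integral>\<^sup>+x. indicator F (mul (adj2 y, x)) * indicator E x \<partial>m)" by simp
  qed
  also have "\<dots> = (\<integral>\<^sup>+x. \<integral>\<^sup>+y. indicator F (mul (adj2 y, x)) * indicator E x \<partial>m \<partial>m)"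
    by (intro P.Fubini') measurable
  also have "\<dots> = (\<integral>\<^sup>+x. emeasure m (adj2 ` F) * indicator E x \<partial>m)"
  proof (rule nn_integral_cong)
    fix x assume "x \<in> space m"
    then have x: "x \<in> SL2" by (simp add: space_m)
    have "(**) x ` adj2 ` F = {y \<in> SL2. adj2 x ** y \<in> adj2 ` F}"
      using x sets_subset[OF adj2_sets[OF F]] by (subst left_translate_eq) auto
    also have "\<dots> = {y \<in> SL2. adj2 y ** x \<in> F}"
      by (metis (no_types, lifting) adj2_adj2 adj2_mult image_iff)
    finally have S: "(**) x ` adj2 ` F = {y \<in> space m. mul (adj2 y, x) \<in> F}" by (simp add: mul_def space_m)
    have "(\<integral>\<^sup>+y. indicator F (mul (adj2 y, x)) * indicator E x \<partial>m)
      = (\<integral>\<^sup>+y. indicator E x * indicator ((**) x ` adj2 ` F) y \<partial>m)"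
      by (intro nn_integral_cong) (auto simp: S indicator_def)
    also have "\<dots> = indicator E x * emeasure m ((**) x ` adj2 ` F)"
      using x F by (intro nn_integral_cmult_indicator left_translate_sets adj2_sets)
    also have "emeasure m ((**) x ` adj2 ` F) = emeasure m (adj2 ` F)"
      using x F by (intro left_invariant adj2_sets)
    finally show "(\<integral>\<^sup>+y. indicator F (mul (adj2 y, x)) * indicator E x \<partial>m)
      = emeasure m (adj2 ` F) * indicator E x" by (simp add: mult.commute)
  qed
  also have "\<dots> = emeasure m E * emeasure m (adj2 ` F)"
    using E by (subst nn_integral_cmult_indicator) (auto simp: mult.commute)
  finally show ?thesis .
qed

end

text \<open>A unipotent \<open>u\<close> is conjugate to \<open>u\<^sup>4\<close>, which forces the value 1.\<close>

lemma positive_character_SL2_trivial: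
  fixes \<theta> :: "real^2^2 \<Rightarrow> real"
  assumes hom: "\<And>g h. g \<in> SL2 \<Longrightarrow> h \<in> SL2 \<Longrightarrow> \<theta> (g ** h) = \<theta> g * \<theta> h"
    and pos: "\<And>g. g \<in> SL2 \<Longrightarrow> \<theta> g > 0" and g: "g \<in> SL2"
  shows "\<theta> g = 1"
proof -
  have one: "\<theta> (mat 1) = 1" using hom[of "mat 1" "mat 1"] pos[of "mat 1"] by simp
  have unip: "\<theta> u = 1" if u: "u \<in> SL2" and a: "a \<in> SL2" and "a ** u ** adj2 a = u ** u ** u ** u" for u a
  proof -
    have "\<theta> a * \<theta> (adj2 a) = 1" using hom[of a "adj2 a"] a one by (auto simp: SL2_cancel)
    then have "\<theta> (a ** u ** adj2 a) = \<theta> u" using hom a u by (simp add: SL2_mult SL2_adj2) 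
    moreover have "\<theta> (u ** u ** u ** u) = \<theta> u ^ 4"
      using hom u by (simp add: SL2_mult power4_eq_xxxx)
    ultimately have "\<theta> u * (\<theta> u) ^ 3 = \<theta> u * 1" using that(3) by (simp add: eval_nat_numeral)
    then have "\<theta> u ^ 3 = 1" using pos[OF u] by simp
    then show ?thesis using pos[OF u] power_eq_imp_eq_base[of "\<theta> u" 3 1] by simp
  qed
  have U: "mat2 1 s 0 1 \<in> SL2" "mat2 1 0 s 1 \<in> SL2" for s by (simp_all add: SL2_iff det_2)
  have up: "\<theta> (mat2 1 s 0 1) = 1" for s
    by (rule unip[of _ "mat2 2 0 0 (1/2)"]) (simp_all add: SL2_iff entry_simps)
  have low: "\<theta> (mat2 1 0 s 1) = 1" for s
    by (rule unip[of _ "mat2 (1/2) 0 0 2"]) (simp_all add: SL2_iff entry_simps)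
  \<comment> \<open>With a nonzero lower left entry, g is a product of three unipotents. In the
    remaining case one lower unipotent factor makes that entry nonzero.\<close>
  have nz: "\<theta> g = 1" if g: "g \<in> SL2" and c: "g$2$1 \<noteq> 0" for g
  proof -
    have d: "g$1$1 * g$2$2 = 1 + g$1$2 * g$2$1" using g by (simp add: SL2_iff det_2)
    have "g = mat2 1 ((g$1$1 - 1) / g$2$1) 0 1 ** mat2 1 0 (g$2$1) 1 ** mat2 1 ((g$2$2 - 1) / g$2$1) 0 1"
      using c d by (simp add: entry_simps field_simps)
    then show ?thesis using hom U up low by (metis SL2_mult mult_1)
  qed
  show ?thesis
  proof (cases "g$2$1 = 0")
    case True
    then have "g$1$1 \<noteq> 0" using g by (auto simp: SL2_iff det_2)
    moreover have "(mat2 1 0 1 1 ** g)$2$1 = g$1$1" using True by (simp add: matrix_mult_nth2)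
    ultimately have "\<theta> (mat2 1 0 1 1 ** g) = 1" using g U by (intro nz) auto
    then show ?thesis using hom[OF U(2) g] low by simp
  qed (use nz g in blast)
qed

section \<open>The modular function\<close>

context haar_SL2R
begin

lemma right_translate_measurable:
  assumes E: "E \<in> sets m"
  shows "(\<lambda>x. emeasure m ((\<lambda>y. y ** adj2 x) ` E)) \<in> borel_measurable m"
proof -
  note [measurable] = E
  define mul :: "(real^2^2) \<times> (real^2^2) \<Rightarrow> real^2^2" where "mul = (\<lambda>p. fst p ** snd p)"
  have [measurable]: "mul \<in> measurable (m \<Otimes>\<^sub>M m) m" unfolding mul_def by (rule measurable_mult)
  have M: "(\<lambda>x. \<integral>\<^sup>+y. indicator E (mul (y, x)) \<partial>m) \<in> borel_measurable m" by measurable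
  have eq: "(\<integral>\<^sup>+y. indicator E (mul (y, x)) \<partial>m) = emeasure m ((\<lambda>y. y ** adj2 x) ` E)"
    if "x \<in> space m" for x
  proof -
    have x: "x \<in> SL2" using that by (simp add: space_m)
    have R: "(\<lambda>y. y ** adj2 x) ` E = {y \<in> space m. y ** x \<in> E}"
      using x sets_subset[OF E] by (subst right_translate_eq) (auto simp: space_m)
    have "(\<integral>\<^sup>+y. indicator E (mul (y, x)) \<partial>m) = (\<integral>\<^sup>+y. indicator ((\<lambda>y. y ** adj2 x) ` E) y \<partial>m)"
      by (intro nn_integral_cong) (auto simp: R mul_def indicator_def)
    also have "\<dots> = emeasure m ((\<lambda>y. y ** adj2 x) ` E)"
      using x E by (intro nn_integral_indicator right_translate_sets) auto
    finally show ?thesis .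
  qed
  show ?thesis by (rule measurable_cong[OF eq, THEN iffD1, OF _ M])
qed

text \<open>By \<open>right_translates_integral\<close> both functions integrate over any F to m(E1)
  m(E2) m(F^-1), so they are densities of one measure.\<close>

lemma AE_right_translates_proportional:
  assumes [measurable]: "E1 \<in> sets m" "E2 \<in> sets m"
  shows "AE x in m. emeasure m E2 * emeasure m ((\<lambda>y. y ** adj2 x) ` E1)
    = emeasure m E1 * emeasure m ((\<lambda>y. y ** adj2 x) ` E2)"
proof (rule density_unique)
  note [measurable] = right_translate_measurable
  show "density m (\<lambda>x. emeasure m E2 * emeasure m ((\<lambda>y. y ** adj2 x) ` E1))
      = density m (\<lambda>x. emeasure m E1 * emeasure m ((\<lambda>y. y ** adj2 x) ` E2))"
  proof (rule measure_eqI)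
    fix F assume "F \<in> sets (density m (\<lambda>x. emeasure m E2 * emeasure m ((\<lambda>y. y ** adj2 x) ` E1)))"
    then have [measurable]: "F \<in> sets m" by simp
    have "emeasure (density m (\<lambda>x. emeasure m A * emeasure m ((\<lambda>y. y ** adj2 x) ` B))) F
        = emeasure m A * (emeasure m B * emeasure m (adj2 ` F))"
      if [measurable]: "A \<in> sets m" "B \<in> sets m" for A B
      by (simp add: emeasure_density mult.assoc nn_integral_cmult right_translates_integral)
    then show "emeasure (density m (\<lambda>x. emeasure m E2 * emeasure m ((\<lambda>y. y ** adj2 x) ` E1))) F
      = emeasure (density m (\<lambda>x. emeasure m E1 * emeasure m ((\<lambda>y. y ** adj2 x) ` E2))) F"
      by (simp add: mult_ac)
  qed simp
qed (use right_translate_measurable in measurable)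

text \<open>In \<open>right_translates_integral\<close> the integral over N vanishes, so m(E)
  m(N^-1) = 0 for an open E of positive measure.\<close>

lemma null_sets_adj2:
  assumes N: "N \<in> null_sets m" shows "adj2 ` N \<in> null_sets m"
proof -
  have s: "N \<in> sets m" "nhd1 1 \<in> sets m" using N openin_sets_m[OF openin_nhd1] by auto
  have "emeasure m (nhd1 1) * emeasure m (adj2 ` N) = 0"
    using right_translates_integral[OF s(2,1)] N by (simp add: nn_integral_null_set)
  moreover have "emeasure m (nhd1 1) > 0"
    using mat1_nhd1[of 1] by (intro emeasure_open_pos openin_nhd1) auto
  ultimately show ?thesis using adj2_sets[OF s(1)] by (auto simp: null_sets_def)
qed

lemma AE_adj2:
  assumes "AE x in m. P x" shows "AE x in m. P (adj2 x)"
proof -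
  obtain N where N: "{x \<in> space m. \<not> P x} \<subseteq> N" "N \<in> null_sets m"
    using assms by (auto simp: eventually_ae_filter)
  have "{x \<in> space m. \<not> P (adj2 x)} \<subseteq> adj2 ` N"
  proof
    fix x assume "x \<in> {x \<in> space m. \<not> P (adj2 x)}"
    then have "adj2 x \<in> N" using N(1) by (auto simp: space_m)
    then show "x \<in> adj2 ` N" by (metis adj2_adj2 image_eqI)
  qed
  then show ?thesis using null_sets_adj2[OF N(2)] by (auto simp: eventually_ae_filter)
qed

lemma AE_left_translate:
  assumes "AE x in m. P x" "g \<in> SL2" shows "AE x in m. P (g ** x)"
proof -
  obtain N where N: "{x \<in> space m. \<not> P x} \<subseteq> N" "N \<in> null_sets m"
    using assms by (auto simp: eventually_ae_filter)
  have "{x \<in> space m. \<not> P (g ** x)} \<subseteq> (**) (adj2 g) ` N"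
  proof
    fix x assume x: "x \<in> {x \<in> space m. \<not> P (g ** x)}"
    then have "g ** x \<in> N" using N(1) assms(2) by (auto simp: space_m)
    moreover have "x = adj2 g ** (g ** x)" using assms(2) by (simp add: SL2_cancel)
    ultimately show "x \<in> (**) (adj2 g) ` N" by blast
  qed
  moreover have "(**) (adj2 g) ` N \<in> null_sets m"
    using N assms by (auto simp: null_sets_def left_invariant left_translate_sets SL2_adj2)
  ultimately show ?thesis by (auto simp: eventually_ae_filter)
qed

text \<open>Let f(g) be the measure of U g. Proportionality gives f(g) f(y) = f(1) f(gy) only for
  almost every y. Used for g, h and gh at one common y, it yields f(1) f(gh) = f(g) f(h), so f /
  f(1) is a positive character and hence trivial.\<close>

theorem unimodular:
  assumes U: "openin (top_of_set SL2) U" "bounded U" and g: "g \<in> SL2"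
  shows "emeasure m ((\<lambda>x. x ** g) ` U) = emeasure m U"
proof (cases "U = {}")
  case False
  define f where "f g = measure m ((\<lambda>x. x ** g) ` U)" for g
  have Us: "U \<in> sets m" using U openin_sets_m by blast
  have fin: "emeasure m ((\<lambda>x. x ** g) ` U) < \<infinity>" if "g \<in> SL2" for g
    using that Us U by (intro emeasure_bounded_finite right_translate_sets bounded_right_translate)
  have ef: "emeasure m ((\<lambda>x. x ** g) ` U) = ennreal (f g)" if "g \<in> SL2" for g
    unfolding f_def using fin[OF that] by (intro emeasure_eq_ennreal_measure) auto
  have fpos: "f g > 0" if "g \<in> SL2" for g
  proof -
    have "emeasure m ((\<lambda>x. x ** g) ` U) > 0"
      using that U False by (intro emeasure_open_pos openin_right_translate) auto
    then show ?thesis using ef[OF that] by simp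
  qed
  have ae: "AE y in m. f g * f y = f (mat 1) * f (g ** y)" if g: "g \<in> SL2" for g
  proof -
    have "AE x in m. emeasure m ((\<lambda>x. x ** g) ` U) * emeasure m ((\<lambda>y. y ** adj2 x) ` U)
        = emeasure m U * emeasure m ((\<lambda>y. y ** adj2 x) ` (\<lambda>x. x ** g) ` U)"
      using g Us by (intro AE_right_translates_proportional right_translate_sets)
    then have "AE x in m. f g * f (adj2 x) = f (mat 1) * f (g ** adj2 x)"
    proof (rule AE_mp, intro AE_I2 impI)
      fix x assume "x \<in> space m" and eq: "emeasure m ((\<lambda>x. x ** g) ` U) * emeasure m ((\<lambda>y. y ** adj2 x) ` U)
        = emeasure m U * emeasure m ((\<lambda>y. y ** adj2 x) ` (\<lambda>x. x ** g) ` U)"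
      then have x: "adj2 x \<in> SL2" by (auto simp: space_m)
      have "(\<lambda>y. y ** adj2 x) ` (\<lambda>x. x ** g) ` U = (\<lambda>y. y ** (g ** adj2 x)) ` U"
        by (simp add: image_image matrix_mul_assoc)
      moreover have "emeasure m U = ennreal (f (mat 1))" using ef[of "mat 1"] by simp
      ultimately have "ennreal (f g) * ennreal (f (adj2 x)) = ennreal (f (mat 1)) * ennreal (f (g ** adj2 x))"
        using eq ef[OF g] ef[OF x] ef[of "g ** adj2 x"] g x by (metis SL2_mult)
      then show "f g * f (adj2 x) = f (mat 1) * f (g ** adj2 x)"
        by (simp add: ennreal_mult[symmetric] f_def)
    qed
    then have "AE x in m. f g * f (adj2 (adj2 x)) = f (mat 1) * f (g ** adj2 (adj2 x))"
      by (rule AE_adj2)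
    then show ?thesis by simp
  qed
  have mul: "f (mat 1) * f (g ** h) = f g * f h" if g: "g \<in> SL2" and h: "h \<in> SL2" for g h
  proof -
    have "AE y in m. y \<in> SL2 \<and> f (g ** h) * f y = f (mat 1) * f (g ** h ** y)
        \<and> f h * f y = f (mat 1) * f (h ** y) \<and> f g * f (h ** y) = f (mat 1) * f (g ** (h ** y))"
      using AE_space[of m, unfolded space_m]
      by (intro AE_conjI ae[OF h] ae[OF SL2_mult[OF g h]] AE_left_translate[OF ae[OF g] h]) 
    moreover have "emeasure m (space m) \<noteq> 0" using haar by (simp add: haar_measure_def space_m)
    then have "ae_filter m \<noteq> bot" by (simp add: ae_filter_eq_bot_iff)
    ultimately obtain y where y: "y \<in> SL2" "f (g ** h) * f y = f (mat 1) * f (g ** h ** y)"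
        "f h * f y = f (mat 1) * f (h ** y)" "f g * f (h ** y) = f (mat 1) * f (g ** (h ** y))"
      using eventually_happens' by blast
    have "f (mat 1) * f (g ** h) * f y = f g * f h * f y"
      using y(2-4) by (simp add: matrix_mul_assoc) algebra
    then show ?thesis using fpos[OF y(1)] by simp
  qed
  have "f g / f (mat 1) = 1"
  proof (rule positive_character_SL2_trivial[OF _ _ g])
    fix g h assume "g \<in> SL2" "h \<in> SL2"
    then show "f (g ** h) / f (mat 1) = f g / f (mat 1) * (f h / f (mat 1))"
      using mul[of g h] fpos[of "mat 1"] by (simp add: field_simps)
  qed (use fpos in auto)
  then have "f g = f (mat 1)" using fpos[of "mat 1"] by simp
  then show ?thesis using ef[OF g] ef[of "mat 1"] by simp
qed simp

end

section \<open>The quotient and its thick part\<close>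

lemma act_eq_image: "g \<bullet>\<^sub>X x = (**) g ` x"
  by (auto simp: l_coset_def SL2R_def)

lemma act_act: "g \<bullet>\<^sub>X h \<bullet>\<^sub>X x = (g ** h) \<bullet>\<^sub>X x"
  by (simp add: act_eq_image image_image matrix_mul_assoc)

lemma inj_act: assumes "g \<in> SL2" shows "inj ((\<bullet>\<^sub>X) g)"
proof (rule injI)
  fix x y assume "g \<bullet>\<^sub>X x = g \<bullet>\<^sub>X y"
  then have "adj2 g \<bullet>\<^sub>X g \<bullet>\<^sub>X x = adj2 g \<bullet>\<^sub>X g \<bullet>\<^sub>X y" by simp
  then show "x = y" using assms by (simp add: act_act SL2_cancel) (simp add: act_eq_image)
qed

section \<open>The projection and the induced measure\<close>

context discrete_subgroup_SL2R
begin

abbreviation pr :: "real^2^2 \<Rightarrow> (real^2^2) set" where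
  "pr g \<equiv> g \<bullet>\<^sub>X \<Gamma>"

lemma mem_SL2: "\<gamma> \<in> \<Gamma> \<Longrightarrow> \<gamma> \<in> SL2"
  by (simp add: SL2_iff det_mem)

lemma quotient_space_eq: "quotient_space \<Gamma> = pr ` SL2"
  by (auto simp: LCOSETS_def)

lemma pr_eq_iff:
  assumes "g \<in> SL2" "h \<in> SL2"
  shows "pr g = pr h \<longleftrightarrow> adj2 g ** h \<in> \<Gamma>"
proof
  assume "pr g = pr h"
  moreover have "h \<in> pr h" using one_mem by (auto simp: act_eq_image intro: image_eqI[of _ _ "mat 1"])
  ultimately obtain \<gamma> where "\<gamma> \<in> \<Gamma>" "h = g ** \<gamma>" by (auto simp: act_eq_image)
  then show "adj2 g ** h \<in> \<Gamma>" using assms by (simp add: SL2_cancel)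
next
  assume a: "adj2 g ** h \<in> \<Gamma>"
  have "(**) (adj2 g ** h) ` \<Gamma> = \<Gamma>"
  proof (safe)
    fix \<gamma> assume "\<gamma> \<in> \<Gamma>"
    then have "\<gamma> = (adj2 g ** h) ** (adj2 (adj2 g ** h) ** \<gamma>)" "adj2 (adj2 g ** h) ** \<gamma> \<in> \<Gamma>"
      using mem_SL2[OF a] a by (auto simp: SL2_cancel intro: mult_mem adj2_mem)
    then show "\<gamma> \<in> (**) (adj2 g ** h) ` \<Gamma>" by blast
  qed (use a mult_mem in blast)
  then have "pr (adj2 g ** h) = \<Gamma>" by (simp add: act_eq_image)
  then have "pr g = g \<bullet>\<^sub>X (adj2 g ** h) \<bullet>\<^sub>X \<Gamma>" by simp
  also have "\<dots> = pr h" using assms by (simp add: act_act SL2_cancel)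
  finally show "pr g = pr h" .
qed

lemma pr_mult_mem: "g \<in> SL2 \<Longrightarrow> \<gamma> \<in> \<Gamma> \<Longrightarrow> pr (g ** \<gamma>) = pr g"
  by (subst eq_commute, subst pr_eq_iff) (auto simp: SL2_cancel mem_SL2)

lemma pr_eqE:
  assumes "g \<in> SL2" "h \<in> SL2" "pr g = pr h"
  obtains \<gamma> where "\<gamma> \<in> \<Gamma>" "h = g ** \<gamma>"
  using assms pr_eq_iff[of g h] by (intro that[of "adj2 g ** h"]) (auto simp: SL2_cancel)

lemma saturation_eq:
  assumes "W \<subseteq> SL2"
  shows "{g \<in> SL2. pr g \<in> pr ` W} = (\<Union>\<gamma>\<in>\<Gamma>. (\<lambda>x. x ** \<gamma>) ` W)"
proof (intro equalityI subsetI)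
  fix g assume "g \<in> {g \<in> SL2. pr g \<in> pr ` W}"
  then obtain w where g: "g \<in> SL2" and w: "w \<in> W" "pr w = pr g" by auto
  obtain \<gamma> where "\<gamma> \<in> \<Gamma>" "g = w ** \<gamma>" using pr_eqE[of w g] w g assms by blast
  then show "g \<in> (\<Union>\<gamma>\<in>\<Gamma>. (\<lambda>x. x ** \<gamma>) ` W)" using w by blast
qed (use assms mem_SL2 pr_mult_mem in auto)

lemma openin_saturation:
  assumes "openin (top_of_set SL2) W"
  shows "openin (top_of_set SL2) {g \<in> SL2. pr g \<in> pr ` W}"
proof -
  have "W \<subseteq> SL2" using assms openin_imp_subset by blast
  then show ?thesis unfolding saturation_eq[OF \<open>W \<subseteq> SL2\<close>]
    using assms mem_SL2 by (intro openin_Union) (auto intro: openin_right_translate)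
qed

lemma openin_pr:
  assumes "openin (top_of_set SL2) W"
  shows "openin (quotient_topology \<Gamma>) (pr ` W)"
  using assms openin_saturation[OF assms] openin_imp_subset[OF assms]
  by (auto simp: openin_quotient_topology quotient_space_eq)

text \<open>Two points gh and gk differ by (gh)^-1 (gk) = h^-1 k, in which g cancels, so one u
  serves all left translates. For right translates g survives as a conjugation, whence the thick
  part below.\<close>

lemma small_left_translate_inj:
  obtains u where "u > 0" "\<And>g. g \<in> SL2 \<Longrightarrow> inj_on pr ((**) g ` nhd1 u)"
proof -
  obtain r where r: "r > 0" "\<And>\<gamma>. \<gamma> \<in> \<Gamma> \<Longrightarrow> norm (\<gamma> - mat 1) < r \<Longrightarrow> \<gamma> = mat 1"
    by (rule separated_from_1) blast
  \<comment> \<open>The 6 is 3 * 2: h has norm at most 3, and k - h has norm below 2 u.\<close>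
  define u where "u = min 1 (r / 6)"
  have u: "0 < u" "u \<le> 1" "6 * u \<le> r" using r by (auto simp: u_def)
  have n1: "norm (mat 1 :: real^2^2) \<le> 2"
    by (rule power2_le_imp_le) (simp_all add: norm_sq_mat2)
  have "inj_on pr ((**) g ` nhd1 u)" if g: "g \<in> SL2" for g
  proof (rule inj_onI)
    fix x y assume "x \<in> (**) g ` nhd1 u" "y \<in> (**) g ` nhd1 u" and eq: "pr x = pr y"
    then obtain h k where h: "x = g ** h" "h \<in> SL2" "norm (h - mat 1) < u"
      and k: "y = g ** k" "k \<in> SL2" "norm (k - mat 1) < u" by (auto simp: nhd1_def)
    have "adj2 x ** y = adj2 h ** k"
      using g by (simp add: h(1) k(1) adj2_mult matrix_mul_assoc[symmetric] SL2_cancel)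
    then have "adj2 h ** k \<in> \<Gamma>" using eq pr_eq_iff[of x y] g h k by auto
    moreover have "norm (adj2 h ** k - mat 1) < r"
    proof -
      have "adj2 h ** k - mat 1 = adj2 h ** (k - h)" using h by (simp add: matrix_diff_ldistrib2 SL2_cancel)
      then have "norm (adj2 h ** k - mat 1) \<le> norm h * norm (k - h)"
        using norm_matrix_mult_le[of "adj2 h" "k - h"] by simp
      moreover have "norm h \<le> 3" using norm_triangle_ineq[of "h - mat 1" "mat 1"] h u n1 by simp
      moreover have "norm (k - h) < 2 * u"
        using norm_triangle_ineq4[of "k - mat 1" "h - mat 1"] h k by simp
      ultimately have "norm (adj2 h ** k - mat 1) < 3 * (2 * u)"
        using u mult_mono[of "norm h" 3 "norm (k - h)" "norm (k - h)"] by simp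
      then show ?thesis using u by simp
    qed
    ultimately have "adj2 h ** k = mat 1" by (rule r(2))
    then have "h ** (adj2 h ** k) = h" by simp
    then show "x = y" using h k by (simp add: SL2_cancel)
  qed
  then show ?thesis using u that by blast
qed

end

locale SL2R_lattice = discrete_subgroup_SL2R + haar_SL2R +
  fixes \<mu> :: "(real^2^2) set measure"
  assumes induced: "induced_measure \<Gamma> m \<mu>" and total: "emeasure \<mu> (quotient_space \<Gamma>) = 1"
begin

lemma space_\<mu>: "space \<mu> = quotient_space \<Gamma>"
  using induced by (simp add: induced_measure_def)

sublocale prob_quotient: finite_measure \<mu>
  by standard (simp add: space_\<mu> total)

lemma openin_sets_\<mu>: "openin (quotient_topology \<Gamma>) U \<Longrightarrow> U \<in> sets \<mu>"
  using induced by (auto simp: induced_measure_def intro: sigma_sets.Basic)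

lemma pr_open_sets: "openin (top_of_set SL2) W \<Longrightarrow> pr ` W \<in> sets \<mu>"
  by (intro openin_sets_\<mu> openin_pr)

lemma emeasure_pr: "E \<in> sets m \<Longrightarrow> inj_on pr E \<Longrightarrow> emeasure \<mu> (pr ` E) = emeasure m E"
  using induced by (simp add: induced_measure_def)

text \<open>\<open>induced_measure\<close> fixes the value of \<mu> only on injective images. So the
  image of W is cut into countably many disjoint images of sets \<open>E i\<close>, each inside a
  translate on which the projection is injective; left translation preserves this structure and the
  Haar measure of each piece.\<close>

theorem emeasure_left_invariant:
  assumes W: "openin (top_of_set SL2) W" and h: "h \<in> SL2"
  shows "emeasure \<mu> (pr ` (**) h ` W) = emeasure \<mu> (pr ` W)"
proof -
  obtain u where u: "u > 0" "\<And>g. g \<in> SL2 \<Longrightarrow> inj_on pr ((**) g ` nhd1 u)"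
    by (rule small_left_translate_inj) blast
  obtain D where D: "countable D" "D \<subseteq> SL2" "SL2 = (\<Union>g\<in>D. (**) g ` nhd1 u)"
    using countable_left_translates[OF openin_nhd1] mat1_nhd1[OF u(1)] by (metis empty_iff)
  have Dne: "D \<noteq> {}" using D(3) SL2_mat1 by blast
  define d where "d = from_nat_into D"
  have d: "d i \<in> SL2" for i using D(2) from_nat_into[OF Dne] by (auto simp: d_def)
  define V where "V i = (**) (d i) ` nhd1 u" for i
  have Vopen: "openin (top_of_set SL2) (V i)" for i
    unfolding V_def using d openin_left_translate openin_nhd1 by blast
  have Vsub: "V i \<subseteq> SL2" for i using Vopen openin_imp_subset by blast
  have Wsub: "W \<subseteq> SL2" using W openin_imp_subset by blast
  have "range d = D" using D(1) Dne by (simp add: d_def)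
  then have Vcov: "(\<Union>i. V i) = SL2" using D(3) by (auto simp: V_def)
  \<comment> \<open>What earlier \<open>V j\<close> cover is removed in the quotient, not just in
    the group; this makes the images disjoint.\<close>
  define E where "E i = {x \<in> V i. pr x \<in> pr ` W - (\<Union>j<i. pr ` V j)}" for i
  have Eeq: "E i = V i \<inter> {x \<in> SL2. pr x \<in> pr ` W} - (\<Union>j<i. {x \<in> SL2. pr x \<in> pr ` V j})" for i
    using Vsub by (auto simp: E_def)
  have "V i \<in> sets m" "{x \<in> SL2. pr x \<in> pr ` W} \<in> sets m" "{x \<in> SL2. pr x \<in> pr ` V i} \<in> sets m" for i
    using W Vopen openin_sets_m openin_saturation by blast+
  then have Es: "E i \<in> sets m" for i
    unfolding Eeq by (intro sets.Diff sets.Int sets.finite_UN) auto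
  have Einj: "inj_on pr (E i)" for i
    using u(2)[OF d] by (rule inj_on_subset) (auto simp: E_def V_def)
  have prE: "pr ` E i = pr ` V i \<inter> pr ` W - (\<Union>j<i. pr ` V j)" for i
    by (auto simp: E_def)
  have cover: "(\<Union>i. pr ` E i) = pr ` W"
  proof (intro equalityI subsetI)
    fix y assume y: "y \<in> pr ` W"
    then have "\<exists>i. y \<in> pr ` V i" using Vcov Wsub by blast
    then obtain i where "y \<in> pr ` V i" "\<And>j. j < i \<Longrightarrow> y \<notin> pr ` V j"
      using exists_least_iff[of "\<lambda>i. y \<in> pr ` V i"] by blast
    then have "y \<in> pr ` E i" using y unfolding prE by blast
    then show "y \<in> (\<Union>i. pr ` E i)" by blast
  qed (auto simp: prE)
  have disj: "disjoint_family (\<lambda>i. pr ` E i)"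
    unfolding disjoint_family_on_def
  proof (intro ballI impI)
    fix i j :: nat assume "i \<noteq> j"
    then consider "i < j" | "j < i" by linarith
    then show "pr ` E i \<inter> pr ` E j = {}" by cases (auto simp: prE)
  qed
  \<comment> \<open>The right side does not depend on k; the claim compares k = h with k =
    1.\<close>
  have key: "emeasure \<mu> (pr ` (**) k ` W) = (\<Sum>i. emeasure m (E i))" if k: "k \<in> SL2" for k
  proof -
    have act: "pr ` (**) k ` A = (\<bullet>\<^sub>X) k ` pr ` A" for A
      by (simp add: image_image act_act)
    \<comment> \<open>Writing the image through images of open sets shows that it is
      measurable.\<close>
    have "pr ` (**) k ` E i = pr ` (**) k ` V i \<inter> pr ` (**) k ` W - (\<Union>j<i. pr ` (**) k ` V j)" for i
      unfolding act prE by (simp only: image_set_diff[OF inj_act[OF k]] image_Int[OF inj_act[OF k]] image_UN)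
    moreover have "pr ` (**) k ` V i \<in> sets \<mu>" "pr ` (**) k ` W \<in> sets \<mu>" for i
      using W Vopen k pr_open_sets openin_left_translate by blast+
    ultimately have s: "pr ` (**) k ` E i \<in> sets \<mu>" for i
      by (simp only:) (intro sets.Diff sets.Int sets.finite_UN; simp)
    have "disjoint_family (\<lambda>i. pr ` (**) k ` E i)"
      using disj unfolding act disjoint_family_on_def
      by (metis image_Int[OF inj_act[OF k]] image_empty)
    then have "(\<Sum>i. emeasure \<mu> (pr ` (**) k ` E i)) = emeasure \<mu> (\<Union>i. pr ` (**) k ` E i)"
      using s by (intro suminf_emeasure) auto
    also have "(\<Union>i. pr ` (**) k ` E i) = pr ` (**) k ` W"
      unfolding act by (simp only: cover[symmetric] image_UN)
    finally have sum: "emeasure \<mu> (pr ` (**) k ` W) = (\<Sum>i. emeasure \<mu> (pr ` (**) k ` E i))" by simp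
    have "emeasure \<mu> (pr ` (**) k ` E i) = emeasure m (E i)" for i
    proof -
      have "inj_on pr ((**) k ` E i)"
      proof (rule inj_onI, clarsimp)
        fix x y assume xy: "x \<in> E i" "y \<in> E i" "pr (k ** x) = pr (k ** y)"
        then have "pr x = pr y" using inj_act[OF k] by (auto simp: act_act[symmetric] inj_def)
        then show "k ** x = k ** y" using inj_onD[OF Einj] xy by blast
      qed
      then show ?thesis using emeasure_pr[of "(**) k ` E i"] left_translate_sets[OF k Es] left_invariant[OF k Es]
        by simp
    qed
    then show ?thesis using sum by simp
  qed
  show ?thesis using key[OF h] key[of "mat 1"] by simp
qed

text \<open>By unimodularity the thick points have neighbourhoods of equal measure, and only finitely many
  of these can be disjoint.\<close>

theorem thick_part_bounded:
  assumes \<rho>: "\<rho> > 0" and g0: "g\<^sub>0 \<in> SL2"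
  obtains D where "D \<ge> 1"
    "\<And>g. g \<in> SL2 \<Longrightarrow> (\<And>\<eta>. \<eta> \<in> \<Gamma> \<Longrightarrow> tl2 \<eta> \<noteq> 0 \<Longrightarrow> norm (conj2 g (tl2 \<eta>)) \<ge> \<rho>) \<Longrightarrow>
      \<exists>\<gamma>\<in>\<Gamma>. norm (g ** \<gamma> ** adj2 g\<^sub>0) \<le> D"
proof -
  define thick where "thick = {g \<in> SL2. \<forall>\<eta>\<in>\<Gamma>. tl2 \<eta> \<noteq> 0 \<longrightarrow> norm (conj2 g (tl2 \<eta>)) \<ge> \<rho>}"
  \<comment> \<open>For h and k in U the element h^-1 k is within 6 u of 1. This must be below
    \<rho> to contradict thickness and below 1 to exclude -1.\<close>
  define u where "u = min 1 \<rho> / 7"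
  have u: "u > 0" "u \<le> 1" "6 * u < \<rho>" "6 * u < 1" using \<rho> by (auto simp: u_def min_def)
  let ?U = "nhd1 u"
  define S where "S g = pr ` (\<lambda>x. x ** g) ` ?U" for g
  have n1: "norm (mat 1 :: real^2^2) \<le> 2"
    by (rule power2_le_imp_le) (simp_all add: norm_sq_mat2)
  have nU: "norm h \<le> 3" if "h \<in> ?U" for h
    using norm_triangle_ineq[of "h - mat 1" "mat 1"] that u n1 by (simp add: nhd1_def)
  \<comment> \<open>Points hg and kg with the same projection differ by some \<eta> in \<Gamma> with
    \<open>conj2 g \<eta>\<close> = h^-1 k. Thickness leaves no room for a noncentral
    \<eta>.\<close>
  have inj: "inj_on pr ((\<lambda>x. x ** g) ` ?U)" if g: "g \<in> thick" for g
  proof (rule inj_onI, clarify)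
    have gS: "g \<in> SL2" "det g = 1" using g by (auto simp: thick_def SL2_iff)
    fix h k assume h: "h \<in> ?U" and k: "k \<in> ?U" and eq: "pr (h ** g) = pr (k ** g)"
    have hk: "h \<in> SL2" "k \<in> SL2" using h k nhd1_subset by auto
    define \<eta> where "\<eta> = adj2 (h ** g) ** (k ** g)"
    have \<eta>: "\<eta> \<in> \<Gamma>" unfolding \<eta>_def using eq pr_eq_iff[of "h ** g" "k ** g"] gS hk by auto
    have c: "conj2 g \<eta> = adj2 h ** k"
      by (simp add: conj2_def \<eta>_def adj2_mult matrix_mul_assoc[symmetric] SL2_cancel gS)
    have "adj2 h ** k - mat 1 = adj2 h ** (k - h)" using hk by (simp add: matrix_diff_ldistrib2 SL2_cancel)
    then have "norm (adj2 h ** k - mat 1) \<le> norm h * norm (k - h)"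
      using norm_matrix_mult_le[of "adj2 h" "k - h"] by simp
    also have "\<dots> \<le> 3 * (2 * u)"
      using norm_triangle_ineq4[of "k - mat 1" "h - mat 1"] h k nU[OF h] u
      by (intro mult_mono) (auto simp: nhd1_def)
    finally have n: "norm (adj2 h ** k - mat 1) \<le> 6 * u" by simp
    have "norm (conj2 g (tl2 \<eta>)) < \<rho>"
      using norm_tl2_le[of "adj2 h ** k"] n u by (simp add: tl2_conj2[symmetric] gS c)
    then have "tl2 \<eta> = 0" using g \<eta> by (auto simp: thick_def not_le[symmetric])
    then have "tl2 (conj2 g \<eta>) = 0" by (simp add: tl2_conj2 gS conj2_eq_0_iff)
    then have "tl2 (adj2 h ** k) = 0" by (simp only: c)
    then have "adj2 h ** k = mat 1" using hk n u by (intro tl2_eq_0_near_1) (auto simp: SL2_iff det_mul)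
    then have "h ** (adj2 h ** k) = h" by simp
    then show "h ** g = k ** g" using hk by (simp add: SL2_cancel)
  qed
  have Uopen: "openin (top_of_set SL2) ?U" by (rule openin_nhd1)
  define c where "c = measure m ?U"
  have Ufin: "emeasure m ?U < \<infinity>" by (intro emeasure_bounded_finite bounded_nhd1 openin_sets_m Uopen)
  then have cU: "emeasure m ?U = ennreal c" unfolding c_def by (intro emeasure_eq_ennreal_measure) auto
  have "emeasure m ?U > 0" using mat1_nhd1[OF u(1)] by (intro emeasure_open_pos Uopen) auto
  then have c: "c > 0" using cU by simp
  have S: "S g \<in> sets \<mu>" "measure \<mu> (S g) = c" if g: "g \<in> thick" for g
  proof -
    have gS: "g \<in> SL2" using g by (simp add: thick_def)
    show "S g \<in> sets \<mu>" unfolding S_def using gS by (intro pr_open_sets openin_right_translate Uopen)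
    have "emeasure \<mu> (S g) = ennreal c" unfolding S_def cU[symmetric] unimodular[OF Uopen bounded_nhd1 gS, symmetric]
      using gS inj[OF g] by (intro emeasure_pr right_translate_sets openin_sets_m Uopen)
    then show "measure \<mu> (S g) = c" using c by (simp add: measure_def)
  qed
  define good where "good P \<longleftrightarrow> finite P \<and> P \<subseteq> thick \<and> disjoint_family_on S P" for P
  have "card P \<le> nat \<lceil>1 / c\<rceil>" if "good P" for P
  proof -
    have "real (card P) * c = (\<Sum>g\<in>P. measure \<mu> (S g))"
      using that S by (simp add: good_def subset_iff)
    also have "\<dots> = measure \<mu> (\<Union>g\<in>P. S g)"
      using that S by (intro prob_quotient.finite_measure_finite_Union[symmetric]) (auto simp: good_def)
    also have "\<dots> \<le> measure \<mu> (space \<mu>)" by (rule prob_quotient.bounded_measure)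
    also have "\<dots> = 1" using total by (simp add: measure_def space_\<mu>)
    finally have "real (card P) \<le> 1 / c" using c by (simp add: field_simps)
    then show ?thesis by linarith
  qed
  moreover have "good {}" by (simp add: good_def disjoint_family_on_def)
  \<comment> \<open>A maximal disjoint family: at most 1/c sets of measure c fit into total mass 1.
    Every other thick point then meets the neighbourhood of some member of P.\<close>
  ultimately obtain P where P: "good P" and max: "\<And>Q. good Q \<Longrightarrow> card Q \<le> card P"
    using ex_has_greatest_nat[of good "{}" card "Suc (nat \<lceil>1 / c\<rceil>)"]
    by (auto simp: less_Suc_eq_le)
  have fP: "finite P" "P \<subseteq> thick" using P by (auto simp: good_def)
  \<comment> \<open>The sum is a convenient bound for the maximum over P, also when P is empty; 9 is
    the product of the bounds 3 for h^-1 and k.\<close>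
  define D where "D = 1 + (\<Sum>p\<in>P. 9 * norm (p ** adj2 g\<^sub>0))"
  have DP: "9 * norm (p ** adj2 g\<^sub>0) \<le> D" if "p \<in> P" for p
    using member_le_sum[of p P "\<lambda>p. 9 * norm (p ** adj2 g\<^sub>0)"] that fP by (simp add: D_def)
  have D1: "D \<ge> 1" unfolding D_def by (simp add: sum_nonneg)
  have "\<exists>\<gamma>\<in>\<Gamma>. norm (g ** \<gamma> ** adj2 g\<^sub>0) \<le> D" if g: "g \<in> thick" for g
  proof (cases "g \<in> P")
    case True
    then have "norm (g ** mat 1 ** adj2 g\<^sub>0) \<le> D"
      using DP[OF True] norm_ge_zero[of "g ** adj2 g\<^sub>0"] by (simp del: norm_ge_zero)
    then show ?thesis using one_mem by blast
  next
    case False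
    have gS: "g \<in> SL2" using g by (simp add: thick_def)
    have "\<not> good (insert g P)" using max[of "insert g P"] False fP by auto
    then have "\<not> disjoint_family_on S (insert g P)" using g fP by (auto simp: good_def)
    moreover have "disjoint_family_on S P" using P by (simp add: good_def)
    ultimately obtain p where p: "p \<in> P" "S g \<inter> S p \<noteq> {}"
      using False by (fastforce simp: disjoint_family_on_def)
    then obtain h k where h: "h \<in> ?U" and k: "k \<in> ?U" and eq: "pr (h ** g) = pr (k ** p)"
      by (auto simp: S_def)
    have pS: "p \<in> SL2" using p fP by (auto simp: thick_def)
    have hk: "h \<in> SL2" "k \<in> SL2" using h k nhd1_subset by auto
    then obtain \<gamma> where \<gamma>: "\<gamma> \<in> \<Gamma>" "k ** p = h ** g ** \<gamma>" using pr_eqE[OF _ _ eq] gS pS by blast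
    have "g ** \<gamma> = adj2 h ** (k ** p)"
      using hk by (simp add: \<gamma>(2) matrix_mul_assoc[symmetric] SL2_cancel)
    then have "g ** \<gamma> ** adj2 g\<^sub>0 = adj2 h ** (k ** (p ** adj2 g\<^sub>0))" by (simp add: matrix_mul_assoc)
    then have "norm (g ** \<gamma> ** adj2 g\<^sub>0) \<le> norm h * (norm k * norm (p ** adj2 g\<^sub>0))"
      using norm_matrix_mult_le[of "adj2 h" "k ** (p ** adj2 g\<^sub>0)"]
        mult_left_mono[OF norm_matrix_mult_le[of k "p ** adj2 g\<^sub>0"], of "norm h"] by simp
    also have "\<dots> \<le> 3 * (3 * norm (p ** adj2 g\<^sub>0))"
      using nU h k by (intro mult_mono) auto
    also have "\<dots> \<le> D" using DP[OF p(1)] by simp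
    finally show ?thesis using \<gamma> by blast
  qed
  then show ?thesis using D1 by (intro that[of D]) (auto simp: thick_def)
qed

end

section \<open>The cusps\<close>

lemma tl2_tl2 [simp]: "tl2 (tl2 A) = tl2 A"
  by (simp add: mat2_eq_iff field_simps)

text \<open>Used with t = 1 or t = -1: a parabolic element may be minus a unipotent one, and
  squaring removes the sign.\<close>

lemma nil2_shift_square:
  "(mat t + s *\<^sub>R nil2 u) ** (mat t + s *\<^sub>R nil2 u) = mat (t\<^sup>2) + (2 * t * s) *\<^sub>R nil2 u"
  by (simp add: entry_simps power2_eq_square algebra_simps)

context SL2R_lattice
begin

text \<open>Enlarge the smallest element at \<open>g\<close> by a conjugation of least cost until the point is
  thick. This bounds the distance of \<open>g\<close> from the base point; and since only finitely many
  conjugacy classes come near the base point, a very small element must be parabolic.\<close>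

theorem far_imp_short_parabolic_vector:
  assumes g0: "g\<^sub>0 \<in> SL2"
  obtains K L\<^sub>1 where "K > 0" "L\<^sub>1 \<ge> 1"
    "\<And>g L. g \<in> SL2 \<Longrightarrow> L \<ge> L\<^sub>1 \<Longrightarrow> (\<And>\<gamma>. \<gamma> \<in> \<Gamma> \<Longrightarrow> L \<le> norm (g ** \<gamma> ** adj2 g\<^sub>0)) \<Longrightarrow>
      \<exists>w\<in>parabolic_vectors. (norm (g *v w))\<^sup>2 \<le> K / L\<^sup>2"
proof -
  obtain D where D: "D \<ge> 1"
    "\<And>g. g \<in> SL2 \<Longrightarrow> (\<And>\<eta>. \<eta> \<in> \<Gamma> \<Longrightarrow> tl2 \<eta> \<noteq> 0 \<Longrightarrow> norm (conj2 g (tl2 \<eta>)) \<ge> 1 / 576) \<Longrightarrow>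
      \<exists>\<gamma>\<in>\<Gamma>. norm (g ** \<gamma> ** adj2 g\<^sub>0) \<le> D"
    by (rule thick_part_bounded[of "1/576", OF _ g0]) (simp, blast)
  have dg0: "det g\<^sub>0 = 1" using g0 by (simp add: SL2_iff)
  define B where "B = (norm g\<^sub>0)\<^sup>2 * (2 * D\<^sup>2)"
  \<comment> \<open>det (\<open>tl2 \<gamma>\<close>) = 1 - (tr \<gamma> / 2)^2 is invariant under
    conjugation and vanishes exactly at trace 2 or -2. It takes finitely many values on bounded
    elements, so the nonzero ones keep a distance c from 0.\<close>
  define F where "F = (\<lambda>\<gamma>. det (tl2 \<gamma>)) ` {\<gamma> \<in> \<Gamma>. norm \<gamma> \<le> B}"
  have F: "finite F" unfolding F_def by (intro finite_imageI finite_bounded)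
  define c where "c = Min (insert 1 (abs ` (F - {0})))"
  have c0: "c > 0" unfolding c_def using F by (subst Min_gr_iff) auto
  have cF: "c \<le> \<bar>x\<bar>" if "x \<in> F" "x \<noteq> 0" for x
    unfolding c_def using F that by (intro Min_le) auto
  \<comment> \<open>Exceeding D rules out that g is thick; exceeding D^2 / sqrt c will push the
    determinant of the smallest traceless part below c.\<close>
  define L\<^sub>1 where "L\<^sub>1 = D + 1 + D\<^sup>2 / sqrt c"
  have "D\<^sup>2 / sqrt c \<ge> 0" using c0 by simp
  then have L1: "L\<^sub>1 > D" "L\<^sub>1 \<ge> 1" "L\<^sub>1 > D\<^sup>2 / sqrt c" using D(1) by (auto simp: L\<^sub>1_def)
  have main: "\<exists>w\<in>parabolic_vectors. (norm (g *v w))\<^sup>2 \<le> 2 * D\<^sup>2 / L\<^sup>2"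
    if g: "g \<in> SL2" and L: "L \<ge> L\<^sub>1" and far: "\<And>\<gamma>. \<gamma> \<in> \<Gamma> \<Longrightarrow> L \<le> norm (g ** \<gamma> ** adj2 g\<^sub>0)" for g L
  proof -
    have dg: "det g = 1" using g by (simp add: SL2_iff)
    have L': "L \<ge> 1" "L > D" "L > D\<^sup>2 / sqrt c" using L L1 by auto
    have "\<exists>\<eta>\<in>\<Gamma>. tl2 \<eta> \<noteq> 0 \<and> norm (conj2 g (tl2 \<eta>)) < 1 / 576"
    proof (rule ccontr)
      assume "\<not> ?thesis"
      then obtain \<gamma> where "\<gamma> \<in> \<Gamma>" "norm (g ** \<gamma> ** adj2 g\<^sub>0) \<le> D" using D(2)[OF g] by force
      then show False using far[of \<gamma>] L' by linarith
    qed
    then obtain \<eta> where \<eta>: "\<eta> \<in> \<Gamma>" "tl2 \<eta> \<noteq> 0" "norm (conj2 g (tl2 \<eta>)) < 1 / 576" by blast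
    obtain \<delta> where \<delta>: "\<delta> \<in> \<Gamma>" "tl2 \<delta> \<noteq> 0"
      and min: "\<And>\<eta>. \<eta> \<in> \<Gamma> \<Longrightarrow> tl2 \<eta> \<noteq> 0 \<Longrightarrow> norm (conj2 g (tl2 \<delta>)) \<le> norm (conj2 g (tl2 \<eta>))"
      using minimal_element[OF dg \<eta>(1,2)] by blast
    define M where "M = conj2 g (tl2 \<delta>)"
    define f where "f = norm M"
    have f: "f > 0" "f < 1 / 576"
      using \<delta>(2) dg min[OF \<eta>(1,2)] \<eta>(3) by (auto simp: f_def M_def conj2_eq_0_iff)
    have "tl2 M = M" unfolding M_def tl2_conj2[OF dg, symmetric] by simp
    \<comment> \<open>With l f = 1/96 the enlarged element has size between 1/576 and 6/96 = 1/16: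
      large enough for thickness, still small enough for the commutator argument.\<close>
    define l where "l = 1 / (96 * f)"
    have l: "l \<ge> 1" "l * f = 1 / 96" using f by (auto simp: l_def)
    obtain h where h: "det h = 1" "(norm h)\<^sup>2 \<le> 6 * l" "norm (conj2 h M) \<ge> l * norm M / 6"
      using expanding_conjugation[OF \<open>tl2 M = M\<close> l(1)] by blast
    define N where "N = conj2 (h ** g) (tl2 \<delta>)"
    have N: "N = conj2 h M" by (simp add: N_def M_def conj2_conj2)
    have Nlow: "norm N \<ge> 1 / 576" using h(3) l(2) by (simp add: N f_def)
    have "norm N \<le> (norm h)\<^sup>2 * f" unfolding N f_def by (rule norm_conj2_le)
    also have "\<dots> \<le> (6 * l) * f" using h(2) f by (intro mult_right_mono) auto
    finally have Nup: "norm N \<le> 1 / 16" using l(2) by simp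
    have hg: "h ** g \<in> SL2" "det (h ** g) = 1" using h(1) dg by (simp_all add: SL2_iff det_mul)
    \<comment> \<open>An element \<zeta> smaller than \<delta> at hg would commute with \<delta>.
      Its traceless part would then be b times that of \<delta> with |b| < 1, against the minimality
      of \<delta> at g.\<close>
    have thick: "norm (conj2 (h ** g) (tl2 \<eta>)) \<ge> 1 / 576" if \<eta>: "\<eta> \<in> \<Gamma>" "tl2 \<eta> \<noteq> 0" for \<eta>
    proof (rule ccontr)
      assume small: "\<not> ?thesis"
      obtain \<zeta> where \<zeta>: "\<zeta> \<in> \<Gamma>" "tl2 \<zeta> \<noteq> 0"
        and min\<zeta>: "\<And>\<eta>. \<eta> \<in> \<Gamma> \<Longrightarrow> tl2 \<eta> \<noteq> 0 \<Longrightarrow> norm (conj2 (h ** g) (tl2 \<zeta>)) \<le> norm (conj2 (h ** g) (tl2 \<eta>))"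
        using minimal_element[OF hg(2) \<eta>] by blast
      have s\<zeta>: "norm (conj2 (h ** g) (tl2 \<zeta>)) < norm N" using min\<zeta>[OF \<eta>] small Nlow by linarith
      have "\<zeta> ** \<delta> = \<delta> ** \<zeta>"
        by (rule minimal_element_commutes[OF hg(2) \<zeta>(1) min\<zeta> \<delta>(1)]) (use Nup in \<open>auto simp: N_def\<close>)
      then obtain b where b: "tl2 \<zeta> = b *\<^sub>R tl2 \<delta>"
        using commuting_tl2_proportional[of \<delta> \<zeta>] \<delta>(2) by metis
      have "\<bar>b\<bar> * norm N < 1 * norm N" using s\<zeta> by (simp add: b conj2_scaleR N_def)
      then have "\<bar>b\<bar> < 1" using Nlow by (subst (asm) mult_less_cancel_right) auto
      moreover have "f \<le> \<bar>b\<bar> * f" using min[OF \<zeta>] by (simp add: b conj2_scaleR f_def M_def)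
      ultimately show False using f by (simp add: mult_le_cancel_right)
    qed
    obtain \<gamma> where \<gamma>: "\<gamma> \<in> \<Gamma>" "norm (h ** g ** \<gamma> ** adj2 g\<^sub>0) \<le> D"
      using D(2)[OF hg(1) thick] by blast
    define P where "P = h ** g ** \<gamma> ** adj2 g\<^sub>0"
    \<comment> \<open>Undoing h costs at most the factor \<open>norm h\<close>, whose square is at
      most 6 l. Combined with l f = 1/96 this bounds f \<open>L\<^sup>2\<close>.\<close>
    have "g ** \<gamma> ** adj2 g\<^sub>0 = adj2 h ** P"
      by (simp add: P_def matrix_mul_assoc[symmetric] mult_adj2_cancel h(1))
    then have "L \<le> norm (adj2 h ** P)" using far[OF \<gamma>(1)] by simp
    also have "\<dots> \<le> norm h * norm P" using norm_matrix_mult_le[of "adj2 h" P] by simp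
    also have "\<dots> \<le> norm h * D" using \<gamma>(2) by (intro mult_left_mono) (auto simp: P_def)
    finally have "L\<^sup>2 \<le> (norm h * D)\<^sup>2" using L' by (intro power_mono) auto
    also have "\<dots> \<le> (6 * l) * D\<^sup>2" unfolding power_mult_distrib using h(2) by (intro mult_right_mono) auto
    finally have "f * L\<^sup>2 \<le> f * ((6 * l) * D\<^sup>2)" using f by (intro mult_left_mono) auto
    also have "\<dots> = 6 * (l * f) * D\<^sup>2" by simp
    also have "\<dots> \<le> D\<^sup>2" unfolding l(2) by simp
    finally have fL: "f \<le> D\<^sup>2 / L\<^sup>2" using L' by (simp add: pos_le_divide_eq)
    \<comment> \<open>Conjugation by \<gamma>^-1 brings \<delta> into bounded position relative to
      the base point without changing the determinant of its traceless part.\<close>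
    define \<delta>' where "\<delta>' = conj2 (adj2 \<gamma>) \<delta>"
    have d\<gamma>: "det (adj2 \<gamma>) = 1" using \<gamma> by (simp add: det_mem)
    have \<delta>': "\<delta>' \<in> \<Gamma>" unfolding \<delta>'_def conj2_def using \<delta> \<gamma> by (auto intro: mult_mem adj2_mem)
    have "conj2 g\<^sub>0 \<delta>' = conj2 (adj2 P) (conj2 (h ** g) \<delta>)"
    proof -
      have "adj2 P ** (h ** g) = g\<^sub>0 ** adj2 \<gamma>"
        by (simp add: P_def adj2_mult matrix_mul_assoc[symmetric] mult_adj2_cancel adj2_mult_self h(1) dg)
      then show ?thesis by (simp add: \<delta>'_def conj2_conj2)
    qed
    moreover have "norm (conj2 (h ** g) \<delta>) \<le> 2"
      using Nup by (intro norm_small_SL2_le_2) (auto simp: det_conj2 hg det_mem \<delta> tl2_conj2 N_def)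
    ultimately have "norm (conj2 g\<^sub>0 \<delta>') \<le> (norm P)\<^sup>2 * 2"
      using norm_conj2_le[of "adj2 P" "conj2 (h ** g) \<delta>"] mult_left_mono[of "norm (conj2 (h ** g) \<delta>)" 2 "(norm P)\<^sup>2"]
      by simp
    also have "\<dots> \<le> D\<^sup>2 * 2" using \<gamma>(2) by (intro mult_right_mono power_mono) (auto simp: P_def)
    finally have "(norm g\<^sub>0)\<^sup>2 * norm (conj2 g\<^sub>0 \<delta>') \<le> B"
      unfolding B_def by (intro mult_left_mono) auto
    then have "norm \<delta>' \<le> B" using norm_le_of_conj2[OF dg0, of \<delta>'] by linarith
    moreover have "det (tl2 \<delta>') = det (tl2 \<delta>)" by (simp add: \<delta>'_def tl2_conj2 d\<gamma> det_conj2 del: det_adj2)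
    ultimately have inF: "det (tl2 \<delta>) \<in> F" using \<delta>' unfolding F_def by (metis (mono_tags, lifting) image_eqI mem_Collect_eq)
    have "\<bar>det (tl2 \<delta>)\<bar> \<le> f\<^sup>2" using abs_det_le_norm_sq[of M] by (simp add: M_def det_conj2 dg f_def)
    also have "f\<^sup>2 < c"
    proof -
      have "f \<le> D\<^sup>2 / L\<^sup>2" by (rule fL)
      also have "\<dots> \<le> D\<^sup>2 / L" using L' by (intro divide_left_mono) (auto simp: power2_eq_square)
      also have "\<dots> < sqrt c" using L' c0 by (simp add: field_simps)
      finally have "f\<^sup>2 < (sqrt c)\<^sup>2" using f by (intro power_strict_mono) auto
      then show ?thesis using c0 by simp
    qed
    finally have det0: "det (tl2 \<delta>) = 0" using cF[OF inF] by linarith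
    obtain \<sigma> u where \<sigma>: "\<sigma> = 1 \<or> \<sigma> = -1" "tl2 \<delta> = \<sigma> *\<^sub>R nil2 u"
      using nilpotent_is_nil2[OF tl2_tl2 det0] by blast
    define \<tau> where "\<tau> = (\<delta>$1$1 + \<delta>$2$2) / 2"
    have dec: "\<delta> = mat \<tau> + \<sigma> *\<^sub>R nil2 u" using tl2_decomp[of \<delta>] by (simp add: \<tau>_def \<sigma>)
    have "det (tl2 \<delta>) = det \<delta> - \<tau>\<^sup>2" by (simp add: det_2 \<tau>_def power2_eq_square field_simps)
    then have \<tau>: "\<tau>\<^sup>2 = 1" using det0 \<delta>(1) by (simp add: det_mem)
    have "\<delta> ** \<delta> \<in> \<Gamma>" using \<delta> mult_mem by blast
    then have mem: "mat 1 + (2 * \<tau> * \<sigma>) *\<^sub>R nil2 u \<in> \<Gamma>" by (subst (asm) (1 2) dec) (simp only: nil2_shift_square \<tau>)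
    have abs: "\<bar>2 * \<tau> * \<sigma>\<bar> = 2" using \<sigma>(1) \<tau> by (auto simp: abs_mult power2_eq_1_iff)
    have u: "u \<noteq> 0" using \<delta>(2) \<sigma> by auto
    have "sqrt \<bar>2 * \<tau> * \<sigma>\<bar> *\<^sub>R u \<in> parabolic_vectors"
      by (rule parabolic_vectorsI[OF mem _ u]) (use abs in auto)
    then have w: "sqrt 2 *\<^sub>R u \<in> parabolic_vectors" by (simp only: abs)
    have "f = \<bar>\<sigma>\<bar> * norm (conj2 g (nil2 u))" by (simp add: f_def M_def \<sigma>(2) conj2_scaleR)
    also have "\<dots> = (norm (g *v u))\<^sup>2" using \<sigma>(1) by (auto simp: conj2_nil2 dg norm_nil2)
    finally have "(norm (g *v (sqrt 2 *\<^sub>R u)))\<^sup>2 = 2 * f"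
      by (simp add: matrix_vector_mult_scaleR power_mult_distrib)
    also have "\<dots> \<le> 2 * D\<^sup>2 / L\<^sup>2" using fL by simp
    finally show ?thesis using w by blast
  qed
  show ?thesis using main L1 D(1) by (intro that[of "2 * D\<^sup>2" L\<^sub>1]) auto
qed

end

section \<open>Measure of the cusp neighbourhoods\<close>

context SL2R_lattice
begin

definition cusp_set :: "(real^2) set \<Rightarrow> (real^2^2) set" where
  "cusp_set S = {g \<in> SL2. \<exists>w\<in>parabolic_vectors. g *v w \<in> S}"

lemma openin_cusp_set:
  assumes "open S" shows "openin (top_of_set SL2) (cusp_set S)"
proof -
  have "openin (top_of_set SL2) (SL2 \<inter> (\<lambda>g. g *v w) -` S)" for w
    using assms unfolding matrix_vector_mult_def
    by (intro continuous_openin_preimage_gen continuous_intros) auto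
  moreover have "cusp_set S = (\<Union>w\<in>parabolic_vectors. SL2 \<inter> (\<lambda>g. g *v w) -` S)"
    by (auto simp: cusp_set_def)
  ultimately show ?thesis by (simp only:) (rule openin_Union, blast)
qed

lemma cusp_set_translate:
  assumes "h \<in> SL2" shows "cusp_set ((*v) h ` S) = (**) h ` cusp_set S"
proof -
  have "cusp_set S \<subseteq> SL2" by (auto simp: cusp_set_def)
  moreover have "x *v w \<in> (*v) h ` S \<longleftrightarrow> (adj2 h ** x) *v w \<in> S" for x w
  proof -
    have "x *v w = h *v (adj2 h *v (x *v w))" using assms by (simp add: SL2_iff adj2_vector_cancel)
    then have "x *v w \<in> (*v) h ` S" if "adj2 h *v (x *v w) \<in> S" using that by (metis image_eqI)
    moreover have "adj2 h *v (x *v w) \<in> S" if "x *v w \<in> (*v) h ` S"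
      using that assms by (auto simp: SL2_iff adj2_vector_cancel)
    ultimately show ?thesis by (auto simp: matrix_vector_mul_assoc[symmetric])
  qed
  ultimately show ?thesis using assms
    by (subst left_translate_eq) (auto simp: cusp_set_def)
qed

text \<open>\<Gamma> permutes the parabolic vectors. Two points with a common projection can
  therefore be tested at one representative.\<close>

lemma cusp_set_mult_mem:
  assumes "g \<in> cusp_set S" "\<gamma> \<in> \<Gamma>" shows "g ** \<gamma> \<in> cusp_set S"
proof -
  obtain w where w: "w \<in> parabolic_vectors" "g *v w \<in> S" and g: "g \<in> SL2"
    using assms(1) by (auto simp: cusp_set_def)
  have "adj2 \<gamma> *v w \<in> parabolic_vectors" using assms(2) w by (intro parabolic_vectors_act adj2_mem)
  moreover have "(g ** \<gamma>) *v (adj2 \<gamma> *v w) = g *v w"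
    using assms(2) by (simp add: matrix_vector_mul_assoc[symmetric] adj2_vector_cancel det_mem)
  ultimately have "\<exists>w\<in>parabolic_vectors. (g ** \<gamma>) *v w \<in> S" using w(2) by metis
  then show ?thesis using g mem_SL2[OF assms(2)] by (auto simp: cusp_set_def)
qed

text \<open>The sector is chosen so that the translates by
  \<open>mat2 (1/r) 0 (4 r j) r\<close> are cones with slopes within \<open>2 r\<^sup>2\<close> of \<open>4 r\<^sup>2 j\<close>. A point in two of
  the translated cusp neighbourhoods would give two vectors with a nonzero wedge below \<open>1/16\<close>.\<close>

definition sector :: "real \<Rightarrow> (real^2) set" where
  "sector r = {v. r / 2 < \<bar>v$1\<bar> \<and> \<bar>v$1\<bar> < r \<and> \<bar>v$2\<bar> < 2 * \<bar>v$1\<bar>}"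

lemma open_sector: "open (sector r)"
  unfolding sector_def by (intro open_Collect_conj open_Collect_less continuous_intros)

lemma sector_translates_disjoint:
  fixes r :: real and i j n :: nat
  assumes r: "r > 0" and n: "4 * r\<^sup>2 * n \<le> 1 / 16" and ij: "i < n" "j < n" "i \<noteq> j"
  shows "pr ` cusp_set ((*v) (mat2 (1/r) 0 (4*r*i) r) ` sector r)
       \<inter> pr ` cusp_set ((*v) (mat2 (1/r) 0 (4*r*j) r) ` sector r) = {}"
proof (rule ccontr)
  let ?f = "\<lambda>j::nat. mat2 (1/r) 0 (4*r*j) r"
  have slope: "\<exists>\<alpha>. 0 < \<bar>a$1\<bar> \<and> \<bar>a$1\<bar> < 1 \<and> a$2 = a$1 * \<alpha> \<and> \<bar>\<alpha> - 4 * r\<^sup>2 * j\<bar> < 2 * r\<^sup>2"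
    if "a \<in> (*v) (?f j) ` sector r" for a j
  proof -
    obtain v where v: "v \<in> sector r" "a = ?f j *v v" using \<open>a \<in> (*v) (?f j) ` sector r\<close> by blast
    have v1: "\<bar>v$1\<bar> > 0" "\<bar>v$1\<bar> < r" "\<bar>v$2\<bar> < 2 * \<bar>v$1\<bar>" using v(1) r by (auto simp: sector_def)
    have a: "a$1 = v$1 / r" "a$2 = 4 * r * j * v$1 + r * v$2"
      by (simp_all add: v(2) matrix_vector_nth2)
    define \<alpha> where "\<alpha> = 4 * r\<^sup>2 * j + r\<^sup>2 * (v$2 / v$1)"
    have "a$2 = a$1 * \<alpha>" using v1 r by (simp add: a \<alpha>_def power2_eq_square field_simps)
    moreover have "\<bar>v$2 / v$1\<bar> < 2" using v1 by (simp add: abs_divide field_simps)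
    then have "r\<^sup>2 * \<bar>v$2 / v$1\<bar> < r\<^sup>2 * 2" using r by (intro mult_strict_left_mono) auto
    then have "\<bar>\<alpha> - 4 * r\<^sup>2 * j\<bar> < 2 * r\<^sup>2" by (simp add: \<alpha>_def abs_mult)
    moreover have "0 < \<bar>a$1\<bar>" "\<bar>a$1\<bar> < 1" using v1 r by (auto simp: a abs_divide)
    ultimately show ?thesis by blast
  qed
  assume "\<not> ?thesis"
  then obtain g h where g: "g \<in> cusp_set ((*v) (?f i) ` sector r)"
    and h: "h \<in> cusp_set ((*v) (?f j) ` sector r)" and eq: "pr h = pr g" by auto
  have gS: "g \<in> SL2" "h \<in> SL2" using g h by (auto simp: cusp_set_def)
  obtain \<gamma> where "\<gamma> \<in> \<Gamma>" "g = h ** \<gamma>" using pr_eqE[OF gS(2,1) eq] .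
  then have "g \<in> cusp_set ((*v) (?f j) ` sector r)" using cusp_set_mult_mem[OF h] by simp
  then obtain w' where w': "w' \<in> parabolic_vectors" "g *v w' \<in> (*v) (?f j) ` sector r"
    by (auto simp: cusp_set_def)
  obtain w where w: "w \<in> parabolic_vectors" "g *v w \<in> (*v) (?f i) ` sector r"
    using g by (auto simp: cusp_set_def)
  define a where "a = g *v w"
  define b where "b = g *v w'"
  obtain \<alpha> where \<alpha>: "0 < \<bar>a$1\<bar>" "\<bar>a$1\<bar> < 1" "a$2 = a$1 * \<alpha>" "\<bar>\<alpha> - 4 * r\<^sup>2 * i\<bar> < 2 * r\<^sup>2"
    using slope[OF w(2)] by (auto simp: a_def)
  obtain \<beta> where \<beta>: "0 < \<bar>b$1\<bar>" "\<bar>b$1\<bar> < 1" "b$2 = b$1 * \<beta>" "\<bar>\<beta> - 4 * r\<^sup>2 * j\<bar> < 2 * r\<^sup>2"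
    using slope[OF w'(2)] by (auto simp: b_def)
  have "wedge w w' = wedge a b" using gS by (simp add: a_def b_def wedge_matrix SL2_iff)
  also have "\<dots> = a$1 * b$1 * (\<beta> - \<alpha>)" by (simp add: wedge_def \<alpha>(3) \<beta>(3) algebra_simps)
  finally have wedge: "\<bar>wedge w w'\<bar> = \<bar>a$1\<bar> * \<bar>b$1\<bar> * \<bar>\<beta> - \<alpha>\<bar>" by (simp add: abs_mult)
  \<comment> \<open>The slope windows have half-width 2 r^2 and centres at least 4 r^2 apart, so the
    slopes differ; the outermost differ by less than 4 r^2 (n - 1) + 4 r^2 = 4 r^2 n.\<close>
  have gap: "1 \<le> \<bar>real j - real i\<bar>" "\<bar>real j - real i\<bar> \<le> real n - 1" using ij by linarith+
  have dist: "\<bar>4 * r\<^sup>2 * j - 4 * r\<^sup>2 * i\<bar> = 4 * r\<^sup>2 * \<bar>real j - real i\<bar>"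
    by (simp add: right_diff_distrib[symmetric] abs_mult)
  have "4 * r\<^sup>2 * 1 \<le> 4 * r\<^sup>2 * \<bar>real j - real i\<bar>" using gap by (intro mult_left_mono) auto
  then have "\<beta> - \<alpha> \<noteq> 0" using \<alpha>(4) \<beta>(4) dist by linarith
  then have "wedge w w' \<noteq> 0" using wedge \<alpha> \<beta> by auto
  then have lower: "1 / 16 \<le> \<bar>wedge w w'\<bar>" using parabolic_vectors_wedge[OF w(1) w'(1)] by blast
  have "4 * r\<^sup>2 * \<bar>real j - real i\<bar> \<le> 4 * r\<^sup>2 * (real n - 1)" using gap by (intro mult_left_mono) auto
  also have "\<dots> = 4 * r\<^sup>2 * n - 4 * r\<^sup>2" by (simp add: right_diff_distrib)
  finally have up: "\<bar>\<beta> - \<alpha>\<bar> < 1 / 16" using \<alpha>(4) \<beta>(4) dist n by linarith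
  have "\<bar>a$1\<bar> * \<bar>b$1\<bar> \<le> 1 * 1" using \<alpha> \<beta> by (intro mult_mono) auto
  then have "\<bar>a$1\<bar> * \<bar>b$1\<bar> * \<bar>\<beta> - \<alpha>\<bar> \<le> 1 * \<bar>\<beta> - \<alpha>\<bar>" by (intro mult_right_mono) auto
  then show False using lower up wedge by linarith
qed

lemma measure_total: "measure \<mu> (space \<mu>) = 1"
  using total by (simp add: measure_def space_\<mu>)

lemma measure_translate:
  assumes "openin (top_of_set SL2) W" "h \<in> SL2"
  shows "measure \<mu> (pr ` (**) h ` W) = measure \<mu> (pr ` W)"
  using emeasure_left_invariant[OF assms] by (simp add: measure_def)

text \<open>About 1 / (64 r^2) translates are disjoint and of equal measure in a space of mass 1.
  For large r the bound exceeds 1 anyway.\<close>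

lemma measure_sector_le:
  assumes r: "r > 0"
  shows "measure \<mu> (pr ` cusp_set (sector r)) \<le> 128 * r\<^sup>2"
proof (cases "64 * r\<^sup>2 \<le> 1")
  case False
  have "measure \<mu> (pr ` cusp_set (sector r)) \<le> 1"
    using prob_quotient.bounded_measure measure_total by metis
  then show ?thesis using False by simp
next
  case True
  let ?q = "measure \<mu> (pr ` cusp_set (sector r))"
  let ?f = "\<lambda>j::nat. mat2 (1/r) 0 (4*r*j) r"
  define n where "n = nat \<lfloor>1 / (64 * r\<^sup>2)\<rfloor>"
  define q where "q = 1 / (64 * r\<^sup>2)"
  have q: "1 \<le> q" using True r by (simp add: q_def)
  have "1 \<le> \<lfloor>q\<rfloor>" using q by simp
  then have "real n \<le> q" "real n > q - 1" "real n \<ge> 1"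
    using q unfolding n_def q_def[symmetric] by linarith+
  moreover from this have "real n \<ge> q / 2" by linarith
  ultimately have n: "real n \<le> 1 / (64 * r\<^sup>2)" "real n \<ge> 1 / (128 * r\<^sup>2)"
    by (simp_all add: q_def)
  have n': "4 * r\<^sup>2 * n \<le> 1 / 16" using n(1) r by (simp add: field_simps)
  have f: "?f j \<in> SL2" for j using r by (simp add: SL2_iff det_2)
  have op: "openin (top_of_set SL2) (cusp_set (sector r))" by (intro openin_cusp_set open_sector)
  let ?A = "\<lambda>j. pr ` cusp_set ((*v) (?f j) ` sector r)"
  have "real n * ?q = (\<Sum>j<n. measure \<mu> (?A j))"
    using f op by (simp add: cusp_set_translate measure_translate)
  also have "\<dots> = measure \<mu> (\<Union>j<n. ?A j)"
  proof (intro prob_quotient.finite_measure_finite_Union[symmetric])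
    show "?A ` {..<n} \<subseteq> sets \<mu>"
      using f op by (auto simp: cusp_set_translate intro!: pr_open_sets openin_left_translate)
    show "disjoint_family_on ?A {..<n}"
      unfolding disjoint_family_on_def using sector_translates_disjoint[OF r n'] by blast
  qed simp
  also have "\<dots> \<le> 1" using prob_quotient.bounded_measure measure_total by metis
  finally have "real n * ?q \<le> 1" .
  moreover have "1 / (128 * r\<^sup>2) * ?q \<le> real n * ?q" using n(2) by (intro mult_right_mono) auto
  ultimately have "1 / (128 * r\<^sup>2) * ?q \<le> 1" by linarith
  then show ?thesis using r by (simp add: field_simps)
qed

text \<open>Multiples \<open>\<surd>k v\<close> of a short vector come from powers of the unipotent element, so one of
  them has first coordinate between \<open>r/2\<close> and \<open>r\<close>.\<close>

lemma cusp_set_sectorI: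
  assumes g: "g \<in> SL2" and w: "w \<in> parabolic_vectors" and r: "r > 0"
    and short: "(norm (g *v w))\<^sup>2 \<le> r\<^sup>2 / 2" and slope: "\<bar>(g *v w)$2\<bar> < 2 * \<bar>(g *v w)$1\<bar>"
  shows "g \<in> cusp_set (sector r)"
proof -
  define v where "v = g *v w"
  have v1: "v$1 \<noteq> 0" using slope by (auto simp: v_def)
  define x where "x = (v$1)\<^sup>2 / r\<^sup>2"
  have "(v$1)\<^sup>2 \<le> r\<^sup>2 / 2" using short zero_le_power2[of "v$2"]
    unfolding v_def[symmetric] norm_sq_vec2 by linarith
  then have x: "0 < x" "x \<le> 1 / 2" using v1 r by (auto simp: x_def field_simps)
  \<comment> \<open>The least k with k x > 1/4, that is, with sqrt k |v1| > r/2; then k x <= 1/4 + x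
    < 1.\<close>
  define k where "k = nat \<lfloor>1 / (4 * x)\<rfloor> + 1"
  have "0 \<le> \<lfloor>1 / (4 * x)\<rfloor>" using x by simp
  then have "1 / (4 * x) < real k" "real k \<le> 1 / (4 * x) + 1" unfolding k_def by linarith+
  then have "1 / 4 < real k * x" "real k * x \<le> 1 / 4 + x" using x by (simp_all add: field_simps)
  then have kx: "1 / 4 < real k * x" "real k * x < 1" using x by linarith+
  define v' where "v' = sqrt (real k) *\<^sub>R v"
  have sq: "(v'$1)\<^sup>2 = real k * x * r\<^sup>2" using r by (simp add: v'_def x_def power_mult_distrib)
  have "(r / 2)\<^sup>2 < \<bar>v'$1\<bar>\<^sup>2" using kx(1) r by (simp add: sq power_divide)
  then have a: "r / 2 < \<bar>v'$1\<bar>" by (rule power_less_imp_less_base) simp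
  have "\<bar>v'$1\<bar>\<^sup>2 < r\<^sup>2" using kx(2) r by (simp add: sq)
  then have b: "\<bar>v'$1\<bar> < r" by (rule power_less_imp_less_base) (use r in simp)
  have k0: "k > 0" by (simp add: k_def)
  then have "\<bar>v'$2\<bar> < 2 * \<bar>v'$1\<bar>" using slope by (simp add: v'_def v_def[symmetric] abs_mult)
  then have "v' \<in> sector r" using a b by (simp add: sector_def)
  moreover have "v' = g *v (sqrt (real k) *\<^sub>R w)" by (simp add: v'_def v_def matrix_vector_mult_scaleR)
  ultimately show ?thesis using g parabolic_vectors_sqrt[OF w k0] by (auto simp: cusp_set_def)
qed

definition near :: "real^2^2 \<Rightarrow> real \<Rightarrow> (real^2^2) set" where
  "near g\<^sub>0 L = {g \<in> SL2. \<exists>\<gamma>\<in>\<Gamma>. norm (g ** \<gamma> ** adj2 g\<^sub>0) < L}"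

lemma openin_near: "openin (top_of_set SL2) (near g\<^sub>0 L)"
proof -
  have "openin (top_of_set SL2) (SL2 \<inter> (\<lambda>g. norm (g ** \<gamma> ** adj2 g\<^sub>0)) -` {..<L})" for \<gamma>
    by (intro continuous_openin_preimage_gen continuous_intros open_lessThan)
  moreover have "near g\<^sub>0 L = (\<Union>\<gamma>\<in>\<Gamma>. SL2 \<inter> (\<lambda>g. norm (g ** \<gamma> ** adj2 g\<^sub>0)) -` {..<L})"
    by (auto simp: near_def)
  ultimately show ?thesis by (simp only:) (rule openin_Union, blast)
qed

text \<open>A point that is not near has a short parabolic vector. The slope condition of the sector
  holds for it either directly or after the quarter turn \<open>?J\<close>, so two sets of measure
  at most 128 r^2 cover the complement. The choice r^2 = 2 K / L^2 matches
  \<open>cusp_set_sectorI\<close> and produces 512 K.\<close>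

theorem measure_near_ge:
  assumes g0: "g\<^sub>0 \<in> SL2"
  obtains K L\<^sub>1 where "K > 0" "L\<^sub>1 \<ge> 1" "\<And>L. L \<ge> L\<^sub>1 \<Longrightarrow> measure \<mu> (pr ` near g\<^sub>0 L) \<ge> 1 - K / L\<^sup>2"
proof -
  obtain K L\<^sub>1 where K: "K > 0" "L\<^sub>1 \<ge> 1"
    "\<And>g L. g \<in> SL2 \<Longrightarrow> L \<ge> L\<^sub>1 \<Longrightarrow> (\<And>\<gamma>. \<gamma> \<in> \<Gamma> \<Longrightarrow> L \<le> norm (g ** \<gamma> ** adj2 g\<^sub>0)) \<Longrightarrow>
      \<exists>w\<in>parabolic_vectors. (norm (g *v w))\<^sup>2 \<le> K / L\<^sup>2"
    using far_imp_short_parabolic_vector[OF g0] by metis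
  have "measure \<mu> (pr ` near g\<^sub>0 L) \<ge> 1 - 512 * K / L\<^sup>2" if L: "L \<ge> L\<^sub>1" for L
  proof -
    have L0: "L > 0" using L K by linarith
    define r where "r = sqrt (2 * K) / L"
    have r: "r > 0" "r\<^sup>2 = 2 * K / L\<^sup>2" using K L0 by (auto simp: r_def power_divide)
    let ?J = "mat2 0 1 (-1) 0"
    have J: "?J \<in> SL2" by (simp add: SL2_iff det_2)
    let ?N = "pr ` near g\<^sub>0 L" and ?A = "pr ` cusp_set (sector r)"
      and ?B = "pr ` (**) (adj2 ?J) ` cusp_set (sector r)"
    have op: "openin (top_of_set SL2) (cusp_set (sector r))" by (intro openin_cusp_set open_sector)
    have sets: "?N \<in> sets \<mu>" "?A \<in> sets \<mu>" "?B \<in> sets \<mu>"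
      using J op by (auto intro!: pr_open_sets openin_near openin_left_translate)
    have "space \<mu> \<subseteq> ?N \<union> (?A \<union> ?B)"
    proof
      fix y assume "y \<in> space \<mu>"
      then obtain g where g: "g \<in> SL2" "y = pr g" by (auto simp: space_\<mu> quotient_space_eq)
      show "y \<in> ?N \<union> (?A \<union> ?B)"
      proof (cases "g \<in> near g\<^sub>0 L")
        case False
        then obtain w where w: "w \<in> parabolic_vectors" "(norm (g *v w))\<^sup>2 \<le> K / L\<^sup>2"
          using K(3)[OF g(1) L] g by (force simp: near_def)
        then have short: "(norm (g *v w))\<^sup>2 \<le> r\<^sup>2 / 2" by (simp add: r)
        show ?thesis
        proof (cases "\<bar>(g *v w)$2\<bar> < 2 * \<bar>(g *v w)$1\<bar>")
          case True
          then show ?thesis using cusp_set_sectorI[OF g(1) w(1) r(1) short] g by blast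
        next
          case slope: False
          have Jv: "(?J ** g) *v w = ?J *v (g *v w)" by (simp add: matrix_vector_mul_assoc)
          have Jv12: "((?J ** g) *v w)$1 = (g *v w)$2" "((?J ** g) *v w)$2 = - (g *v w)$1"
            unfolding Jv by (simp_all add: matrix_vector_nth2[of ?J])
          have "g *v w \<noteq> 0" using w(1) adj2_vector_cancel(2)[of g w] g
            by (auto simp: SL2_iff parabolic_vectors_def)
          then have "(g *v w)$2 \<noteq> 0" using slope by (auto simp: vec2_eq_iff)
          then have "?J ** g \<in> cusp_set (sector r)"
            using slope short J g(1)
            by (intro cusp_set_sectorI[OF _ w(1) r(1)]) (auto simp: Jv12 norm_sq_vec2)
          moreover have "g = adj2 ?J ** (?J ** g)" using J by (simp add: SL2_cancel)
          ultimately have "g \<in> (**) (adj2 ?J) ` cusp_set (sector r)" by (metis image_eqI)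
          then show ?thesis using g by blast
        qed
      qed (use g in blast)
    qed
    then have "1 \<le> measure \<mu> (?N \<union> (?A \<union> ?B))"
      using sets measure_total prob_quotient.finite_measure_mono[of "space \<mu>" "?N \<union> (?A \<union> ?B)"] by simp
    also have "\<dots> \<le> measure \<mu> ?N + (measure \<mu> ?A + measure \<mu> ?B)"
      using sets measure_Un_le[of ?N \<mu> "?A \<union> ?B"] measure_Un_le[of ?A \<mu> ?B] by simp
    also have "measure \<mu> ?B = measure \<mu> ?A" using J by (intro measure_translate op SL2_adj2)
    finally have "1 \<le> measure \<mu> ?N + 2 * measure \<mu> ?A" by simp
    then show ?thesis using measure_sector_le[OF r(1)] by (simp add: r(2))
  qed
  then show ?thesis using K by (intro that[of "512 * K" L\<^sub>1]) auto
qed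

end

section \<open>Distances, flows and cuspidal points\<close>

lemma moebius_i:
  assumes "det A = 1"
  shows "Re (moebius A \<i>) = (A$1$1 * A$2$1 + A$1$2 * A$2$2) / ((A$2$1)\<^sup>2 + (A$2$2)\<^sup>2)"
    and "Im (moebius A \<i>) = 1 / ((A$2$1)\<^sup>2 + (A$2$2)\<^sup>2)"
    and "(A$2$1)\<^sup>2 + (A$2$2)\<^sup>2 > 0"
proof -
  have d: "A$1$1 * A$2$2 - A$1$2 * A$2$1 = 1" using assms by (simp add: det_2)
  show "Re (moebius A \<i>) = (A$1$1 * A$2$1 + A$1$2 * A$2$2) / ((A$2$1)\<^sup>2 + (A$2$2)\<^sup>2)"
    by (simp add: moebius_def Re_divide add.commute)
  show "Im (moebius A \<i>) = 1 / ((A$2$1)\<^sup>2 + (A$2$2)\<^sup>2)"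
    using d by (simp add: moebius_def Im_divide add.commute)
  have "A$2$1 \<noteq> 0 \<or> A$2$2 \<noteq> 0" using d by auto
  then show "(A$2$1)\<^sup>2 + (A$2$2)\<^sup>2 > 0" by (simp add: sum_power2_gt_zero_iff)
qed

text \<open>The two points have real parts p/N and q/M and imaginary parts 1/N and 1/M. The
  equations for p and q are Lagrange's identity for the rows of a matrix of determinant 1 and
  eliminate the squares.\<close>

lemma hyp_dist_formula_aux:
  fixes N M p q N' M' :: real
  assumes "N > 0" "M > 0" "p\<^sup>2 + 1 = N' * N" "q\<^sup>2 + 1 = M' * M"
  shows "1 + ((p/N - q/M)\<^sup>2 + (1/N - 1/M)\<^sup>2) / (2 * (1/N) * (1/M)) = (N' * M + M' * N - 2 * p * q) / 2"
proof -
  have "((p/N - q/M)\<^sup>2 + (1/N - 1/M)\<^sup>2) * (N * M)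
      = (p\<^sup>2 + 1) / N * M + (q\<^sup>2 + 1) / M * N - 2 * p * q - 2"
    using assms(1,2) by (simp add: power2_eq_square field_simps)
  also have "\<dots> = N' * M + M' * N - 2 * p * q - 2" using assms by simp
  finally show ?thesis using assms(1,2) by (simp add: field_simps)
qed

lemma hyp_dist_half_plane_point:
  assumes a: "det a = 1" and b: "det b = 1"
  shows "hyp_dist (half_plane_point a) (half_plane_point b) = arcosh ((norm (a ** adj2 b))\<^sup>2 / 2)"
proof -
  define P where "P = adj2 a"
  define Q where "Q = adj2 b"
  have det: "det P = 1" "det Q = 1" using a b by (simp_all add: P_def Q_def)
  have dP: "P$1$1 * P$2$2 = 1 + P$1$2 * P$2$1" and dQ: "Q$1$1 * Q$2$2 = 1 + Q$1$2 * Q$2$1"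
    using det by (simp_all add: det_2)
  let ?N = "(P$2$1)\<^sup>2 + (P$2$2)\<^sup>2" and ?M = "(Q$2$1)\<^sup>2 + (Q$2$2)\<^sup>2"
  let ?N' = "(P$1$1)\<^sup>2 + (P$1$2)\<^sup>2" and ?M' = "(Q$1$1)\<^sup>2 + (Q$1$2)\<^sup>2"
  let ?p = "P$1$1 * P$2$1 + P$1$2 * P$2$2" and ?q = "Q$1$1 * Q$2$1 + Q$1$2 * Q$2$2"
  have lagrange: "(a * c + b * d)\<^sup>2 + 1 = (a\<^sup>2 + b\<^sup>2) * (c\<^sup>2 + d\<^sup>2)" if "a * d = 1 + b * c" for a b c d :: real
  proof -
    have "(a * c + b * d)\<^sup>2 + (a * d - b * c)\<^sup>2 = (a\<^sup>2 + b\<^sup>2) * (c\<^sup>2 + d\<^sup>2)"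
      by (simp add: power2_eq_square algebra_simps)
    then show ?thesis using that by simp
  qed
  have p: "?p\<^sup>2 + 1 = ?N' * ?N" and q: "?q\<^sup>2 + 1 = ?M' * ?M" using lagrange dP dQ by blast+
  have aP: "a = adj2 P" by (simp add: P_def)
  have "(norm (a ** adj2 b))\<^sup>2 = ?N' * ?M + ?M' * ?N - 2 * ?p * ?q"
    unfolding aP Q_def[symmetric] norm_sq_mat2 matrix_mult_nth2
    by (simp add: power2_eq_square algebra_simps)
  then show ?thesis
    unfolding hyp_dist_def half_plane_point_def matrix_inv_eq_adj2[OF a] matrix_inv_eq_adj2[OF b]
      P_def[symmetric] Q_def[symmetric] cmod_power2 minus_complex.sel moebius_i[OF det(1)] moebius_i[OF det(2)]
    by (subst hyp_dist_formula_aux[OF moebius_i(3)[OF det(1)] moebius_i(3)[OF det(2)] p q]) simp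
qed

lemma arcosh_less_iff:
  fixes x R :: real assumes "x \<ge> 1" "R \<ge> 0"
  shows "arcosh x < R \<longleftrightarrow> x < cosh R"
proof -
  have "arcosh x < arcosh (cosh R) \<longleftrightarrow> x < cosh R"
    using assms cosh_real_ge_1 by (metis arcosh_less_iff_real)
  then show ?thesis using assms by (simp add: arcosh_cosh_real)
qed

section \<open>The two flows and the distance in the quotient\<close>

lemma horocycle_flow_mat2: "horocycle_flow s = mat2 1 0 s 1"
  by (simp add: horocycle_flow_def mat2_def)

lemma geodesic_flow_mat2: "geodesic_flow t = mat2 (exp (t/2)) 0 0 (exp (- t/2))"
  by (simp add: geodesic_flow_def mat2_def)

lemma horocycle_flow_SL2: "horocycle_flow s \<in> SL2"
  by (simp add: horocycle_flow_mat2 SL2_iff det_2)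

lemma geodesic_flow_SL2: "geodesic_flow t \<in> SL2"
  by (simp add: geodesic_flow_mat2 SL2_iff det_2 exp_add[symmetric])

lemma horocycle_flow_add: "horocycle_flow (s + t) = horocycle_flow s ** horocycle_flow t"
  by (simp add: horocycle_flow_mat2 entry_simps)

lemma continuous_on_horocycle_flow [continuous_intros]:
  assumes "continuous_on S f" shows "continuous_on S (\<lambda>x. horocycle_flow (f x))"
proof -
  have "horocycle_flow s = mat 1 + s *\<^sub>R mat2 0 0 1 0" for s
    by (simp add: horocycle_flow_mat2 mat2_eq_iff)
  then show ?thesis using assms by (auto intro!: continuous_intros)
qed

context discrete_subgroup_SL2R
begin

text \<open>Representatives g \<gamma> and h \<eta> enter the norm only through \<gamma> \<eta>^-1,
  so the infimum over pairs runs over \<Gamma> once; monotonicity of \<open>arcosh\<close> does the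
  rest.\<close>

lemma orbifold_dist_less_iff:
  assumes g: "g \<in> SL2" and h: "h \<in> SL2" and R: "R \<ge> 0"
  shows "orbifold_dist (pr g) (pr h) < R \<longleftrightarrow> (\<exists>\<gamma>\<in>\<Gamma>. (norm (g ** \<gamma> ** adj2 h))\<^sup>2 < 2 * cosh R)"
proof -
  let ?f = "\<lambda>(a, b). hyp_dist (half_plane_point a) (half_plane_point b)"
  have f: "?f (a, b) = arcosh ((norm (a ** adj2 b))\<^sup>2 / 2)" "1 \<le> (norm (a ** adj2 b))\<^sup>2 / 2"
    if "(a, b) \<in> pr g \<times> pr h" for a b
  proof -
    have "det a = 1" "det b = 1" using that g h det_mem by (auto simp: act_eq_image SL2_iff det_mul)
    then show "?f (a, b) = arcosh ((norm (a ** adj2 b))\<^sup>2 / 2)" "1 \<le> (norm (a ** adj2 b))\<^sup>2 / 2"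
      using norm_sq_SL2_ge_2[of "a ** adj2 b"] by (auto simp: hyp_dist_half_plane_point det_mul)
  qed
  have "bdd_below (?f ` (pr g \<times> pr h))"
  proof (intro bdd_belowI2[of _ 0])
    fix x assume "x \<in> pr g \<times> pr h"
    then show "0 \<le> ?f x" using f by (cases x) (auto simp: arcosh_nonneg_real)
  qed
  moreover have "pr g \<times> pr h \<noteq> {}" using one_mem by (auto simp: act_eq_image)
  ultimately have "orbifold_dist (pr g) (pr h) < R \<longleftrightarrow> (\<exists>x\<in>pr g \<times> pr h. ?f x < R)"
    unfolding orbifold_dist_def by (rule cINF_less_iff[rotated])
  also have "\<dots> \<longleftrightarrow> (\<exists>x\<in>pr g \<times> pr h. (norm (fst x ** adj2 (snd x)))\<^sup>2 < 2 * cosh R)"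
  proof (rule bex_cong[OF refl])
    fix x assume x: "x \<in> pr g \<times> pr h"
    obtain a b where ab: "x = (a, b)" by (cases x)
    show "?f x < R \<longleftrightarrow> (norm (fst x ** adj2 (snd x)))\<^sup>2 < 2 * cosh R"
      using f[of a b] x ab R arcosh_less_iff[of "(norm (a ** adj2 b))\<^sup>2 / 2" R] by auto
  qed
  also have "\<dots> \<longleftrightarrow> (\<exists>\<gamma>\<in>\<Gamma>. (norm (g ** \<gamma> ** adj2 h))\<^sup>2 < 2 * cosh R)"
  proof
    assume "\<exists>x\<in>pr g \<times> pr h. (norm (fst x ** adj2 (snd x)))\<^sup>2 < 2 * cosh R"
    then obtain \<gamma> \<eta> where "\<gamma> \<in> \<Gamma>" "\<eta> \<in> \<Gamma>" "(norm (g ** \<gamma> ** adj2 (h ** \<eta>)))\<^sup>2 < 2 * cosh R"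
      by (auto simp: act_eq_image)
    then show "\<exists>\<gamma>\<in>\<Gamma>. (norm (g ** \<gamma> ** adj2 h))\<^sup>2 < 2 * cosh R"
      by (intro bexI[of _ "\<gamma> ** adj2 \<eta>"]) (auto simp: adj2_mult matrix_mul_assoc intro: mult_mem adj2_mem)
  next
    assume "\<exists>\<gamma>\<in>\<Gamma>. (norm (g ** \<gamma> ** adj2 h))\<^sup>2 < 2 * cosh R"
    then obtain \<gamma> where "\<gamma> \<in> \<Gamma>" "(norm (g ** \<gamma> ** adj2 h))\<^sup>2 < 2 * cosh R" by blast
    moreover have "h \<in> pr h" using one_mem by (auto simp: act_eq_image intro: image_eqI[of _ _ "mat 1"])
    ultimately show "\<exists>x\<in>pr g \<times> pr h. (norm (fst x ** adj2 (snd x)))\<^sup>2 < 2 * cosh R"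
      by (intro bexI[of _ "(g ** \<gamma>, h)"]) (auto simp: act_eq_image)
  qed
  finally show ?thesis .
qed

text \<open>A parabolic vector contracted by the geodesic flow makes the horocycle orbit periodic.\<close>

lemma cuspidal_if_contracted:
  assumes g: "g \<in> SL2" and w: "w \<in> parabolic_vectors" and w1: "(g *v w)$1 = 0"
  shows "cuspidal \<Gamma> (pr g)"
proof -
  \<comment> \<open>As g w lies on the second axis, g (1 + \<open>nil2 w\<close>) g^-1 is the lower
    unipotent with entry -b, making b a period of the orbit.\<close>
  define b where "b = ((g *v w)$2)\<^sup>2"
  have dg: "det g = 1" using g by (simp add: SL2_iff)
  have "g *v w \<noteq> 0" using w adj2_vector_cancel(2)[OF dg, of w] by (auto simp: parabolic_vectors_def)
  then have b: "b > 0" using w1 by (auto simp: b_def vec2_eq_iff)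
  have period: "pr (horocycle_flow (- b) ** g) = pr g"
  proof -
    have "horocycle_flow (- b) = conj2 g (mat 1 + nil2 w)"
      using w1 by (simp add: conj2_add conj2_mat1 conj2_nil2 dg horocycle_flow_mat2 mat2_eq_iff b_def)
    then have "horocycle_flow (- b) ** g = g ** (mat 1 + nil2 w)" using g by (simp add: conj2_def SL2_cancel)
    then show ?thesis using g w by (simp add: pr_mult_mem parabolic_vectors_def)
  qed
  let ?\<phi> = "\<lambda>s. pr (horocycle_flow s ** g)"
  have hg: "horocycle_flow s ** g \<in> SL2" for s using g horocycle_flow_SL2 by blast
  have per1: "?\<phi> (s - b) = ?\<phi> s" for s
  proof -
    have "?\<phi> (s - b) = horocycle_flow s \<bullet>\<^sub>X pr (horocycle_flow (- b) ** g)"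
      using horocycle_flow_add[of s "- b"] by (simp add: act_act matrix_mul_assoc)
    then show ?thesis by (simp only: period act_act)
  qed
  have pern: "?\<phi> (s - real n * b) = ?\<phi> s" for s n
  proof (induction n)
    case (Suc n)
    have "?\<phi> (s - real (Suc n) * b) = ?\<phi> (s - real n * b - b)" by (simp add: algebra_simps)
    then show ?case using Suc per1 by simp
  qed simp
  have perz: "?\<phi> (s - of_int k * b) = ?\<phi> s" for s k
  proof (cases "k \<ge> 0")
    case True
    then show ?thesis using pern[of s "nat k"] by simp
  next
    case False
    then show ?thesis using pern[of "s - of_int k * b" "nat (- k)"] by simp
  qed
  let ?O = "?\<phi> ` {0..b}"
  have orbit: "range (\<lambda>s. horocycle_flow s \<bullet>\<^sub>X pr g) = ?O"
  proof (intro equalityI subsetI)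
    fix y assume "y \<in> range (\<lambda>s. horocycle_flow s \<bullet>\<^sub>X pr g)"
    then obtain s where y: "y = ?\<phi> s" by (auto simp: act_act)
    have "of_int \<lfloor>s / b\<rfloor> * b \<le> s"
      by (simp add: pos_le_divide_eq[OF b, symmetric])
    moreover have "s \<le> (of_int \<lfloor>s / b\<rfloor> + 1) * b"
      unfolding pos_divide_le_eq[OF b, symmetric] by linarith
    ultimately have "s - of_int \<lfloor>s / b\<rfloor> * b \<in> {0..b}" by (simp add: algebra_simps)
    moreover have "y = ?\<phi> (s - of_int \<lfloor>s / b\<rfloor> * b)" unfolding y by (rule perz[symmetric])
    ultimately show "y \<in> ?O" by (rule rev_image_eqI)
  qed (auto simp: act_act)
  \<comment> \<open>A limit of points over the orbit has orbit times in the compact period interval.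
    Along a convergent subsequence the connecting elements of \<Gamma> converge, and \<Gamma> is
    closed.\<close>
  have clos: "closed {x \<in> SL2. pr x \<in> ?O}"
  proof -
    have "x \<in> SL2 \<and> pr x \<in> ?O" if f: "\<And>n. f n \<in> SL2 \<and> pr (f n) \<in> ?O" and lim: "f \<longlonglongrightarrow> x" for f x
    proof -
      have x: "x \<in> SL2" using closed_sequentially[OF closed_SL2 _ lim] f by blast
      have "\<forall>n. \<exists>s. s \<in> {0..b} \<and> pr (f n) = ?\<phi> s" using f by blast
      then obtain s where s: "\<And>n. s n \<in> {0..b}" "\<And>n. pr (f n) = ?\<phi> (s n)" by metis
      obtain l r where l: "l \<in> {0..b}" "strict_mono (r :: nat \<Rightarrow> nat)" "(s \<circ> r) \<longlonglongrightarrow> l"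
        using compact_imp_seq_compact[OF compact_Icc[of 0 b]] s(1) unfolding seq_compact_def by metis
      define c :: "real \<times> (real^2^2) \<Rightarrow> real^2^2" where "c p = adj2 (horocycle_flow (fst p) ** g) ** snd p"
        for p
      have c: "continuous_on UNIV c" unfolding c_def by (intro continuous_intros)
      have "(\<lambda>n. ((s \<circ> r) n, (f \<circ> r) n)) \<longlonglongrightarrow> (l, x)"
        using l(3) LIMSEQ_subseq_LIMSEQ[OF lim l(2)] by (rule tendsto_Pair)
      then have clim: "(\<lambda>n. c ((s \<circ> r) n, (f \<circ> r) n)) \<longlonglongrightarrow> c (l, x)"
        using c by (intro continuous_on_tendsto_compose[OF c]) auto
      have "c ((s \<circ> r) n, (f \<circ> r) n) \<in> \<Gamma>" for n
        using pr_eq_iff[OF hg, of "f (r n)" "s (r n)"] s(2)[of "r n"] f[of "r n"] by (simp add: c_def)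
      then have "c (l, x) \<in> \<Gamma>" by (rule closed_sequentially[OF closed_mem _ clim])
      then have "?\<phi> l = pr x" using pr_eq_iff[OF hg x] by (simp add: c_def)
      then have "pr x \<in> ?O" using l(1) by (intro rev_image_eqI[of l]) auto
      then show ?thesis using x by blast
    qed
    then show ?thesis unfolding closed_sequential_limits by blast
  qed
  have "?O \<subseteq> quotient_space \<Gamma>" using hg by (auto simp: quotient_space_eq)
  moreover have "openin (top_of_set SL2) (SL2 \<inter> - {x \<in> SL2. pr x \<in> ?O})"
    using clos by (intro openin_open_Int) auto
  moreover have "{x \<in> SL2. pr x \<in> quotient_space \<Gamma> - ?O} = SL2 \<inter> - {x \<in> SL2. pr x \<in> ?O}"
    by (auto simp: quotient_space_eq)
  ultimately show ?thesis
    unfolding cuspidal_def closedin_def topspace_quotient_topology openin_quotient_topology orbit by auto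
qed

text \<open>The squared norm of \<open>geodesic_flow t\<close> is at most 2 e^t, so
  submultiplicativity adds t up to a constant; the summand 1 makes the inequality strict, as
  \<open>orbifold_dist_less_iff\<close> demands.\<close>

lemma orbifold_dist_geodesic_le:
  assumes g: "g \<in> SL2" and h: "h \<in> SL2"
  obtains c where "\<And>t. t \<ge> 0 \<Longrightarrow> orbifold_dist (pr (geodesic_flow t ** g)) (pr h) \<le> t + c"
proof -
  define B where "B = (norm (g ** adj2 h))\<^sup>2"
  have B: "B \<ge> 2" unfolding B_def using g h by (intro norm_sq_SL2_ge_2) (auto simp: SL2_iff det_mul)
  have "orbifold_dist (pr (geodesic_flow t ** g)) (pr h) \<le> t + (ln (2 * B) + 1)" if t: "t \<ge> 0" for t
  proof -
    let ?R = "t + (ln (2 * B) + 1)"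
    have lnB: "ln (2 * B) \<ge> 0" using B by simp
    have "(norm (geodesic_flow t))\<^sup>2 = exp t + exp (- t)"
      unfolding geodesic_flow_mat2 norm_sq_mat2 by (simp add: power2_eq_square exp_add[symmetric])
    also have "\<dots> \<le> 2 * exp t" using t by simp
    finally have n: "(norm (geodesic_flow t))\<^sup>2 \<le> 2 * exp t" .
    have "(norm (geodesic_flow t ** g ** mat 1 ** adj2 h))\<^sup>2 \<le> (norm (geodesic_flow t) * norm (g ** adj2 h))\<^sup>2"
      using norm_matrix_mult_le[of "geodesic_flow t" "g ** adj2 h"]
      by (intro power_mono) (simp_all add: matrix_mul_assoc)
    also have "\<dots> \<le> 2 * exp t * B" unfolding power_mult_distrib B_def[symmetric]
      using n B by (intro mult_right_mono) auto
    also have "\<dots> = exp (t + ln (2 * B))" using B by (simp add: exp_add)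
    also have "\<dots> < exp ?R" by simp
    also have "\<dots> \<le> 2 * cosh ?R" by (simp add: cosh_def)
    finally have "\<exists>\<gamma>\<in>\<Gamma>. (norm (geodesic_flow t ** g ** \<gamma> ** adj2 h))\<^sup>2 < 2 * cosh ?R"
      using one_mem by blast
    then have "orbifold_dist (pr (geodesic_flow t ** g)) (pr h) < ?R"
      using t lnB orbifold_dist_less_iff[OF SL2_mult[OF geodesic_flow_SL2 g] h, of ?R t] by simp
    then show ?thesis by simp
  qed
  then show ?thesis by (rule that)
qed

end

section \<open>The discrepancy\<close>

lemma eventually_powr_dominates:
  fixes a b A B :: real
  assumes "A > 0" "a < b"
  shows "\<forall>\<^sub>F s in at_top. B * s powr a \<le> A * s powr b"
proof -
  define e where "e = (\<bar>B\<bar> / A + 1) powr (1 / (b - a))"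
  have "B * s powr a \<le> A * s powr b" if s: "s > max 1 e" for s
  proof -
    have c: "\<bar>B\<bar> / A + 1 > 0" using assms by (simp add: add_nonneg_pos)
    have "e powr (b - a) \<le> s powr (b - a)" using s assms by (intro powr_mono2) (auto simp: e_def)
    moreover have "e powr (b - a) = \<bar>B\<bar> / A + 1" using c assms by (simp add: e_def powr_powr)
    ultimately have "\<bar>B\<bar> \<le> A * s powr (b - a)" using assms by (simp add: field_simps)
    then have "B * s powr a \<le> (A * s powr (b - a)) * s powr a" by (intro mult_right_mono) auto
    also have "\<dots> = A * s powr b" by (simp add: powr_add[symmetric])
    finally show ?thesis .
  qed
  then show ?thesis using eventually_gt_at_top[of "max 1 e"] by (rule eventually_mono[rotated]) 
qed

lemma Limsup_frequently_gt:
  fixes f :: "real \<Rightarrow> real"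
  assumes "ereal c < Limsup at_top (\<lambda>t. ereal (f t))"
  obtains t where "t > T" "f t > c"
proof -
  have "\<not> (\<forall>\<^sub>F t in at_top. ereal (f t) \<le> ereal c)"
    using Limsup_bounded[of "\<lambda>t. ereal (f t)" "ereal c" at_top] assms by auto
  then have "\<exists>\<^sub>F t in at_top. f t > c" by (simp add: frequently_def not_less)
  moreover have "\<forall>\<^sub>F t in at_top. t > T" by (rule eventually_gt_at_top)
  ultimately have "\<exists>\<^sub>F t in at_top. f t > c \<and> t > T" by (rule frequently_rev_mp[OF _ eventually_mono]) auto
  then show ?thesis using that by (auto dest: frequently_ex)
qed

context SL2R_lattice
begin

text \<open>The flow moves points by at most t plus a constant. This keeps the later choice \<kappa>
  = 1 - \<gamma> + \<epsilon> positive.\<close>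

lemma Limsup_orbifold_dist_le_1:
  assumes g: "g \<in> SL2" and h: "h \<in> SL2"
    and \<gamma>: "ereal \<gamma> = Limsup at_top (\<lambda>t::real. ereal (orbifold_dist (pr (geodesic_flow t ** g)) (pr h) / t))"
  shows "\<gamma> \<le> 1"
proof (rule ccontr)
  assume "\<not> \<gamma> \<le> 1"
  then have lt: "ereal ((1 + \<gamma>) / 2) < ereal \<gamma>" by simp
  obtain c where c: "\<And>t. t \<ge> 0 \<Longrightarrow> orbifold_dist (pr (geodesic_flow t ** g)) (pr h) \<le> t + c"
    using orbifold_dist_geodesic_le[OF g h] by blast
  obtain t where t: "t > max 1 (2 * \<bar>c\<bar> / (\<gamma> - 1))"
    "orbifold_dist (pr (geodesic_flow t ** g)) (pr h) / t > (1 + \<gamma>) / 2"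
    using Limsup_frequently_gt[OF lt[unfolded \<gamma>]] by blast
  have "(1 + \<gamma>) / 2 * t < t + c" using t c[of t] by (simp add: less_divide_eq)
  then have "(\<gamma> - 1) * t < 2 * c" by (simp add: field_simps)
  moreover have "(\<gamma> - 1) * t > 2 * \<bar>c\<bar>" using t \<open>\<not> \<gamma> \<le> 1\<close> by (simp add: field_simps)
  ultimately show False by linarith
qed

text \<open>The inverse of g \<gamma> h^-1 carries g w to h (\<gamma>^-1 w), which has length at
  least c. A short g w thus forces every such product to be large, that is, a large
  distance.\<close>

lemma norm_times_short_vector_ge:
  assumes g: "g \<in> SL2" and h: "det h = 1" and w: "w \<in> parabolic_vectors" and \<gamma>: "\<gamma> \<in> \<Gamma>"
    and c: "\<And>w. w \<in> parabolic_vectors \<Longrightarrow> c \<le> norm (h *v w)"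
  shows "c \<le> norm (g ** \<gamma> ** adj2 h) * norm (g *v w)"
proof -
  let ?P = "g ** \<gamma> ** adj2 h"
  have "adj2 ?P *v (g *v w) = h *v (adj2 \<gamma> *v w)"
    using g by (simp add: adj2_mult matrix_vector_mul_assoc matrix_mul_assoc[symmetric] SL2_cancel)
  moreover have "c \<le> norm (h *v (adj2 \<gamma> *v w))" using w \<gamma> by (intro c parabolic_vectors_act adj2_mem)
  ultimately show ?thesis using norm_matrix_vector_le[of "adj2 ?P" "g *v w"] by simp
qed

text \<open>Run the flow up to the time \<open>T\<close> at which the contracted and the expanded coordinate of the
  short vector are balanced; this keeps the vector as short as the limsup requires.\<close>

lemma deep_excursion:
  assumes g: "g \<in> SL2" and h: "h \<in> SL2" and nc: "\<not> cuspidal \<Gamma> (pr g)"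
    and \<gamma>: "ereal \<gamma> = Limsup at_top (\<lambda>t::real. ereal (orbifold_dist (pr (geodesic_flow t ** g)) (pr h) / t))"
    and b: "0 < b" "b < \<gamma>" "b \<le> 1"
  obtains K where "K > 0"
    "\<And>T\<^sub>0. \<exists>T>T\<^sub>0. \<exists>w\<in>parabolic_vectors. (g *v w)$1 \<noteq> 0 \<and> \<bar>(g *v w)$2\<bar> \<le> exp T * \<bar>(g *v w)$1\<bar>
       \<and> ((g *v w)$1)\<^sup>2 \<le> K * exp (- (1 + b) * T)"
proof -
  obtain K L\<^sub>1 where K: "K > 0" "L\<^sub>1 \<ge> 1"
    "\<And>g L. g \<in> SL2 \<Longrightarrow> L \<ge> L\<^sub>1 \<Longrightarrow> (\<And>\<gamma>. \<gamma> \<in> \<Gamma> \<Longrightarrow> L \<le> norm (g ** \<gamma> ** adj2 h)) \<Longrightarrow>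
      \<exists>w\<in>parabolic_vectors. (norm (g *v w))\<^sup>2 \<le> K / L\<^sup>2"
    using far_imp_short_parabolic_vector[OF h] by metis
  have "\<exists>T>T\<^sub>0. \<exists>w\<in>parabolic_vectors. (g *v w)$1 \<noteq> 0 \<and> \<bar>(g *v w)$2\<bar> \<le> exp T * \<bar>(g *v w)$1\<bar>
       \<and> ((g *v w)$1)\<^sup>2 \<le> K * exp (- (1 + b) * T)" for T\<^sub>0
  proof -
    have lt: "ereal b < ereal \<gamma>" using b by simp
    obtain t where t: "t > max T\<^sub>0 (max 1 (2 * ln L\<^sub>1 / b))"
      "orbifold_dist (pr (geodesic_flow t ** g)) (pr h) / t > b"
      using Limsup_frequently_gt[OF lt[unfolded \<gamma>]] by blast
    define L where "L = exp (b * t / 2)"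
    have L2: "L\<^sup>2 = exp (b * t)" by (simp add: L_def power2_eq_square exp_add[symmetric])
    have "\<not> orbifold_dist (pr (geodesic_flow t ** g)) (pr h) < b * t" using t by (simp add: less_divide_eq)
    moreover have gt: "geodesic_flow t ** g \<in> SL2" using g geodesic_flow_SL2 by blast
    ultimately have far: "2 * cosh (b * t) \<le> (norm (geodesic_flow t ** g ** \<gamma> ** adj2 h))\<^sup>2" if "\<gamma> \<in> \<Gamma>" for \<gamma>
      using orbifold_dist_less_iff[OF gt h, of "b * t"] that t b by (auto simp: not_less)
    have "L \<le> norm (geodesic_flow t ** g ** \<gamma> ** adj2 h)" if "\<gamma> \<in> \<Gamma>" for \<gamma>
    proof (rule power2_le_imp_le)
      have "L\<^sup>2 \<le> 2 * cosh (b * t)" by (simp add: L2 cosh_def)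
      then show "L\<^sup>2 \<le> (norm (geodesic_flow t ** g ** \<gamma> ** adj2 h))\<^sup>2" using far[OF that] by linarith
    qed simp
    moreover have "L \<ge> L\<^sub>1"
    proof -
      have "ln L\<^sub>1 \<le> b * t / 2" using t b by (simp add: field_simps)
      then have "exp (ln L\<^sub>1) \<le> L" unfolding L_def by simp
      then show ?thesis using K(2) by simp
    qed
    ultimately obtain w where w: "w \<in> parabolic_vectors"
      and "(norm ((geodesic_flow t ** g) *v w))\<^sup>2 \<le> K / L\<^sup>2" using K(3)[OF gt] by blast
    then have n: "(norm (geodesic_flow t *v (g *v w)))\<^sup>2 \<le> K * exp (- (b * t))"
      by (simp add: L2 matrix_vector_mul_assoc exp_minus divide_inverse)
    define v where "v = g *v w"
    \<comment> \<open>The point at which noncuspidality enters: otherwise the flow would contract v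
      forever.\<close>
    have v1: "v$1 \<noteq> 0" using cuspidal_if_contracted[OF g w] nc by (auto simp: v_def)
    have gv: "(norm (geodesic_flow t *v v))\<^sup>2 = exp t * (v$1)\<^sup>2 + exp (- t) * (v$2)\<^sup>2"
      by (simp add: norm_sq_vec2 matrix_vector_nth2 geodesic_flow_mat2 power_mult_distrib)
        (simp add: power2_eq_square exp_add[symmetric])
    have nn: "0 \<le> exp t * (v$1)\<^sup>2" "0 \<le> exp (- t) * (v$2)\<^sup>2" by simp_all
    have e: "exp t * (v$1)\<^sup>2 \<le> K * exp (- (b * t))" "exp (- t) * (v$2)\<^sup>2 \<le> K * exp (- (b * t))"
      using n nn unfolding v_def[symmetric] gv by linarith+
    have "exp (- t) * (exp t * (v$1)\<^sup>2) \<le> exp (- t) * (K * exp (- (b * t)))"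
      using e(1) by (rule mult_left_mono) simp
    then have e1: "(v$1)\<^sup>2 \<le> K * exp (- (1 + b) * t)"
      by (simp add: mult.assoc[symmetric] exp_add[symmetric]) (simp add: mult_ac exp_add[symmetric] algebra_simps)
    have "exp t * (exp (- t) * (v$2)\<^sup>2) \<le> exp t * (K * exp (- (b * t)))"
      using e(2) by (rule mult_left_mono) simp
    then have e2: "(v$2)\<^sup>2 \<le> K * exp ((1 - b) * t)"
      by (simp add: mult.assoc[symmetric] exp_add[symmetric]) (simp add: mult_ac exp_add[symmetric] algebra_simps)
    show ?thesis
    proof (cases "\<bar>v$2\<bar> \<le> exp t * \<bar>v$1\<bar>")
      case True
      then show ?thesis using t w v1 e1 by (intro exI[of _ t]) (auto simp: v_def)
    next
      case False
      \<comment> \<open>The balancing time, later than t. Since v2 = O(e^((1 - b) t / 2)) and b <=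
        1, the bound survives replacing t by T, and v1^2 = e^(-2 T) v2^2.\<close>
      define T where "T = ln (\<bar>v$2\<bar> / \<bar>v$1\<bar>)"
      have gt: "exp t < \<bar>v$2\<bar> / \<bar>v$1\<bar>" using False v1 by (simp add: field_simps)
      then have pos: "\<bar>v$2\<bar> / \<bar>v$1\<bar> > 0" using exp_gt_zero[of t] by linarith
      then have eT: "exp T = \<bar>v$2\<bar> / \<bar>v$1\<bar>" by (simp add: T_def)
      then have tT: "t < T" using gt by (metis exp_less_cancel_iff)
      have "\<bar>v$2\<bar> = exp T * \<bar>v$1\<bar>" using v1 by (simp add: eT)
      then have "\<bar>v$2\<bar>\<^sup>2 = (exp T * \<bar>v$1\<bar>)\<^sup>2" by simp
      then have "(v$2)\<^sup>2 = exp (2 * T) * (v$1)\<^sup>2" by (simp add: power_mult_distrib exp_double)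
      then have "(v$1)\<^sup>2 = exp (- (2 * T)) * (v$2)\<^sup>2" by (simp add: exp_minus)
      also have "\<dots> \<le> exp (- (2 * T)) * (K * exp ((1 - b) * T))"
      proof (rule mult_left_mono)
        have "(1 - b) * t \<le> (1 - b) * T" using tT b by (intro mult_left_mono) auto
        then have "K * exp ((1 - b) * t) \<le> K * exp ((1 - b) * T)" using K(1) by simp
        then show "(v$2)\<^sup>2 \<le> K * exp ((1 - b) * T)" using e2 by linarith
      qed simp
      also have "\<dots> = K * (exp (- (2 * T)) * exp ((1 - b) * T))" by simp
      also have "exp (- (2 * T)) * exp ((1 - b) * T) = exp (- (1 + b) * T)"
        unfolding exp_add[symmetric] by (simp add: algebra_simps)
      finally have "(v$1)\<^sup>2 \<le> K * exp (- (1 + b) * T)" .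
      moreover have "T > T\<^sub>0" using tT t by simp
      ultimately show ?thesis using w v1 \<open>\<bar>v$2\<bar> = exp T * \<bar>v$1\<bar>\<close>
        by (intro exI[of _ T]) (auto simp: v_def)
    qed
  qed
  then show ?thesis using K(1) that by blast
qed

end

lemma hyp_dist_commute: "hyp_dist z w = hyp_dist w z"
  by (simp add: hyp_dist_def norm_minus_commute mult_ac)

lemma orbifold_dist_commute: "orbifold_dist x y = orbifold_dist y x"
proof -
  have "(\<lambda>(a, b). hyp_dist (half_plane_point a) (half_plane_point b)) ` (x \<times> y)
      = (\<lambda>(a, b). hyp_dist (half_plane_point a) (half_plane_point b)) ` prod.swap ` (x \<times> y)"
    unfolding image_image by (intro image_cong) (auto simp: hyp_dist_commute)
  then show ?thesis unfolding orbifold_dist_def by (simp add: product_swap)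
qed

section \<open>Time spent outside the ball\<close>

context SL2R_lattice
begin

lemma orbifold_ball_eq_near:
  assumes h: "h \<in> SL2" and R: "R \<ge> 0"
  shows "orbifold_ball \<Gamma> (pr h) R = pr ` near h (sqrt (2 * cosh R))"
proof -
  have "orbifold_dist (pr g) (pr h) < R \<longleftrightarrow> g \<in> near h (sqrt (2 * cosh R))" if g: "g \<in> SL2" for g
  proof -
    have "norm (g ** \<gamma> ** adj2 h) < sqrt (2 * cosh R) \<longleftrightarrow> (norm (g ** \<gamma> ** adj2 h))\<^sup>2 < 2 * cosh R" for \<gamma>
      using real_less_rsqrt[of "norm (g ** \<gamma> ** adj2 h)"] real_sqrt_less_mono[of "(norm (g ** \<gamma> ** adj2 h))\<^sup>2" "2 * cosh R"]
      by (metis norm_ge_zero real_sqrt_abs abs_of_nonneg real_sqrt_less_iff)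
    then show ?thesis using orbifold_dist_less_iff[OF g h R] g by (simp add: near_def)
  qed
  moreover have "near h L \<subseteq> SL2" for L by (auto simp: near_def)
  ultimately show ?thesis
    by (auto simp: orbifold_ball_def quotient_space_eq orbifold_dist_commute[of "pr h"])
qed

theorem horocycle_discrepancy:
  assumes g: "g \<in> SL2" and h: "h \<in> SL2" and nc: "\<not> cuspidal \<Gamma> (pr g)"
    and \<gamma>: "ereal \<gamma> = Limsup at_top (\<lambda>t::real. ereal (orbifold_dist (pr (geodesic_flow t ** g)) (pr h) / t))"
    and \<epsilon>: "0 < \<epsilon>" "\<epsilon> < \<gamma>"
  obtains s\<^sub>0 \<kappa> where "s\<^sub>0 > S" "\<kappa> > 0"
    "2 * s\<^sub>0 * measure \<mu> (orbifold_ball \<Gamma> (pr h) (\<kappa> * ln s\<^sub>0))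
      - (LINT s:{-s\<^sub>0..s\<^sub>0}|lborel. (indicator (orbifold_ball \<Gamma> (pr h) (\<kappa> * ln s\<^sub>0)) (pr (horocycle_flow s ** g)) :: real))
      \<ge> s\<^sub>0 powr (\<gamma> - \<epsilon>)"
proof -
  have \<gamma>1: "\<gamma> \<le> 1" using Limsup_orbifold_dist_le_1[OF g h \<gamma>] .
  define \<kappa> where "\<kappa> = 1 - \<gamma> + \<epsilon>"
  define b where "b = \<gamma> - \<epsilon> / 2"
  define \<beta> where "\<beta> = \<gamma> - 3 * \<epsilon> / 4"
  define \<alpha> where "\<alpha> = \<gamma> - \<epsilon>"
  have \<kappa>: "\<kappa> > 0" using \<gamma>1 \<epsilon> by (simp add: \<kappa>_def)
  have b: "0 < b" "b < \<gamma>" "b \<le> 1" using \<gamma>1 \<epsilon> by (simp_all add: b_def)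
  have \<beta>: "0 < \<beta>" "\<alpha> < \<beta>" "\<alpha> < 1" using \<gamma>1 \<epsilon> by (simp_all add: \<beta>_def \<alpha>_def)
  obtain K where K: "K > 0"
    "\<And>T\<^sub>0. \<exists>T>T\<^sub>0. \<exists>w\<in>parabolic_vectors. (g *v w)$1 \<noteq> 0 \<and> \<bar>(g *v w)$2\<bar> \<le> exp T * \<bar>(g *v w)$1\<bar>
       \<and> ((g *v w)$1)\<^sup>2 \<le> K * exp (- (1 + b) * T)"
    using deep_excursion[OF g h nc \<gamma> b] by metis
  obtain K\<^sub>2 L\<^sub>2 where K2: "K\<^sub>2 > 0" "L\<^sub>2 \<ge> 1" "\<And>L. L \<ge> L\<^sub>2 \<Longrightarrow> measure \<mu> (pr ` near h L) \<ge> 1 - K\<^sub>2 / L\<^sup>2"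
    using measure_near_ge[OF h] by metis
  obtain c where c: "c > 0" "\<And>w. w \<in> parabolic_vectors \<Longrightarrow> c \<le> norm (h *v w)"
    using parabolic_vectors_lower_bound[of h] h by (metis SL2_iff)
  \<comment> \<open>Chosen so that 4 K \<open>c\<^sub>2\<close> = c^2 / 2. The 4 bounds the loss
    2^(1 + b) in passing from e^T to \<open>s\<^sub>0\<close>, and the 1/2 supplies the factor 2 in
    2 cosh R <= 2 e^R.\<close>
  define c\<^sub>2 where "c\<^sub>2 = c\<^sup>2 / (8 * K)"
  have c2: "c\<^sub>2 > 0" using c K by (simp add: c\<^sub>2_def)
  \<comment> \<open>The conditions absorb the 1 in 1 + (s - z)^2, fit the loss 2
    \<open>K\<^sub>2\<close> s^\<alpha> plus the desired s^\<alpha> into either bound defining l,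
    and make the ball large enough for the measure estimate. Exponents 0 and 1 are written out to
    match \<open>eventually_powr_dominates\<close>.\<close>
  have "\<forall>\<^sub>F s in at_top. s > max 1 S \<and> 1 * s powr 0 \<le> (3/4 * c\<^sub>2) * s powr (2 * \<beta>)
      \<and> (2 * K\<^sub>2 + 1) * s powr \<alpha> \<le> (sqrt c\<^sub>2 / 2) * s powr \<beta>
      \<and> (2 * K\<^sub>2 + 1) * s powr \<alpha> \<le> (1 / 2) * s powr 1 \<and> L\<^sub>2\<^sup>2 * s powr 0 \<le> 1 * s powr \<kappa>"
    using c2 \<beta> \<kappa> by (intro eventually_conj eventually_gt_at_top eventually_powr_dominates) auto
  then obtain s\<^sub>1 where s1: "\<And>s. s \<ge> s\<^sub>1 \<Longrightarrow> s > max 1 S \<and> 1 * s powr 0 \<le> (3/4 * c\<^sub>2) * s powr (2 * \<beta>)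
      \<and> (2 * K\<^sub>2 + 1) * s powr \<alpha> \<le> (sqrt c\<^sub>2 / 2) * s powr \<beta>
      \<and> (2 * K\<^sub>2 + 1) * s powr \<alpha> \<le> (1 / 2) * s powr 1 \<and> L\<^sub>2\<^sup>2 * s powr 0 \<le> 1 * s powr \<kappa>"
    by (auto simp: eventually_at_top_linorder)
  obtain T w where T: "T > ln (max s\<^sub>1 1)" and w: "w \<in> parabolic_vectors" "(g *v w)$1 \<noteq> 0"
    "\<bar>(g *v w)$2\<bar> \<le> exp T * \<bar>(g *v w)$1\<bar>" "((g *v w)$1)\<^sup>2 \<le> K * exp (- (1 + b) * T)"
    using K(2) by metis
  \<comment> \<open>Then |z| <= e^T = \<open>s\<^sub>0\<close>/2, and an interval of length at most
    \<open>s\<^sub>0\<close>/2 starting at z stays in the window.\<close>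
  define s\<^sub>0 where "s\<^sub>0 = 2 * exp T"
  have "max s\<^sub>1 1 = exp (ln (max s\<^sub>1 1))" by simp
  also have "\<dots> < exp T" using T by (simp only: exp_less_cancel_iff)
  finally have "s\<^sub>1 \<le> s\<^sub>0" unfolding s\<^sub>0_def using exp_gt_zero[of T] by linarith
  from s1[OF this] have s0: "s\<^sub>0 > 1" "s\<^sub>0 > S" "1 \<le> (3/4 * c\<^sub>2) * s\<^sub>0 powr (2 * \<beta>)"
    "(2 * K\<^sub>2 + 1) * s\<^sub>0 powr \<alpha> \<le> (sqrt c\<^sub>2 / 2) * s\<^sub>0 powr \<beta>"
    "(2 * K\<^sub>2 + 1) * s\<^sub>0 powr \<alpha> \<le> s\<^sub>0 / 2" "L\<^sub>2\<^sup>2 \<le> s\<^sub>0 powr \<kappa>" by auto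
  define R where "R = \<kappa> * ln s\<^sub>0"
  have R: "R \<ge> 0" "exp R = s\<^sub>0 powr \<kappa>" using s0 \<kappa> by (simp_all add: R_def powr_def)
  define C where "C = orbifold_ball \<Gamma> (pr h) R"
  define v where "v = g *v w"
  define z where "z = - v$2 / v$1"
  have v1: "v$1 \<noteq> 0" using w(2) by (simp add: v_def)
  have z: "\<bar>z\<bar> \<le> s\<^sub>0 / 2" using w(3) v1 by (simp add: z_def v_def s\<^sub>0_def abs_divide field_simps)
  define l where "l = min (sqrt c\<^sub>2 / 2 * s\<^sub>0 powr \<beta>) (s\<^sub>0 / 2)"
  have l0: "l \<ge> 0" using c2 s0 by (simp add: l_def)
  have outside: "pr (horocycle_flow s ** g) \<notin> C" if s: "s \<in> {z..z + l}" for s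
  proof -
    let ?hg = "horocycle_flow s ** g"
    have hg: "?hg \<in> SL2" using g horocycle_flow_SL2 by blast
    define u where "u = ?hg *v w"
    have u: "u$1 = v$1" "u$2 = (s - z) * v$1" using v1
      by (simp_all add: u_def v_def matrix_vector_mul_assoc[symmetric] z_def horocycle_flow_mat2
          matrix_vector_nth2[of "mat2 _ _ _ _"] field_simps)
    have "(s - z)\<^sup>2 \<le> (sqrt c\<^sub>2 / 2 * s\<^sub>0 powr \<beta>)\<^sup>2" using s by (intro power_mono) (auto simp: l_def)
    also have "\<dots> = c\<^sub>2 / 4 * (s\<^sub>0 powr \<beta> * s\<^sub>0 powr \<beta>)"
      using c2 by (simp add: power_mult_distrib power_divide) (simp add: power2_eq_square)
    also have "s\<^sub>0 powr \<beta> * s\<^sub>0 powr \<beta> = s\<^sub>0 powr (2 * \<beta>)" by (simp add: powr_add[symmetric])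
    finally have "1 + (s - z)\<^sup>2 \<le> c\<^sub>2 * s\<^sub>0 powr (2 * \<beta>)" using s0(3) by (simp add: field_simps)
    moreover have "(v$1)\<^sup>2 \<le> K * (4 * s\<^sub>0 powr (- (1 + b)))"
    proof -
      have "exp (- (1 + b) * T) = (s\<^sub>0 / 2) powr (- (1 + b))" by (simp add: s\<^sub>0_def powr_def)
      also have "\<dots> = 2 powr (1 + b) * s\<^sub>0 powr (- (1 + b))"
      proof -
        have "(s\<^sub>0 / 2) powr (- a) = 2 powr a * s\<^sub>0 powr (- a)" for a
          using s0 by (simp add: powr_divide powr_minus field_simps)
        then show ?thesis .
      qed
      also have "\<dots> \<le> 4 * s\<^sub>0 powr (- (1 + b))"
        using powr_mono[of "1 + b" 2 "2::real"] b by (intro mult_right_mono) auto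
      finally have "K * exp (- (1 + b) * T) \<le> K * (4 * s\<^sub>0 powr (- (1 + b)))" using K by simp
      then show ?thesis using w(4) by (simp add: v_def)
    qed
    ultimately have "(v$1)\<^sup>2 * (1 + (s - z)\<^sup>2) \<le> (K * (4 * s\<^sub>0 powr (- (1 + b)))) * (c\<^sub>2 * s\<^sub>0 powr (2 * \<beta>))"
      by (intro mult_mono) (use K in auto)
    also have "\<dots> = c\<^sup>2 / 2 * (s\<^sub>0 powr (- (1 + b)) * s\<^sub>0 powr (2 * \<beta>))"
      using K by (simp add: c\<^sub>2_def)
    also have "s\<^sub>0 powr (- (1 + b)) * s\<^sub>0 powr (2 * \<beta>) = s\<^sub>0 powr (- \<kappa>)"
      unfolding powr_add[symmetric] by (rule arg_cong) (simp add: b_def \<beta>_def \<kappa>_def)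
    finally have un: "(norm u)\<^sup>2 \<le> c\<^sup>2 / 2 * s\<^sub>0 powr (- \<kappa>)"
      unfolding norm_sq_vec2 u power_mult_distrib by (simp add: distrib_left mult.commute)
    have "2 * cosh R \<le> (norm (?hg ** \<gamma>' ** adj2 h))\<^sup>2" if \<gamma>': "\<gamma>' \<in> \<Gamma>" for \<gamma>'
    proof -
      let ?P = "norm (?hg ** \<gamma>' ** adj2 h)"
      have "c \<le> ?P * norm u"
        unfolding u_def using norm_times_short_vector_ge[OF hg _ w(1) \<gamma>' c(2)] h by (simp add: SL2_iff)
      then have "c\<^sup>2 \<le> (?P * norm u)\<^sup>2" using c(1) by (intro power_mono) auto
      also have "\<dots> \<le> ?P\<^sup>2 * (c\<^sup>2 / 2 * s\<^sub>0 powr (- \<kappa>))"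
        unfolding power_mult_distrib using un by (intro mult_left_mono) auto
      finally have "c\<^sup>2 * 1 \<le> c\<^sup>2 * (?P\<^sup>2 * s\<^sub>0 powr (- \<kappa>) / 2)" by (simp add: mult_ac)
      then have "1 \<le> ?P\<^sup>2 * s\<^sub>0 powr (- \<kappa>) / 2" using c(1) by (subst (asm) mult_le_cancel_left_pos) auto
      then have "2 * s\<^sub>0 powr \<kappa> \<le> ?P\<^sup>2" using s0 by (simp add: powr_minus field_simps)
      moreover have "cosh R \<le> exp R" using R(1) by (simp add: cosh_def)
      ultimately show ?thesis using R(2) by linarith
    qed
    then show ?thesis using orbifold_dist_less_iff[OF hg h R(1)]
      by (auto simp: C_def orbifold_ball_def orbifold_dist_commute[of "pr h"] not_less)
  qed
  have integral: "(LINT s:{-s\<^sub>0..s\<^sub>0}|lborel. (indicator C (pr (horocycle_flow s ** g)) :: real)) \<le> 2 * s\<^sub>0 - l"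
  proof -
    let ?A = "{s \<in> {-s\<^sub>0..s\<^sub>0}. pr (horocycle_flow s ** g) \<in> C}"
    have J: "{z..z + l} \<subseteq> {-s\<^sub>0..s\<^sub>0}" using z by (auto simp: l_def)
    have "(LINT s:{-s\<^sub>0..s\<^sub>0}|lborel. (indicator C (pr (horocycle_flow s ** g)) :: real)) = (LINT s|lborel. indicator ?A s)"
      unfolding set_lebesgue_integral_def by (intro Bochner_Integration.integral_cong) (auto simp: indicator_def)
    also have "\<dots> = measure lborel ?A" by simp
    also have "\<dots> \<le> measure lborel ({-s\<^sub>0..s\<^sub>0} - {z..z + l})"
    \<comment> \<open>For a set that is not measurable, \<open>measure\<close> takes the default
      value 0, which satisfies the bound.\<close>
    proof (cases "?A \<in> sets lborel")
      case True
      have "?A \<subseteq> {-s\<^sub>0..s\<^sub>0} - {z..z + l}" using outside by blast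
      moreover have "{-s\<^sub>0..s\<^sub>0} - {z..z + l} \<in> fmeasurable lborel"
        by (intro fmeasurable.Diff fmeasurable_compact) auto
      ultimately show ?thesis using True by (intro measure_mono_fmeasurable)
    qed (simp add: measure_notin_sets)
    also have "\<dots> = measure lborel {-s\<^sub>0..s\<^sub>0} - measure lborel {z..z + l}"
      using J by (intro measurable_measure_Diff fmeasurable_compact) auto
    also have "\<dots> = 2 * s\<^sub>0 - l" using s0 l0 by simp
    finally show ?thesis .
  qed
  have ball: "measure \<mu> C \<ge> 1 - K\<^sub>2 * s\<^sub>0 powr (- \<kappa>)"
  proof -
    let ?L = "sqrt (2 * cosh R)"
    have L2: "?L\<^sup>2 = 2 * cosh R" by simp
    have eL: "s\<^sub>0 powr \<kappa> \<le> 2 * cosh R" unfolding R(2)[symmetric] by (simp add: cosh_def)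
    have "L\<^sub>2\<^sup>2 \<le> ?L\<^sup>2" unfolding L2 using s0(6) eL by linarith
    then have "L\<^sub>2 \<le> ?L" by (rule power2_le_imp_le) simp
    then have "1 - K\<^sub>2 / (2 * cosh R) \<le> measure \<mu> C"
      using K2(3)[of ?L] R(1) by (simp add: C_def orbifold_ball_eq_near[OF h] L2)
    moreover have "K\<^sub>2 / (2 * cosh R) \<le> K\<^sub>2 / s\<^sub>0 powr \<kappa>"
      using eL K2 s0 by (intro divide_left_mono mult_pos_pos) auto
    moreover have "K\<^sub>2 / s\<^sub>0 powr \<kappa> = K\<^sub>2 * s\<^sub>0 powr (- \<kappa>)" by (simp add: powr_minus_divide)
    ultimately show ?thesis by linarith
  qed
  have "s\<^sub>0 powr 1 * s\<^sub>0 powr (- \<kappa>) = s\<^sub>0 powr \<alpha>"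
    unfolding powr_add[symmetric] by (rule arg_cong) (simp add: \<kappa>_def \<alpha>_def)
  then have p: "s\<^sub>0 * s\<^sub>0 powr (- \<kappa>) = s\<^sub>0 powr \<alpha>" using s0 by simp
  have "2 * s\<^sub>0 * (1 - K\<^sub>2 * s\<^sub>0 powr (- \<kappa>)) \<le> 2 * s\<^sub>0 * measure \<mu> C"
    using ball s0 by (intro mult_left_mono) auto
  moreover have "2 * s\<^sub>0 * (1 - K\<^sub>2 * s\<^sub>0 powr (- \<kappa>)) = 2 * s\<^sub>0 - 2 * K\<^sub>2 * s\<^sub>0 powr \<alpha>"
    unfolding p[symmetric] by (simp add: algebra_simps)
  moreover have "2 * K\<^sub>2 * s\<^sub>0 powr \<alpha> + s\<^sub>0 powr \<alpha> \<le> l"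
    using s0(4,5) by (simp add: l_def distrib_right)
  ultimately have "2 * s\<^sub>0 * measure \<mu> C
      - (LINT s:{-s\<^sub>0..s\<^sub>0}|lborel. (indicator C (pr (horocycle_flow s ** g)) :: real)) \<ge> s\<^sub>0 powr \<alpha>"
    using integral by linarith
  then show ?thesis using s0(2) \<kappa> that unfolding C_def R_def \<alpha>_def by blast
qed

end

theorem theorem2p11:
  fixes \<Gamma> :: "(real^2^2) set" and \<mu> :: "(real^2^2) set measure"
    and x\<^sub>0 x :: "(real^2^2) set" and \<gamma> :: real
  assumes "nonuniform_lattice \<Gamma>"
    and "normalized_haar_quotient \<Gamma> \<mu>"
    and "x\<^sub>0 \<in> quotient_space \<Gamma>" and "x \<in> quotient_space \<Gamma>"
    and "\<not> cuspidal \<Gamma> x"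
    and "ereal \<gamma> = Limsup at_top (\<lambda>t::real. ereal (orbifold_dist (geodesic_flow t \<bullet>\<^sub>X x) x\<^sub>0 / t))"
    and "\<gamma> > 0"
  shows "\<forall>S>0. \<forall>\<epsilon>\<in>{0<..<\<gamma>}. \<forall>\<delta>\<in>{0<..<1}. \<exists>s\<^sub>0>S. \<exists>\<kappa>>0.
    (let C = orbifold_ball \<Gamma> x\<^sub>0 (\<kappa> * ln s\<^sub>0) in
      \<bar>(LINT s:{-s\<^sub>0..s\<^sub>0}|lborel. (indicator C (horocycle_flow s \<bullet>\<^sub>X x) :: real))
          - 2 * s\<^sub>0 * measure \<mu> C\<bar> \<ge> s\<^sub>0 powr (\<gamma> - \<epsilon>) * (1 - \<delta>))"
proof (intro allI impI ballI)
  fix S \<epsilon> \<delta> :: real assume "S > 0" and \<epsilon>: "\<epsilon> \<in> {0<..<\<gamma>}" and \<delta>: "\<delta> \<in> {0<..<1}"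
  obtain m where m: "haar_measure m" "induced_measure \<Gamma> m \<mu>" "emeasure \<mu> (quotient_space \<Gamma>) = 1"
    using assms(2) by (auto simp: normalized_haar_quotient_def)
  have "subgroup \<Gamma> SL2R" "discrete \<Gamma>"
    using assms(1) by (auto simp: nonuniform_lattice_def lattice_in_SL2R_def)
  then interpret SL2R_lattice \<Gamma> m \<mu>
    using m by (intro SL2R_lattice.intro discrete_subgroup_SL2R.intro haar_SL2R.intro
        SL2R_lattice_axioms.intro)
  obtain g h where g: "g \<in> SL2" "x = pr g" and h: "h \<in> SL2" "x\<^sub>0 = pr h"
    using assms(3,4) unfolding quotient_space_eq by blast
  obtain s\<^sub>0 \<kappa> where s: "s\<^sub>0 > S" "\<kappa> > 0"
    "2 * s\<^sub>0 * measure \<mu> (orbifold_ball \<Gamma> x\<^sub>0 (\<kappa> * ln s\<^sub>0))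
      - (LINT s:{-s\<^sub>0..s\<^sub>0}|lborel. (indicator (orbifold_ball \<Gamma> x\<^sub>0 (\<kappa> * ln s\<^sub>0)) (horocycle_flow s \<bullet>\<^sub>X x) :: real))
      \<ge> s\<^sub>0 powr (\<gamma> - \<epsilon>)"
    using horocycle_discrepancy[OF g(1) h(1), of \<gamma> \<epsilon> S] assms(5,6) \<epsilon> unfolding g(2) h(2) act_act by auto
  have "s\<^sub>0 powr (\<gamma> - \<epsilon>) * (1 - \<delta>) \<le> s\<^sub>0 powr (\<gamma> - \<epsilon>) * 1" using \<delta> by (intro mult_left_mono) auto
  then have "s\<^sub>0 powr (\<gamma> - \<epsilon>) * (1 - \<delta>)
      \<le> \<bar>(LINT s:{-s\<^sub>0..s\<^sub>0}|lborel. (indicator (orbifold_ball \<Gamma> x\<^sub>0 (\<kappa> * ln s\<^sub>0)) (horocycle_flow s \<bullet>\<^sub>X x) :: real))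
          - 2 * s\<^sub>0 * measure \<mu> (orbifold_ball \<Gamma> x\<^sub>0 (\<kappa> * ln s\<^sub>0))\<bar>"
    using s(3) by linarith
  then show "\<exists>s\<^sub>0>S. \<exists>\<kappa>>0.
    (let C = orbifold_ball \<Gamma> x\<^sub>0 (\<kappa> * ln s\<^sub>0) in
      \<bar>(LINT s:{-s\<^sub>0..s\<^sub>0}|lborel. (indicator C (horocycle_flow s \<bullet>\<^sub>X x) :: real))
          - 2 * s\<^sub>0 * measure \<mu> C\<bar> \<ge> s\<^sub>0 powr (\<gamma> - \<epsilon>) * (1 - \<delta>))"
    unfolding Let_def using s(1,2) by blast
qed

end
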